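(* Let $\rho_1,\rho_2$ be two boundary-preserving isomorphic Fuchsian representations of $G=\pi_1S$ satisfying the extended Schottky condition, with associated countable Markov shift $(\Sigma^+,\sigma)$ and geometric potentials $\tau,\kappa$. For each $(a,b)\in D$ there exists a unique $t_{a,b}\in\left(\frac{1}{2(a+b)},\infty\right)$ such that $$P_\sigma(-t_{a,b}(a\tau+b\kappa))=0.$$
   Context: $D=\{(x,y)\in\mathbb{R}^2:x\ge0,y\ge0\}\setminus\{(0,0)\}$. $\mathbb{H}$ is the hyperbolic plane (Poincaré disk model), $\partial_\infty\mathbb{H}=S^1$ its boundary, $d$ its distance; $\mathrm{PSL}(2,\mathbb{R})$ acts by isometries. $S$ is a surface with negative Euler characteristic and $G=\pi_1S$. A Fuchsian representation is a discrete faithful representation $\rho:G\to\mathrm{PSL}(2,\mathbb{R})$. Extended Schottky condition: $\rho(G)$ is generated by hyperbolic isometries $h_1,\dots,h_{N_1}$ and parabolic isometries $p_1,\dots,p_{N_2}$ with $N_2\ge1$, $N_1+N_2\ge3$, such that: (C1) for each $i$ there are compact neighborhoods $C_{h_i}$, $C_{h_i^{-1}}$ in $S^1$ of the attracting and repelling fixed points of $h_i$ with $h_i(S^1\setminus C_{h_i^{-1}})\subset C_{h_i}$; (C2) for each $i$ there is a compact neighborhood $C_{p_i}$ in $S^1$ of the fixed point of $p_i$ with $p_i^n(S^1\setminus C_{p_i})\subset C_{p_i}$ for all $n\in\mathbb{Z}\setminus\{0\}$; (C3) these $2N_1+N_2$ neighborhoods are pairwise disjoint. Such a group is free on these generators.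 Boundary-preserving isomorphic: the isomorphism $\iota=\rho_2\circ\rho_1^{-1}:\rho_1(G)\to\rho_2(G)$ sends hyperbolic elements to hyperbolic elements and parabolic elements to parabolic elements, and $\gamma\in\rho_1(G)$ corresponds to a geodesic boundary of $S_1=\rho_1(G)\backslash\mathbb{H}$ iff $\iota(\gamma)$ corresponds to a geodesic boundary of $S_2=\rho_2(G)\backslash\mathbb{H}$. Generators $\mathcal{A}=\{h_1,\dots,h_{N_1},p_1,\dots,p_{N_2}\}$ of $G$ are fixed so that for $i=1,2$ the elements $\rho_i(h_j)$ are hyperbolic, $\rho_i(p_k)$ are parabolic, and they are extended Schottky generators of $\rho_i(G)$. Markov shift: $\Sigma^+=\{(a_i^{n_i})_{i\ge1}:a_i\in\mathcal{A},\ n_i\in\mathbb{Z}\setminus\{0\},\ a_i\ne a_{i+1}\}$ with alphabet $\{a^n:a\in\mathcal{A},n\in\mathbb{Z}\setminus\{0\}\}$, and $\sigma$ the left shift. Geometric potentials: let $\Lambda_i^0$ be the limit set of $\rho_i(G)$ minus the $\rho_i(G)$-orbits of fixed points of $\rho_i(\alpha)$, $\alpha\in\mathcal{A}$. There is a bijection $\omega_i:\Lambda_i^0\to\Sigma^+$ with $\omega_i^{-1}(x)=\lim_k\rho_i(a_1^{n_1}\cdots a_k^{n_k})o$ for $x=a_1^{n_1}a_2^{n_2}\cdots$ ($o$ the origin of the disk). With the Busemann function $B_\xi(x,y)=\lim_{z\to\xi}\big(d(x,z)-d(y,z)\big)$, put $\tau(x)=B_{\omega_1^{-1}(x)}(o,\rho_1(a_1^{n_1})o)$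 and $\kappa(x)=B_{\omega_2^{-1}(x)}(o,\rho_2(a_1^{n_1})o)$. (The paper also writes $\tau,\kappa$ for cohomologous locally Hölder functions bounded away from $0$; this does not change pressures.) Gurevich pressure: $P_\sigma(g)=\lim_{n\to\infty}\frac1n\log\sum_{x:\sigma^nx=x}e^{S_ng(x)}\chi_{[s]}(x)$ with $S_ng=\sum_{i=0}^{n-1}g\circ\sigma^i$ and $[s]$ the set of sequences whose first symbol is $s$; it is independent of the symbol $s$. *)

theory Defs
  imports "HOL-Analysis.Analysis" "HOL-Homology.Homology"
begin

definition SL2R :: "(real^2^2) monoid" where
  "SL2R = \<lparr>carrier = {A. det A = 1}, mult = (**), one = mat 1\<rparr>"

definition PSL2R :: "(real^2^2) set monoid" where
  "PSL2R = SL2R Mod {mat 1, - mat 1}"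

text \<open>
  The upper half-plane map \<open>z \<mapsto> (a z + b) / (c z + d)\<close>, conjugated by the Cayley transform
  \<open>z \<mapsto> (z - \<i>) / (z + \<i>)\<close> (see the lemma below). In this form the action is defined on the whole
  closed unit disk, without a point at infinity.
\<close>

definition disk_moebius :: "real^2^2 \<Rightarrow> complex \<Rightarrow> complex" where
  "disk_moebius A w =
     (let \<alpha> = Complex ((A$1$1 + A$2$2) / 2) ((A$1$2 - A$2$1) / 2);
          \<beta> = Complex ((A$1$1 - A$2$2) / 2) (- (A$1$2 + A$2$1) / 2)
      in (\<alpha> * w + \<beta>) / (cnj \<beta> * w + cnj \<alpha>))"

lemma disk_moebius_Cayley:
  fixes A :: "real^2^2" and z :: complex
  assumes "det A = 1" and z: "Im z > 0"
  defines "z' \<equiv> (A$1$1 * z + A$1$2) / (A$2$1 * z + A$2$2)"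
  shows "disk_moebius A ((z - \<i>) / (z + \<i>)) = (z' - \<i>) / (z' + \<i>)"
proof -
  define a b c d where abcd: "a = A$1$1" "b = A$1$2" "c = A$2$1" "d = A$2$2"
  define \<alpha> where "\<alpha> = Complex ((a + d) / 2) ((b - c) / 2)"
  define \<beta> where "\<beta> = Complex ((a - d) / 2) (- (b + c) / 2)"
  have det: "a * d - b * c = 1"
    using assms(1) by (simp add: det_2 abcd)
  have zi: "z + \<i> \<noteq> 0"
    using z by (auto simp: complex_eq_iff)
  have den: "c * z + d \<noteq> 0"
  proof
    assume "c * z + d = 0"
    then have "c * Im z = 0" "c * Re z + d = 0"
      by (auto simp: complex_eq_iff)
    with z det show False
      by auto
  qed
  have num: "\<alpha> * (z - \<i>) + \<beta> * (z + \<i>) = (a * z + b) - \<i> * (c * z + d)"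
    by (simp add: \<alpha>_def \<beta>_def complex_eq_iff field_simps)
  have dnm: "cnj \<beta> * (z - \<i>) + cnj \<alpha> * (z + \<i>) = (a * z + b) + \<i> * (c * z + d)"
    by (simp add: \<alpha>_def \<beta>_def complex_eq_iff field_simps)
  have "disk_moebius A ((z - \<i>) / (z + \<i>)) =
      (\<alpha> * ((z - \<i>) / (z + \<i>)) + \<beta>) / (cnj \<beta> * ((z - \<i>) / (z + \<i>)) + cnj \<alpha>)"
    by (simp add: disk_moebius_def Let_def \<alpha>_def \<beta>_def abcd)
  also have "\<dots> = ((\<alpha> * (z - \<i>) + \<beta> * (z + \<i>)) / (z + \<i>)) /
                   ((cnj \<beta> * (z - \<i>) + cnj \<alpha> * (z + \<i>)) / (z + \<i>))"
    using zi by (simp add: add_divide_distrib)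
  also have "\<dots> = ((a * z + b) - \<i> * (c * z + d)) / ((a * z + b) + \<i> * (c * z + d))"
    using zi by (simp add: num dnm)
  also have "\<dots> = (((a * z + b) - \<i> * (c * z + d)) / (c * z + d)) /
                   (((a * z + b) + \<i> * (c * z + d)) / (c * z + d))"
    using den by simp
  also have "\<dots> = (z' - \<i>) / (z' + \<i>)"
    using den by (simp add: z'_def abcd add_divide_distrib diff_divide_distrib)
  finally show ?thesis .
qed

lemma disk_moebius_uminus: "disk_moebius (- A) w = disk_moebius A w"
proof -
  define \<alpha> \<beta> where "\<alpha> = Complex ((A$1$1 + A$2$2) / 2) ((A$1$2 - A$2$1) / 2)"
    and "\<beta> = Complex ((A$1$1 - A$2$2) / 2) (- (A$1$2 + A$2$1) / 2)"
  have "Complex (((- A)$1$1 + (- A)$2$2) / 2) (((- A)$1$2 - (- A)$2$1) / 2) = - \<alpha>"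
       "Complex (((- A)$1$1 - (- A)$2$2) / 2) (- ((- A)$1$2 + (- A)$2$1) / 2) = - \<beta>"
    by (simp_all add: \<alpha>_def \<beta>_def complex_eq_iff field_simps)
  then have "disk_moebius (- A) w = (- (\<alpha> * w + \<beta>)) / (- (cnj \<beta> * w + cnj \<alpha>))"
    unfolding disk_moebius_def Let_def by simp
  also have "\<dots> = disk_moebius A w"
    unfolding minus_divide_divide by (simp add: disk_moebius_def Let_def \<alpha>_def \<beta>_def)
  finally show ?thesis .
qed

text \<open>
  An element of PSL(2,R) is a set \<open>{A, -A}\<close> of matrices, both of which act in the same way.
\<close>

definition psl_act :: "(real^2^2) set \<Rightarrow> complex \<Rightarrow> complex" where
  "psl_act g w = the_elem ((\<lambda>A. disk_moebius A w) ` g)"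

lemma psl_act_coset: "psl_act ({mat 1, - mat 1} #>\<^bsub>SL2R\<^esub> A) w = disk_moebius A w"
proof -
  have "{mat 1, - mat 1} #>\<^bsub>SL2R\<^esub> A = {A, - A}"
    by (auto simp: r_coset_def SL2R_def matrix_matrix_mult_def mat_def vec_eq_iff sum_2 forall_2)
  then show ?thesis
    by (simp add: psl_act_def disk_moebius_uminus)
qed

definition hyperbolic :: "(real^2^2) set \<Rightarrow> bool" where
  "hyperbolic g \<longleftrightarrow> g \<in> carrier PSL2R \<and> card {\<xi> \<in> sphere 0 1. psl_act g \<xi> = \<xi>} = 2"

definition parabolic :: "(real^2^2) set \<Rightarrow> bool" where
  "parabolic g \<longleftrightarrow> g \<in> carrier PSL2R \<and> card {\<xi> \<in> sphere 0 1. psl_act g \<xi> = \<xi>} = 1"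

definition attracting_fixpoint :: "(real^2^2) set \<Rightarrow> complex" where
  "attracting_fixpoint g =
     (THE \<xi>. \<xi> \<in> sphere 0 1 \<and> psl_act g \<xi> = \<xi> \<and>
        (\<forall>z\<in>ball 0 1. (\<lambda>n::nat. psl_act (g [^]\<^bsub>PSL2R\<^esub> n) z) \<longlonglongrightarrow> \<xi>))"

definition repelling_fixpoint :: "(real^2^2) set \<Rightarrow> complex" where
  "repelling_fixpoint g = attracting_fixpoint (inv\<^bsub>PSL2R\<^esub> g)"

definition parabolic_fixpoint :: "(real^2^2) set \<Rightarrow> complex" where
  "parabolic_fixpoint g = (THE \<xi>. \<xi> \<in> sphere 0 1 \<and> psl_act g \<xi> = \<xi>)"

text \<open>Curvature \<open>-1\<close>; the formula is meaningful for \<open>z, w\<close> in the open unit disk.\<close>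

definition hdist :: "complex \<Rightarrow> complex \<Rightarrow> real" where
  "hdist z w = arcosh (1 + 2 * (cmod (z - w))\<^sup>2 / ((1 - (cmod z)\<^sup>2) * (1 - (cmod w)\<^sup>2)))"

definition busemann :: "complex \<Rightarrow> complex \<Rightarrow> complex \<Rightarrow> real" where
  "busemann \<xi> x y = Lim (at \<xi> within ball 0 1) (\<lambda>z. hdist x z - hdist y z)"

definition geodesic_from_to :: "(real \<Rightarrow> complex) \<Rightarrow> complex \<Rightarrow> complex \<Rightarrow> bool" where
  "geodesic_from_to c \<xi> \<eta> \<longleftrightarrow>
     range c \<subseteq> ball 0 1 \<and> (\<forall>s t. hdist (c s) (c t) = \<bar>s - t\<bar>) \<and>
     (c \<longlongrightarrow> \<xi>) at_bot \<and> (c \<longlongrightarrow> \<eta>) at_top"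

definition hconvex :: "complex set \<Rightarrow> bool" where
  "hconvex K \<longleftrightarrow> K \<subseteq> ball 0 1 \<and>
     (\<forall>z\<in>K. \<forall>w\<in>K. \<forall>u\<in>ball 0 1. hdist z u + hdist u w = hdist z w \<longrightarrow> u \<in> K)"

definition limit_set :: "(real^2^2) set set \<Rightarrow> complex set" where
  "limit_set \<Gamma> = {\<xi> \<in> sphere 0 1. \<xi> islimpt ((\<lambda>g. psl_act g 0) ` \<Gamma>)}"

text \<open>
  The universal cover of the convex core of the quotient surface: the convex hull of the limit set.
\<close>

definition convex_core :: "(real^2^2) set set \<Rightarrow> complex set" where
  "convex_core \<Gamma> =
     \<Inter>{K. hconvex K \<and>
        (\<forall>\<xi>\<in>limit_set \<Gamma>. \<forall>\<eta>\<in>limit_set \<Gamma>. \<forall>c. geodesic_from_to c \<xi> \<eta> \<longrightarrow> range c \<subseteq> K)}"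

text \<open>
  The geodesic boundary of the quotient surface is the boundary of its convex core; a hyperbolic
  element corresponds to a component of it iff its axis lies in the boundary of the hull.
\<close>

definition geodesic_boundary :: "(real^2^2) set set \<Rightarrow> (real^2^2) set \<Rightarrow> bool" where
  "geodesic_boundary \<Gamma> g \<longleftrightarrow> g \<in> \<Gamma> \<and> hyperbolic g \<and>
     (\<forall>c. geodesic_from_to c (repelling_fixpoint g) (attracting_fixpoint g) \<longrightarrow>
        range c \<subseteq> frontier (convex_core \<Gamma>))"

text \<open>Surfaces may have boundary.\<close>

definition surface :: "'s::topological_space set \<Rightarrow> bool" where
  "surface S \<longleftrightarrow> S \<noteq> {} \<and> connected S \<and>
     Hausdorff_space (top_of_set S) \<and> second_countable (top_of_set S) \<and>
     (\<forall>x\<in>S. \<exists>U V. openin (top_of_set S) U \<and> x \<in> U \<and>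
        openin (top_of_set {z::complex. Im z \<ge> 0}) V \<and> U homeomorphic V)"

definition fundamental_group ::
    "'s::topological_space set \<Rightarrow> 's \<Rightarrow> (real \<Rightarrow> 's) set monoid" where
  "fundamental_group S x =
     \<lparr>carrier = (\<lambda>p. {q. homotopic_paths S p q}) `
          {p. path p \<and> path_image p \<subseteq> S \<and> pathstart p = x \<and> pathfinish p = x},
      mult = (\<lambda>P Q. {r. \<exists>p\<in>P. \<exists>q\<in>Q. homotopic_paths S (p +++ q) r}),
      one = {q. homotopic_paths S (\<lambda>_. x) q}\<rparr>"

definition abelian_rank :: "('a, 'm) monoid_scheme \<Rightarrow> nat" where
  "abelian_rank H =
     (GREATEST n. \<exists>B \<subseteq> carrier H. finite B \<and> card B = n \<and>
        (\<forall>c :: 'a \<Rightarrow> int. finprod H (\<lambda>b. b [^]\<^bsub>H\<^esub> c b) B = \<one>\<^bsub>H\<^esub> \<longrightarrow> (\<forall>b\<in>B. c b = 0)))"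

text \<open>The homology of a surface vanishes above degree 2.\<close>

definition euler_characteristic :: "'s::topological_space set \<Rightarrow> int" where
  "euler_characteristic S =
     (\<Sum>k\<le>2. (- 1) ^ k * int (abelian_rank (homology_group (int k) (top_of_set S))))"

text \<open>
  A set of elements of PSL(2,R) is discrete iff its preimage under the two-fold covering
  \<open>SL(2,R) \<rightarrow> PSL(2,R)\<close>, which is its union, is discrete.
\<close>

definition fuchsian :: "('g, 'm) monoid_scheme \<Rightarrow> ('g \<Rightarrow> (real^2^2) set) \<Rightarrow> bool" where
  "fuchsian G \<rho> \<longleftrightarrow>
     \<rho> \<in> hom G PSL2R \<and> inj_on \<rho> (carrier G) \<and> discrete (\<Union>(\<rho> ` carrier G))"

definition boundary_preserving ::
    "('g, 'm) monoid_scheme \<Rightarrow> ('g \<Rightarrow> (real^2^2) set) \<Rightarrow> ('g \<Rightarrow> (real^2^2) set) \<Rightarrow> bool" where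
  "boundary_preserving G \<rho>1 \<rho>2 \<longleftrightarrow>
     (let \<iota> = \<rho>2 \<circ> inv_into (carrier G) \<rho>1;
          \<Gamma>1 = \<rho>1 ` carrier G; \<Gamma>2 = \<rho>2 ` carrier G
      in \<forall>\<gamma>\<in>\<Gamma>1. (hyperbolic \<gamma> \<longrightarrow> hyperbolic (\<iota> \<gamma>)) \<and>
                (parabolic \<gamma> \<longrightarrow> parabolic (\<iota> \<gamma>)) \<and>
                (geodesic_boundary \<Gamma>1 \<gamma> \<longleftrightarrow> geodesic_boundary \<Gamma>2 (\<iota> \<gamma>)))"

definition compact_nbhd :: "complex set \<Rightarrow> complex \<Rightarrow> bool" where
  "compact_nbhd C \<xi> \<longleftrightarrow> compact C \<and> C \<subseteq> sphere 0 1 \<and>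
     (\<exists>U. openin (top_of_set (sphere 0 1)) U \<and> \<xi> \<in> U \<and> U \<subseteq> C)"

text \<open>
  Indexing the neighbourhoods by labels, not by group elements, makes disjointness range over all
  \<open>2 * N1 + N2\<close> of them; in particular the generators are distinct.
\<close>

datatype label = Att nat | Rep nat | Par nat

definition extended_schottky_generators ::
    "nat \<Rightarrow> nat \<Rightarrow> (nat \<Rightarrow> (real^2^2) set) \<Rightarrow> (nat \<Rightarrow> (real^2^2) set) \<Rightarrow> (real^2^2) set set \<Rightarrow> bool"
  where
  "extended_schottky_generators N1 N2 h p \<Gamma> \<longleftrightarrow>
     N2 \<ge> 1 \<and> N1 + N2 \<ge> 3 \<and>
     (\<forall>i<N1. hyperbolic (h i)) \<and> (\<forall>i<N2. parabolic (p i)) \<and>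
     generate PSL2R (h ` {..<N1} \<union> p ` {..<N2}) = \<Gamma> \<and>
     (\<exists>C :: label \<Rightarrow> complex set.
        (\<forall>i<N1. compact_nbhd (C (Att i)) (attracting_fixpoint (h i)) \<and>
                compact_nbhd (C (Rep i)) (repelling_fixpoint (h i)) \<and>
                psl_act (h i) ` (sphere 0 1 - C (Rep i)) \<subseteq> C (Att i)) \<and>
        (\<forall>i<N2. compact_nbhd (C (Par i)) (parabolic_fixpoint (p i)) \<and>
                (\<forall>n::int. n \<noteq> 0 \<longrightarrow>
                   psl_act (p i [^]\<^bsub>PSL2R\<^esub> n) ` (sphere 0 1 - C (Par i)) \<subseteq> C (Par i))) \<and>
        disjoint_family_on C (Att ` {..<N1} \<union> Rep ` {..<N1} \<union> Par ` {..<N2}))"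

text \<open>
  The symbol \<open>a\<^sup>n\<close> is encoded as the pair \<open>(a, n)\<close>; sequences are indexed from \<open>0\<close>.
\<close>

definition markov_shift :: "'g set \<Rightarrow> (nat \<Rightarrow> 'g \<times> int) set" where
  "markov_shift A =
     {x. \<forall>i. fst (x i) \<in> A \<and> snd (x i) \<noteq> 0 \<and> fst (x i) \<noteq> fst (x (Suc i))}"

definition shift :: "(nat \<Rightarrow> 's) \<Rightarrow> nat \<Rightarrow> 's" where
  "shift x = (\<lambda>i. x (Suc i))"

definition symbol_elt :: "('g, 'm) monoid_scheme \<Rightarrow> 'g \<times> int \<Rightarrow> 'g" where
  "symbol_elt G s = fst s [^]\<^bsub>G\<^esub> snd s"

primrec prefix_elt :: "('g, 'm) monoid_scheme \<Rightarrow> (nat \<Rightarrow> 'g \<times> int) \<Rightarrow> nat \<Rightarrow> 'g" where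
  "prefix_elt G x 0 = \<one>\<^bsub>G\<^esub>"
| "prefix_elt G x (Suc k) = prefix_elt G x k \<otimes>\<^bsub>G\<^esub> symbol_elt G (x k)"

text \<open>The inverse of the coding map \<open>\<omega>\<close> of the limit set.\<close>

definition coded_point ::
    "('g, 'm) monoid_scheme \<Rightarrow> ('g \<Rightarrow> (real^2^2) set) \<Rightarrow> (nat \<Rightarrow> 'g \<times> int) \<Rightarrow> complex" where
  "coded_point G \<rho> x = lim (\<lambda>k. psl_act (\<rho> (prefix_elt G x k)) 0)"

definition geometric_potential ::
    "('g, 'm) monoid_scheme \<Rightarrow> ('g \<Rightarrow> (real^2^2) set) \<Rightarrow> (nat \<Rightarrow> 'g \<times> int) \<Rightarrow> real" where
  "geometric_potential G \<rho> x =
     busemann (coded_point G \<rho> x) 0 (psl_act (\<rho> (symbol_elt G (x 0))) 0)"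

definition birkhoff_sum :: "nat \<Rightarrow> ((nat \<Rightarrow> 's) \<Rightarrow> real) \<Rightarrow> (nat \<Rightarrow> 's) \<Rightarrow> real" where
  "birkhoff_sum n g x = (\<Sum>i<n. g ((shift ^^ i) x))"

definition partition_sum ::
    "(nat \<Rightarrow> 's) set \<Rightarrow> ((nat \<Rightarrow> 's) \<Rightarrow> real) \<Rightarrow> 's \<Rightarrow> nat \<Rightarrow> ennreal" where
  "partition_sum X g s n =
     (\<Sum>\<^sub>\<infinity>x\<in>{x \<in> X. (shift ^^ n) x = x}.
        ennreal (exp (birkhoff_sum n g x)) * indicator {y \<in> X. y 0 = s} x)"

definition ln_ennreal :: "ennreal \<Rightarrow> ereal" where
  "ln_ennreal u = (if u = 0 then - \<infinity> else if u = \<infinity> then \<infinity> else ereal (ln (enn2real u)))"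

text \<open>
  The common value, over all symbols \<open>s\<close> of the shift space \<open>X\<close>, of the limits; it may be \<open>\<infinity>\<close>.
\<close>

definition gurevich_pressure :: "(nat \<Rightarrow> 's) set \<Rightarrow> ((nat \<Rightarrow> 's) \<Rightarrow> real) \<Rightarrow> ereal" where
  "gurevich_pressure X g =
     (THE P. \<forall>s \<in> (\<lambda>x. x 0) ` X.
        (\<lambda>n. ereal (1 / real n) * ln_ennreal (partition_sum X g s n)) \<longlonglongrightarrow> P)"

definition weight_quadrant :: "(real \<times> real) set" where
  "weight_quadrant = {(x, y). x \<ge> 0 \<and> y \<ge> 0} - {(0, 0)}"

end

theory Submission
  imports Defs
begin

text \<open>
  Write \<open>\<rho>(g)\<close> as an element of SU(1,1) with entries \<open>\<alpha>, \<beta>\<close>. The potential \<open>\<tau>\<close> is minus the logarithm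
  of a derivative, so by the chain rule the exponential of minus a Birkhoff sum over a periodic orbit is
  the derivative at a limit point of the group element of the period \<open>w\<close>. The ping-pong
  configuration gives uniform distortion: this derivative is comparable to \<open>\<bar>\<alpha>\<bar>\<^sup>-\<^sup>2\<close>, which therefore is almost
  multiplicative under concatenation of admissible words. It tends to 0 as the length of the word
  grows, by discreteness, and for powers \<open>a\<^sup>n\<close> of a generator it is at most of order \<open>n\<^sup>-\<^sup>2\<close>, exactly so for
  parabolic \<open>a\<close>.

  Hence the pressure at \<open>-t(a\<tau> + b\<kappa>)\<close> is the growth rate \<open>P t\<close> of the sum of \<open>\<psi>(w)\<^sup>t\<close> over the words \<open>w\<close> of length
  \<open>n\<close>, where \<open>\<psi>\<close> is an almost multiplicative weight. The sum converges for \<open>t > 1/(2(a+b))\<close>; there \<open>P\<close> is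
  finite and convex, it is positive near the left end point, since the parabolic powers make the sum
  over the words of length 1 diverge like the harmonic series, and it is negative for large \<open>t\<close>. A
  convex function with these properties has exactly one zero.
\<close>

section \<open>Pressure of almost multiplicative word weights\<close>

text \<open>Only periodic points enter the pressure, so Birkhoff sums have to be compared with word
  weights only there. The recurring obstacle is that two admissible words need not be concatenable:
  the first may end, and the second begin, with a power of the same generator. With at least three
  generators a letter can always be inserted between them, and likewise a word can be closed up to a
  cyclic one. The third generator also supplies the second test arc in the distortion estimate.

  The weight of \<open>w\<close> is \<open>N1(w)^(-2a) N2(w)^(-2b)\<close>, with \<open>Ni\<close>
  the modulus of \<alpha> for the i-th representation. Since \<open>a\<close> or \<open>b\<close>
  may vanish, each representation is treated alone with an exponent \<open>e\<close> \<ge> 0, and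
  the results are multiplied. Both representations make the same generator \<open>p 0\<close>
  parabolic; hence the orders \<open>n^(-2a)\<close> and \<open>n^(-2b)\<close> combine to exactly
  \<open>n^(-2(a+b))\<close>, which fixes the left end point. Uniqueness is drawn from convexity and
  not from strict monotonicity, because the estimates do not show the potentials themselves to be
  positive.\<close>

lemma has_sum_Times_mult:
  fixes f :: "'a \<Rightarrow> real" and g :: "'b \<Rightarrow> real"
  assumes "f summable_on X" "g summable_on Y"
    and "\<And>x. x \<in> X \<Longrightarrow> f x \<ge> 0" "\<And>y. y \<in> Y \<Longrightarrow> g y \<ge> 0"
  shows "((\<lambda>(x, y). f x * g y) has_sum (infsum f X * infsum g Y)) (X \<times> Y)"
proof (rule has_sum_SigmaI)
  show f: "((\<lambda>y. case (x, y) of (x, y) \<Rightarrow> f x * g y) has_sum (f x * infsum g Y)) Y" for x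
    using assms(2) by (simp add: has_sum_cmult_right)
  show g: "((\<lambda>x. f x * infsum g Y) has_sum infsum f X * infsum g Y) X"
    using assms(1) by (simp add: has_sum_cmult_left)
  show "(\<lambda>(x, y). f x * g y) summable_on X \<times> Y"
    using assms(3,4) by (intro summable_on_SigmaI[OF f has_sum_imp_summable[OF g]]) auto
qed

lemma infsum_le_inj:
  fixes F :: "'a \<Rightarrow> real" and H :: "'b \<Rightarrow> real"
  assumes "H summable_on Y" "inj_on j X" "j ` X \<subseteq> Y"
    and "\<And>x. x \<in> X \<Longrightarrow> 0 \<le> F x" "\<And>x. x \<in> X \<Longrightarrow> F x \<le> H (j x)" "\<And>y. y \<in> Y \<Longrightarrow> 0 \<le> H y"
  shows "F summable_on X" "infsum F X \<le> infsum H Y"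
proof -
  have sH: "H summable_on j ` X"
    using assms by (meson summable_on_subset_banach)
  then have sHj: "(H \<circ> j) summable_on X"
    using summable_on_reindex[OF assms(2)] by blast
  then show sF: "F summable_on X"
    using assms by (intro summable_on_comparison_test[OF sHj]) auto
  have "infsum F X \<le> infsum (H \<circ> j) X"
    using sF sHj assms(5) by (intro infsum_mono) auto
  also have "\<dots> = infsum H (j ` X)"
    using infsum_reindex[OF assms(2)] by metis
  also have "\<dots> \<le> infsum H Y"
    using sH assms by (intro infsum_mono2) auto
  finally show "infsum F X \<le> infsum H Y" .
qed

section \<open>Limits of almost additive sequences, and zeros of convex functions\<close>

lemma almost_additive_converges:
  fixes a :: "nat \<Rightarrow> real"
  assumes a: "\<And>m n. m \<ge> 1 \<Longrightarrow> n \<ge> 1 \<Longrightarrow> \<bar>a (m + n) - a m - a n\<bar> \<le> k"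
  shows "convergent (\<lambda>n. a n / n)"
proof -
  have k: "k \<ge> 0" using a[of 1 1] by linarith
  have mult: "\<bar>a (j * m) - j * a m\<bar> \<le> j * k" if "j \<ge> 1" "m \<ge> 1" for j m
    using that(1)
  proof (induction j rule: dec_induct)
    case base
    then show ?case using k by simp
  next
    case (step j)
    have "\<bar>a (m + j * m) - a m - a (j * m)\<bar> \<le> k"
      using step that(2) by (intro a) auto
    with step.IH have "\<bar>a (m + j * m) - a m - j * a m\<bar> \<le> k + j * k"
      by linarith
    then show ?case by (simp add: algebra_simps)
  qed
  \<comment> \<open>The value \<open>a (n * m)\<close> is computed in two ways, as \<open>n\<close>
    blocks of length \<open>m\<close> and as \<open>m\<close> blocks of length
    \<open>n\<close>.\<close>
  have close: "\<bar>a n / n - a m / m\<bar> \<le> k / m + k / n" if "n \<ge> 1" "m \<ge> 1" for m n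
  proof -
    have "\<bar>n * a m - m * a n\<bar> \<le> n * k + m * k"
      using mult[OF that] mult[OF that(2) that(1)] by (simp add: mult.commute)
    then have "\<bar>n * a m - m * a n\<bar> / (n * m) \<le> (n * k + m * k) / (n * m)"
      by (intro divide_right_mono) auto
    also have "(n * k + m * k) / (n * m) = k / m + k / n"
      using that by (simp add: field_simps)
    also have "\<bar>n * a m - m * a n\<bar> / (n * m) = \<bar>(n * a m - m * a n) / (n * m)\<bar>"
      by (simp add: abs_divide)
    also have "(n * a m - m * a n) / (n * m) = a m / m - a n / n"
      using that by (simp add: field_simps)
    finally show ?thesis by (simp add: abs_minus_commute)
  qed
  have "Cauchy (\<lambda>n. a n / n)"
  proof (rule metric_CauchyI)
    fix e :: real assume e: "e > 0"
    obtain M :: nat where M: "M > 2 * k / e" using reals_Archimedean2 by blast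
    have kM: "k / n < e / 2" if "n \<ge> Suc M" for n
    proof -
      have "2 * k / e < n" using M that by linarith
      then have "2 * k < n * e" using e by (simp add: pos_divide_less_eq)
      then show ?thesis using that by (simp add: field_simps)
    qed
    show "\<exists>M. \<forall>m\<ge>M. \<forall>n\<ge>M. dist (a m / m) (a n / n) < e"
    proof (intro exI allI impI)
      fix m n assume "m \<ge> Suc M" "n \<ge> Suc M"
      then show "dist (a m / m) (a n / n) < e"
        using close[of n m] kM[of m] kM[of n] unfolding dist_real_def by linarith
    qed
  qed
  then show ?thesis by (simp add: Cauchy_convergent_iff)
qed

text \<open>The sequence \<open>a + k\<close> is subadditive, so following the multiples of
  \<open>N\<close> bounds the limit by any single term. Applied to \<open>ln (Z n t)\<close> it
  gives upper bounds for the pressure; applied to \<open>- ln (Z n t)\<close> along odd lengths it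
  gives a lower bound.\<close>

lemma subadditive_limit_le:
  fixes a :: "nat \<Rightarrow> real"
  assumes a: "\<And>m n. m \<ge> 1 \<Longrightarrow> n \<ge> 1 \<Longrightarrow> a (m + n) \<le> a m + a n + k"
    and lim: "(\<lambda>n. a n / n) \<longlonglongrightarrow> P" and "N \<ge> 1"
  shows "P \<le> (a N + k) / N"
proof -
  have mult: "a (j * N) \<le> j * (a N + k) - k" if "j \<ge> 1" for j
    using that
  proof (induction j rule: dec_induct)
    case (step j)
    have "a (N + j * N) \<le> a N + a (j * N) + k"
      using step assms(3) by (intro a) auto
    with step.IH show ?case by (simp add: algebra_simps)
  qed simp
  have "(\<lambda>j. a (j * N) / (j * N)) \<longlonglongrightarrow> P"
    using LIMSEQ_subseq_LIMSEQ[OF lim, of "\<lambda>j. j * N"] assms(3)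
    by (simp add: o_def strict_mono_def)
  moreover have "(\<lambda>j. (a N + k) / N - k / N * (1 / real j)) \<longlonglongrightarrow> (a N + k) / N - k / N * 0"
    by (intro tendsto_intros lim_1_over_n)
  moreover have "\<forall>\<^sub>F j in sequentially. a (j * N) / (j * N) \<le> (a N + k) / N - k / N * (1 / real j)"
    using eventually_ge_at_top[of 1]
  proof eventually_elim
    case (elim j)
    then have "a (j * N) / (j * N) \<le> (j * (a N + k) - k) / (j * N)"
      using mult[OF elim] by (intro divide_right_mono) auto
    also have "\<dots> = (a N + k) / N - k / N * (1 / real j)"
      using elim assms(3) by (simp add: field_simps)
    finally show ?case .
  qed
  ultimately show ?thesis
    using tendsto_le[OF sequentially_bot] by fastforce
qed

text \<open>A zero exists by the intermediate value theorem. If \<open>x < y\<close> were two zeros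
  and \<open>z > y\<close> a point where \<open>P\<close> is negative, then \<open>y\<close> would
  be a convex combination of \<open>x\<close> and \<open>z\<close>, and convexity would force
  \<open>P y < 0\<close>.\<close>

lemma convex_unique_zero:
  fixes P :: "real \<Rightarrow> real"
  assumes conv: "convex_on {\<theta><..} P" and t1: "t1 > \<theta>" "P t1 > 0"
    and neg: "\<And>t. t \<ge> T \<Longrightarrow> P t < 0"
  shows "\<exists>!t. t \<in> {\<theta><..} \<and> P t = 0"
proof -
  define t2 where "t2 = max T (t1 + 1)"
  have t2: "P t2 < 0" "t1 < t2" using neg[of t2] by (auto simp: t2_def)
  have "continuous_on {\<theta><..} P"
    using conv by (intro convex_on_continuous) auto
  then have "continuous_on {t1..t2} P"
    using t1 by (auto elim: continuous_on_subset)
  then obtain t where t: "t1 \<le> t" "t \<le> t2" "P t = 0"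
    using IVT2'[of P t2 0 t1] t1 t2 by auto
  have *: "False" if x: "x > \<theta>" "P x = 0" and y: "P y = 0" "x < y" for x y
  proof -
    define z where "z = max T (y + 1)"
    have z: "P z < 0" "y < z" using neg[of z] by (auto simp: z_def)
    define u where "u = (y - x) / (z - x)"
    have u: "0 < u" "u < 1" using z y by (auto simp: u_def)
    have "u * (z - x) = y - x" using z y by (simp add: u_def)
    then have "(1 - u) *\<^sub>R x + u *\<^sub>R z = y" by (simp add: algebra_simps)
    with convex_onD[OF conv, of u x z] u x z y have "P y \<le> u * P z" by simp
    moreover have "u * P z < 0" using u z by (simp add: mult_pos_neg)
    ultimately show False using y by simp
  qed
  show ?thesis
  proof (intro ex1I[of _ t] conjI)
    show "t \<in> {\<theta><..}" using t t1 by simp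
    fix x assume "x \<in> {\<theta><..} \<and> P x = 0"
    then show "x = t"
      using *[of x t] *[of t x] t t1 by (cases x t rule: linorder_cases) auto
  qed (rule t)
qed

section \<open>Admissible words and the growth rate of their weights\<close>

definition admissible :: "'g set \<Rightarrow> ('g \<times> int) list \<Rightarrow> bool" where
  "admissible A w \<longleftrightarrow> (\<forall>s\<in>set w. fst s \<in> A \<and> snd s \<noteq> 0) \<and> distinct_adj (map fst w)"

lemma admissible_append:
  "admissible A (v @ w) \<longleftrightarrow> admissible A v \<and> admissible A w \<and>
     (v = [] \<or> w = [] \<or> fst (last v) \<noteq> fst (hd w))"
  by (auto simp: admissible_def distinct_adj_append_iff last_map hd_map)

lemma admissible_single: "admissible A [s] \<longleftrightarrow> fst s \<in> A \<and> snd s \<noteq> 0"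
  by (auto simp: admissible_def)

lemma admissible_Cons:
  "admissible A (s # w) \<longleftrightarrow>
     fst s \<in> A \<and> snd s \<noteq> 0 \<and> admissible A w \<and> (w = [] \<or> fst s \<noteq> fst (hd w))"
  using admissible_append[of A "[s]" w] by (auto simp: admissible_single)

text \<open>The purpose of having three generators: a letter can be chosen that differs from both of
  its prospective neighbours.\<close>

lemma ex_third:
  assumes "card A \<ge> 3"
  shows "\<exists>z\<in>A. z \<noteq> x \<and> z \<noteq> y"
proof -
  have "card A - card {x, y} \<le> card (A - {x, y})"
    by (rule diff_card_le_card_Diff) auto
  moreover have "card {x, y} \<le> 2"
    by (simp add: card_insert_if)
  ultimately have "card (A - {x, y}) > 0" using assms by linarith
  then have "A - {x, y} \<noteq> {}" by (metis card.empty less_numeral_extra(3))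
  then show ?thesis by blast
qed

text \<open>Almost multiplicativity is required only for admissible concatenations. The exponent
  \<open>s\<close> stands for \<open>a + b\<close>. All single letters obey the upper bound of order
  \<open>-2 * s\<close>, but the matching lower bound is asked only for the powers of one generator
  \<open>p\<close>, the parabolic one.\<close>

locale word_weights =
  fixes A :: "'g set" and \<psi> :: "('g \<times> int) list \<Rightarrow> real" and K s :: real and p :: 'g
  assumes finite_A: "finite A" and card_A: "card A \<ge> 3" and p_A: "p \<in> A"
    and K_ge_1: "K \<ge> 1" and s_pos: "s > 0"
    and weight_pos: "admissible A w \<Longrightarrow> \<psi> w > 0"
    and weight_append_le:
      "v \<noteq> [] \<Longrightarrow> w \<noteq> [] \<Longrightarrow> admissible A (v @ w) \<Longrightarrow> \<psi> (v @ w) \<le> K * (\<psi> v * \<psi> w)"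
    and weight_append_ge:
      "v \<noteq> [] \<Longrightarrow> w \<noteq> [] \<Longrightarrow> admissible A (v @ w) \<Longrightarrow> \<psi> v * \<psi> w \<le> K * \<psi> (v @ w)"
    and weight_single_le: "a \<in> A \<Longrightarrow> n \<noteq> 0 \<Longrightarrow> \<psi> [(a, n)] \<le> K * \<bar>real_of_int n\<bar> powr (- 2 * s)"
    and weight_parabolic_ge: "n \<noteq> 0 \<Longrightarrow> \<bar>real_of_int n\<bar> powr (- 2 * s) \<le> K * \<psi> [(p, n)]"
    and weight_small:
      "\<epsilon> > 0 \<Longrightarrow> \<exists>N\<ge>1. \<forall>w. admissible A w \<and> length w = N \<longrightarrow> \<psi> w \<le> \<epsilon>"
begin

definition words :: "nat \<Rightarrow> ('g \<times> int) list set" where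
  "words n = {w. admissible A w \<and> length w = n}"

definition Z :: "nat \<Rightarrow> real \<Rightarrow> real" where
  "Z n t = infsum (\<lambda>w. \<psi> w powr t) (words n)"

text \<open>The critical exponent: the sum of \<open>n powr (- 2 * s * t)\<close> over the positive
  integers converges exactly for \<open>t > \<theta>\<close>.\<close>

definition \<theta> :: real where "\<theta> = 1 / (2 * s)"

lemma theta_pos: "\<theta> > 0"
  using s_pos by (simp add: \<theta>_def)

definition pick :: "'g \<Rightarrow> 'g \<Rightarrow> 'g" where
  "pick x y = (SOME z. z \<in> A \<and> z \<noteq> x \<and> z \<noteq> y)"

lemma pick: "pick x y \<in> A" "pick x y \<noteq> x" "pick x y \<noteq> y"
proof -
  have "\<exists>z. z \<in> A \<and> z \<noteq> x \<and> z \<noteq> y" using ex_third[OF card_A] by blast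
  then have "pick x y \<in> A \<and> pick x y \<noteq> x \<and> pick x y \<noteq> y"
    unfolding pick_def by (rule someI_ex)
  then show "pick x y \<in> A" "pick x y \<noteq> x" "pick x y \<noteq> y" by auto
qed

lemma words_nonempty: "\<exists>w. w \<in> words n"
proof (induction n)
  case 0
  then show ?case by (auto simp: words_def admissible_def)
next
  case (Suc n)
  then obtain w where w: "w \<in> words n" by blast
  let ?c = "pick (fst (hd w)) (fst (hd w))"
  have "(?c, 1) # w \<in> words (Suc n)"
    using w pick[of "fst (hd w)" "fst (hd w)"] by (auto simp: words_def admissible_Cons)
  then show ?case by blast
qed

lemma weight_pos_words: "w \<in> words n \<Longrightarrow> \<psi> w > 0"
  by (simp add: words_def weight_pos)

lemma summable_words_1:
  assumes t: "t > \<theta>"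
  shows "(\<lambda>w. \<psi> w powr t) summable_on words 1"
proof -
  define r where "r = 2 * s * t"
  have r: "r > 1" using t s_pos by (simp add: r_def \<theta>_def field_simps)
  define g where "g n = \<bar>real_of_int n\<bar> powr (- r)" for n :: int
  have nat: "(\<lambda>n::nat. real n powr (- r)) summable_on UNIV"
    using r by (subst summable_on_UNIV_nonneg_real_iff) (auto simp: summable_real_powr_iff)
  have "g summable_on range int"
    using nat by (subst summable_on_reindex) (auto simp: g_def o_def)
  moreover have "g summable_on range (\<lambda>n. - int n)"
    using nat by (subst summable_on_reindex) (auto simp: g_def o_def inj_on_def)
  ultimately have "g summable_on (range int \<union> range (\<lambda>n. - int n))"
    by (rule summable_on_union)
  moreover have "range int \<union> range (\<lambda>n. - int n) = UNIV"
  proof (intro UNIV_eq_I[symmetric])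
    fix n :: int
    show "n \<in> range int \<union> range (\<lambda>n. - int n)"
      by (cases n rule: int_cases2) auto
  qed
  ultimately have g: "g summable_on UNIV" by simp
  have prod: "(\<lambda>(x, y). K powr t * g y) summable_on A \<times> (UNIV :: int set)"
    using has_sum_Times_mult[of "\<lambda>_. K powr t" A g UNIV] g finite_A
    by (auto simp: g_def has_sum_imp_summable)
  show ?thesis
  proof (rule infsum_le_inj(1)[OF prod, of hd])
    show "inj_on hd (words 1)"
      by (auto simp: inj_on_def words_def length_Suc_conv)
    show "hd ` words 1 \<subseteq> A \<times> UNIV"
      by (auto simp: words_def length_Suc_conv admissible_single)
    fix w assume "w \<in> words 1"
    then obtain a n where w: "w = [(a, n)]" "a \<in> A" "n \<noteq> 0"
      by (auto simp: words_def length_Suc_conv admissible_single)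
    have "0 \<le> \<psi> w" using \<open>w \<in> words 1\<close> weight_pos_words by (simp add: less_imp_le)
    then have "\<psi> w powr t \<le> (K * \<bar>real_of_int n\<bar> powr (- 2 * s)) powr t"
      using weight_single_le[OF w(2,3)] w(1) t theta_pos by (intro powr_mono2) auto
    also have "\<dots> = K powr t * g n"
      using K_ge_1 by (simp add: powr_mult powr_powr g_def r_def)
    finally show "\<psi> w powr t \<le> (case hd w of (x, y) \<Rightarrow> K powr t * g y)" by (simp add: w(1))
  qed (auto simp: g_def)
qed

lemma take_drop_words:
  assumes "w \<in> words (m + n)"
  shows "take m w \<in> words m" "drop m w \<in> words n"
  using assms admissible_append[of A "take m w" "drop m w"] by (auto simp: words_def)

text \<open>Cutting after \<open>m\<close> letters embeds the words of length \<open>m + n\<close>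
  into pairs of words. Summability and the bound come from the same comparison and are stated
  together, so that summability for all lengths follows by induction from length 1.\<close>

lemma Z_add_le_aux:
  assumes t: "t > \<theta>" and mn: "m \<ge> 1" "n \<ge> 1"
    and sm: "(\<lambda>w. \<psi> w powr t) summable_on words m" "(\<lambda>w. \<psi> w powr t) summable_on words n"
  shows "(\<lambda>w. \<psi> w powr t) summable_on words (m + n) \<and> Z (m + n) t \<le> K powr t * (Z m t * Z n t)"
proof -
  let ?f = "\<lambda>w. \<psi> w powr t" and ?H = "\<lambda>p. K powr t * (case p of (v, w) \<Rightarrow> \<psi> v powr t * \<psi> w powr t)"
  have hs: "(?H has_sum (K powr t * (Z m t * Z n t))) (words m \<times> words n)"
    unfolding Z_def by (intro has_sum_cmult_right has_sum_Times_mult sm) auto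
  have le: "\<psi> w powr t \<le> ?H (take m w, drop m w)" if w: "w \<in> words (m + n)" for w
  proof -
    have "w = take m w @ drop m w" by simp
    then have "\<psi> w \<le> K * (\<psi> (take m w) * \<psi> (drop m w))"
      using weight_append_le[of "take m w" "drop m w"] w mn by (cases "w = []") (auto simp: words_def)
    then have "\<psi> w powr t \<le> (K * (\<psi> (take m w) * \<psi> (drop m w))) powr t"
      using t theta_pos weight_pos_words[OF w] by (intro powr_mono2) auto
    then show ?thesis
      using K_ge_1 weight_pos_words[OF take_drop_words(1)[OF w]]
        weight_pos_words[OF take_drop_words(2)[OF w]]
      by (simp add: powr_mult)
  qed
  have inj: "inj_on (\<lambda>w. (take m w, drop m w)) (words (m + n))"
    by (auto simp: inj_on_def) (metis append_take_drop_id)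
  have sub: "(\<lambda>w. (take m w, drop m w)) ` words (m + n) \<subseteq> words m \<times> words n"
    using take_drop_words by auto
  note * = infsum_le_inj[OF has_sum_imp_summable[OF hs] inj sub, of ?f]
  have "?f summable_on words (m + n)"
    by (rule *(1)) (use le in auto)
  moreover have "infsum ?f (words (m + n)) \<le> infsum ?H (words m \<times> words n)"
    by (rule *(2)) (use le in auto)
  ultimately show ?thesis using infsumI[OF hs] by (simp add: Z_def)
qed

lemma summable_words:
  assumes "t > \<theta>" "n \<ge> 1"
  shows "(\<lambda>w. \<psi> w powr t) summable_on words n"
  using assms(2)
proof (induction n rule: dec_induct)
  case base
  then show ?case using summable_words_1[OF assms(1)] by simp
next
  case (step n)
  then show ?case using Z_add_le_aux[of t n 1] summable_words_1[OF assms(1)] assms(1) by simp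
qed

lemma Z_add_le:
  assumes "t > \<theta>" "m \<ge> 1" "n \<ge> 1"
  shows "Z (m + n) t \<le> K powr t * (Z m t * Z n t)"
  using Z_add_le_aux summable_words assms by blast

text \<open>The loss caused by a connecting letter: it weighs at least the minimum, and each of its
  two junctions costs a factor \<open>K\<close>.\<close>

definition L :: real where
  "L = Min ((\<lambda>a. \<psi> [(a, 1)]) ` A) / K\<^sup>2"

lemma A_nonempty: "A \<noteq> {}"
  using p_A by auto

lemma L_pos: "L > 0"
proof -
  have "Min ((\<lambda>a. \<psi> [(a, 1)]) ` A) > 0"
    using finite_A A_nonempty by (subst Min_gr_iff) (auto intro!: weight_pos simp: admissible_single)
  then show ?thesis using K_ge_1 by (simp add: L_def)
qed

lemma weight_connect:
  assumes "v \<noteq> []" "w \<noteq> []" "admissible A v" "admissible A w"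
  defines "c \<equiv> pick (fst (last v)) (fst (hd w))"
  shows "admissible A (v @ (c, 1) # w)" "L * (\<psi> v * \<psi> w) \<le> \<psi> (v @ (c, 1) # w)"
proof -
  have c: "c \<in> A" "c \<noteq> fst (last v)" "c \<noteq> fst (hd w)"
    unfolding c_def by (rule pick)+
  have cw: "admissible A ([(c, 1)] @ w)"
    using c assms by (simp add: admissible_Cons)
  then show vcw: "admissible A (v @ (c, 1) # w)"
    using c assms by (simp add: admissible_append)
  have 1: "\<psi> [(c, 1)] * \<psi> w \<le> K * \<psi> ((c, 1) # w)"
    using weight_append_ge[OF _ assms(2) cw] by simp
  have 2: "\<psi> v * \<psi> ((c, 1) # w) \<le> K * \<psi> (v @ (c, 1) # w)"
    using weight_append_ge[OF assms(1) _ vcw] by simp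
  have K: "K > 0" using K_ge_1 by simp
  have pos: "\<psi> v > 0" "\<psi> w > 0" using weight_pos assms by auto
  have "L * K\<^sup>2 \<le> \<psi> [(c, 1)]"
    using finite_A c(1) K by (simp add: L_def)
  then have "L * K\<^sup>2 * (\<psi> v * \<psi> w) \<le> \<psi> [(c, 1)] * (\<psi> v * \<psi> w)"
    using pos by (intro mult_right_mono) auto
  also have "\<dots> = \<psi> v * (\<psi> [(c, 1)] * \<psi> w)" by simp
  also have "\<dots> \<le> \<psi> v * (K * \<psi> ((c, 1) # w))"
    using 1 pos by (intro mult_left_mono) auto
  also have "\<dots> = K * (\<psi> v * \<psi> ((c, 1) # w))" by simp
  also have "\<dots> \<le> K * (K * \<psi> (v @ (c, 1) # w))"
    using 2 K by (intro mult_left_mono) auto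
  finally have "K\<^sup>2 * (L * (\<psi> v * \<psi> w)) \<le> K\<^sup>2 * \<psi> (v @ (c, 1) # w)"
    by (simp add: power2_eq_square mult_ac)
  then show "L * (\<psi> v * \<psi> w) \<le> \<psi> (v @ (c, 1) # w)"
    using K by simp
qed

lemma Z_connect_ge:
  assumes t: "t > \<theta>" and mn: "m \<ge> 1" "n \<ge> 1"
  shows "L powr t * (Z m t * Z n t) \<le> Z (m + 1 + n) t"
proof -
  let ?H = "\<lambda>p. L powr t * (case p of (v, w) \<Rightarrow> \<psi> v powr t * \<psi> w powr t)"
  let ?j = "\<lambda>(v, w). v @ (pick (fst (last v)) (fst (hd w)), 1::int) # w"
  have hs: "(?H has_sum (L powr t * (Z m t * Z n t))) (words m \<times> words n)"
    unfolding Z_def using assms by (intro has_sum_cmult_right has_sum_Times_mult summable_words) auto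
  have "infsum ?H (words m \<times> words n) \<le> infsum (\<lambda>w. \<psi> w powr t) (words (m + 1 + n))"
  proof (rule infsum_le_inj(2)[where j = ?j])
    \<comment> \<open>The inserted letter depends on both words, but \<open>v\<close> has the fixed
      length \<open>m\<close>, so \<open>v\<close> and \<open>w\<close> can be read off from the
      result.\<close>
    show "inj_on ?j (words m \<times> words n)"
    proof (rule inj_onI)
      fix x y assume x: "x \<in> words m \<times> words n" and y: "y \<in> words m \<times> words n" and eq: "?j x = ?j y"
      have "length (fst x) = length (fst y)" using x y by (auto simp: words_def)
      moreover have "fst x @ (pick (fst (last (fst x))) (fst (hd (snd x))), 1::int) # snd x =
          fst y @ (pick (fst (last (fst y))) (fst (hd (snd y))), 1) # snd y"
        using eq by (simp only: case_prod_beta)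
      ultimately have "fst x = fst y \<and> snd x = snd y"
        by (metis append_eq_append_conv list.inject)
      then show "x = y" by (simp add: prod_eq_iff)
    qed
    show "?j ` (words m \<times> words n) \<subseteq> words (m + 1 + n)"
    proof (intro image_subsetI)
      fix x assume x: "x \<in> words m \<times> words n"
      then obtain v w where "x = (v, w)" "v \<in> words m" "w \<in> words n" by auto
      moreover from this have "v \<noteq> []" "w \<noteq> []" using mn by (auto simp: words_def)
      ultimately show "?j x \<in> words (m + 1 + n)"
        using weight_connect(1)[of v w] by (simp add: words_def)
    qed
    fix x assume x: "x \<in> words m \<times> words n"
    then obtain v w where vw: "x = (v, w)" "v \<in> words m" "w \<in> words n" by auto
    then have "v \<noteq> []" "w \<noteq> []" using mn by (auto simp: words_def)
    then have *: "L * (\<psi> v * \<psi> w) \<le> \<psi> (?j x)"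
      using weight_connect(2)[of v w] vw by (simp add: words_def)
    have pos: "\<psi> v > 0" "\<psi> w > 0" using x vw weight_pos_words by auto
    have "?H x = (L * (\<psi> v * \<psi> w)) powr t"
      using pos L_pos by (simp add: vw powr_mult)
    also have "\<dots> \<le> \<psi> (?j x) powr t"
      using * t theta_pos pos L_pos by (intro powr_mono2) auto
    finally show "?H x \<le> \<psi> (?j x) powr t" .
  qed (use assms summable_words in auto)
  then show ?thesis using infsumI[OF hs] by (simp add: Z_def)
qed

lemma Z_pos:
  assumes "t > \<theta>" "n \<ge> 1"
  shows "Z n t > 0"
proof -
  obtain w where w: "w \<in> words n" using words_nonempty by blast
  have "0 < \<psi> w powr t" using weight_pos_words[OF w] by simp
  also have "\<dots> = sum (\<lambda>w. \<psi> w powr t) {w}" by simp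
  also have "\<dots> \<le> Z n t"
    unfolding Z_def using w summable_words[OF assms] by (intro finite_sum_le_infsum) auto
  finally show ?thesis .
qed

lemma ln_Z_add_le:
  assumes "t > \<theta>" "m \<ge> 1" "n \<ge> 1"
  shows "ln (Z (m + n) t) \<le> ln (Z m t) + ln (Z n t) + t * ln K"
proof -
  have "ln (Z (m + n) t) \<le> ln (K powr t * (Z m t * Z n t))"
    using Z_add_le[OF assms] Z_pos[of t] assms K_ge_1 by (subst ln_le_cancel_iff) auto
  also have "\<dots> = t * ln K + (ln (Z m t) + ln (Z n t))"
    using Z_pos[OF assms(1,2)] Z_pos[OF assms(1,3)] K_ge_1 by (simp add: ln_mult ln_powr)
  finally show ?thesis by simp
qed

lemma ln_Z_connect_ge:
  assumes "t > \<theta>" "m \<ge> 1" "n \<ge> 1"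
  shows "ln (Z m t) + ln (Z n t) + t * ln L \<le> ln (Z (m + 1 + n) t)"
proof -
  have "t * ln L + (ln (Z m t) + ln (Z n t)) = ln (L powr t * (Z m t * Z n t))"
    using Z_pos[OF assms(1,2)] Z_pos[OF assms(1,3)] L_pos by (simp add: ln_mult ln_powr)
  also have "\<dots> \<le> ln (Z (m + 1 + n) t)"
    using Z_connect_ge[OF assms] Z_pos[of t] assms L_pos by (subst ln_le_cancel_iff) auto
  finally show ?thesis by simp
qed

definition P :: "real \<Rightarrow> real" where
  "P t = lim (\<lambda>n. ln (Z n t) / n)"

text \<open>Inserting a letter bounds \<open>Z m t * Z n t\<close> by a multiple of
  \<open>Z (m + 1 + n) t\<close>, and submultiplicativity removes that letter again at the cost of a
  factor \<open>Z 1 t\<close>. Together with the upper bound this makes \<open>ln (Z n t)\<close>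
  almost additive.\<close>

lemma P_lim:
  assumes t: "t > \<theta>"
  shows "(\<lambda>n. ln (Z n t) / n) \<longlonglongrightarrow> P t"
proof -
  define k where "k = \<bar>t * ln K\<bar> + \<bar>t * ln L\<bar> + \<bar>ln (Z 1 t)\<bar>"
  have "convergent (\<lambda>n. ln (Z n t) / n)"
  proof (rule almost_additive_converges)
    fix m n :: nat assume mn: "m \<ge> 1" "n \<ge> 1"
    have "ln (Z (m + 1 + n) t) \<le> ln (Z (m + n) t) + ln (Z 1 t) + t * ln K"
      using ln_Z_add_le[of t "m + n" 1] t mn by (simp add: add_ac)
    then show "\<bar>ln (Z (m + n) t) - ln (Z m t) - ln (Z n t)\<bar> \<le> k"
      using ln_Z_add_le[OF t mn] ln_Z_connect_ge[OF t mn] by (auto simp: k_def abs_if)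
  qed
  then show ?thesis by (simp add: P_def convergent_LIMSEQ_iff)
qed

lemma P_le:
  assumes "t > \<theta>" "N \<ge> 1"
  shows "P t \<le> (ln (Z N t) + t * ln K) / N"
  by (rule subadditive_limit_le[OF _ P_lim]) (use assms ln_Z_add_le in auto)

text \<open>For odd lengths the connecting letter does no harm, as
  \<open>(2m - 1) + 1 + (2n - 1) = 2(m + n) - 1\<close>. So \<open>- ln (Z (2 * n - 1) t)\<close> is
  subadditive up to a constant, and its first term gives the bound; the divisor 2 counts one letter
  and one connecting letter.\<close>

lemma P_ge:
  assumes t: "t > \<theta>"
  shows "P t \<ge> (ln (Z 1 t) + t * ln L) / 2"
proof -
  define b where "b n = - ln (Z (2 * n - 1) t)" for n :: nat
  have sub: "filterlim (\<lambda>n::nat. 2 * n - 1) sequentially sequentially"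
    unfolding filterlim_at_top eventually_at_top_linorder
    by (intro allI) (rule_tac x = "Suc Z" in exI, auto)
  have "(\<lambda>n. (- (2 - 1 / real n)) * (ln (Z (2 * n - 1) t) / real (2 * n - 1))) \<longlonglongrightarrow> (- (2 - 0)) * P t"
    by (intro tendsto_intros lim_1_over_n filterlim_compose[OF P_lim[OF t] sub])
  moreover have "\<forall>\<^sub>F n in sequentially.
      (- (2 - 1 / real n)) * (ln (Z (2 * n - 1) t) / real (2 * n - 1)) = b n / n"
    using eventually_ge_at_top[of 1] by eventually_elim (auto simp: b_def field_simps of_nat_diff)
  ultimately have lim: "(\<lambda>n. b n / n) \<longlonglongrightarrow> - 2 * P t"
    by (simp add: tendsto_cong)
  have "b (m + n) \<le> b m + b n + (- (t * ln L))" if mn: "m \<ge> 1" "n \<ge> 1" for m n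
  proof -
    have "2 * m - 1 + 1 + (2 * n - 1) = 2 * (m + n) - 1" using mn by simp
    moreover have "2 * m - 1 \<ge> 1" "2 * n - 1 \<ge> 1" using mn by auto
    ultimately show ?thesis
      using ln_Z_connect_ge[OF t, of "2 * m - 1" "2 * n - 1"] unfolding b_def by auto
  qed
  from subadditive_limit_le[OF this lim, of 1] show ?thesis
    by (simp add: b_def)
qed

text \<open>Hoelder's inequality, obtained by summing Young's inequality for the normalised weights
  \<open>\<psi> w powr x / Z n x\<close> and \<open>\<psi> w powr y / Z n y\<close>; the factor
  \<open>?C\<close> undoes the normalisation.\<close>

lemma Z_log_convex:
  assumes x: "x > \<theta>" and y: "y > \<theta>" and u: "0 < u" "u < 1" and n: "n \<ge> 1"
  shows "ln (Z n ((1 - u) * x + u * y)) \<le> (1 - u) * ln (Z n x) + u * ln (Z n y)"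
proof -
  let ?z = "(1 - u) * x + u * y"
  have z: "?z > \<theta>"
  proof -
    have "(1 - u) * x > (1 - u) * \<theta>" "u * y > u * \<theta>" using assms by auto
    then have "?z > (1 - u) * \<theta> + u * \<theta>" by linarith
    then show ?thesis by (simp add: algebra_simps)
  qed
  have pos: "Z n x > 0" "Z n y > 0" "Z n ?z > 0" using Z_pos x y z n by auto
  let ?C = "Z n x powr (1 - u) * Z n y powr u"
  let ?g = "\<lambda>w. (1 - u) / Z n x * \<psi> w powr x + u / Z n y * \<psi> w powr y"
  have gs: "(?g has_sum ((1 - u) / Z n x * Z n x + u / Z n y * Z n y)) (words n)"
    unfolding Z_def using x y n by (intro has_sum_add has_sum_cmult_right has_sum_infsum summable_words)
  then have gs: "((\<lambda>w. ?C * ?g w) has_sum ?C * 1) (words n)"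
    using pos by (intro has_sum_cmult_right) simp
  have le: "\<psi> w powr ?z \<le> ?C * ?g w" if w: "w \<in> words n" for w
  proof -
    have pw: "\<psi> w > 0" using weight_pos_words[OF w] .
    have "(\<psi> w powr x / Z n x) powr (1 - u) * (\<psi> w powr y / Z n y) powr u \<le>
      (1 - u) * (\<psi> w powr x / Z n x) + u * (\<psi> w powr y / Z n y)"
      using u pos pw by (intro Youngs_inequality_0) auto
    then have "(\<psi> w powr x / Z n x) powr (1 - u) * (\<psi> w powr y / Z n y) powr u \<le> ?g w" by simp
    then have "?C * ((\<psi> w powr x / Z n x) powr (1 - u) * (\<psi> w powr y / Z n y) powr u) \<le> ?C * ?g w"
      by (intro mult_left_mono) auto
    moreover have "?C * ((\<psi> w powr x / Z n x) powr (1 - u) * (\<psi> w powr y / Z n y) powr u) =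
        \<psi> w powr ?z"
      using pos pw by (simp add: powr_divide powr_powr powr_add mult_ac)
    ultimately show ?thesis by simp
  qed
  have "Z n ?z \<le> ?C * 1"
    unfolding Z_def[of n ?z]
    using infsum_mono[OF summable_words[OF z n] has_sum_imp_summable[OF gs] le] infsumI[OF gs]
    by simp
  then have "ln (Z n ?z) \<le> ln ?C" using pos by simp
  also have "\<dots> = (1 - u) * ln (Z n x) + u * ln (Z n y)"
    using pos by (simp add: ln_mult ln_powr)
  finally show ?thesis .
qed

lemma P_convex: "convex_on {\<theta><..} P"
proof (rule convex_onI)
  fix u x y :: real assume u: "0 < u" "u < 1" and xy: "x \<in> {\<theta><..}" "y \<in> {\<theta><..}"
  have z: "(1 - u) * x + u * y > \<theta>"
    using convexD[OF convex_real_interval(3)[of \<theta>] xy, of "1 - u" u] u by simp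
  have "P ((1 - u) * x + u * y) \<le> (1 - u) * P x + u * P y"
  proof (rule tendsto_le[OF sequentially_bot])
    show "(\<lambda>n. ln (Z n ((1 - u) * x + u * y)) / n) \<longlonglongrightarrow> P ((1 - u) * x + u * y)"
      by (rule P_lim[OF z])
    show "(\<lambda>n. (1 - u) * (ln (Z n x) / n) + u * (ln (Z n y) / n)) \<longlonglongrightarrow> (1 - u) * P x + u * P y"
      using xy by (intro tendsto_intros P_lim) auto
    show "\<forall>\<^sub>F n in sequentially. ln (Z n ((1 - u) * x + u * y)) / n \<le>
        (1 - u) * (ln (Z n x) / n) + u * (ln (Z n y) / n)"
      using eventually_ge_at_top[of 1]
    proof eventually_elim
      case (elim n)
      then show ?case
        using divide_right_mono[OF Z_log_convex[of x y u n], of "real n"] xy u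
        by (simp add: add_divide_distrib)
    qed
  qed
  then show "P ((1 - u) *\<^sub>R x + u *\<^sub>R y) \<le> (1 - u) * P x + u * P y" by simp
qed auto

text \<open>Raising \<open>t\<close> by one may cost a factor \<open>K\<close> in the
  submultiplicative bound. For a length \<open>N\<close> at which all weights are at most
  \<open>1 / (2 * K)\<close>, it also multiplies \<open>Z N t\<close> by at most
  \<open>1 / (2 * K)\<close>, so a net factor \<open>1 / 2\<close> remains.\<close>

lemma P_neg: "\<exists>T. \<forall>t\<ge>T. P t < 0"
proof -
  obtain N where N: "N \<ge> 1" "\<And>w. admissible A w \<Longrightarrow> length w = N \<Longrightarrow> \<psi> w \<le> 1 / (2 * K)"
    using weight_small[of "1 / (2 * K)"] K_ge_1 by auto
  define t0 where "t0 = \<theta> + 1"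
  have t0: "t0 > \<theta>" by (simp add: t0_def)
  have bound: "P t \<le> (ln (Z N t0) + t0 * ln K - (t - t0) * ln 2) / N" if t: "t \<ge> t0" for t
  proof -
    have "Z N t \<le> Z N t0 * (1 / (2 * K)) powr (t - t0)"
      unfolding Z_def
    proof (subst infsum_cmult_left'[symmetric], rule infsum_mono)
      fix w assume w: "w \<in> words N"
      have "\<psi> w powr t = \<psi> w powr t0 * \<psi> w powr (t - t0)"
        by (simp flip: powr_add)
      also have "\<dots> \<le> \<psi> w powr t0 * (1 / (2 * K)) powr (t - t0)"
        using N(2)[of w] w weight_pos_words[OF w] t by (intro mult_left_mono powr_mono2) (auto simp: words_def)
      finally show "\<psi> w powr t \<le> \<psi> w powr t0 * (1 / (2 * K)) powr (t - t0)" .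
    qed (use t t0 N(1) summable_words in \<open>auto intro!: summable_on_cmult_left\<close>)
    then have "ln (Z N t) \<le> ln (Z N t0 * (1 / (2 * K)) powr (t - t0))"
      using Z_pos[of t N] Z_pos[of t0 N] t t0 N(1) K_ge_1 by (subst ln_le_cancel_iff) auto
    also have "\<dots> = ln (Z N t0) + (t - t0) * ln (1 / (2 * K))"
      using Z_pos[of t0 N] t0 N(1) K_ge_1 by (simp add: ln_mult ln_powr)
    also have "ln (1 / (2 * K)) = - ln 2 - ln K"
      using K_ge_1 by (simp add: ln_div ln_mult)
    finally have "ln (Z N t) + t * ln K \<le> ln (Z N t0) + t0 * ln K - (t - t0) * ln 2"
      by (simp add: algebra_simps)
    moreover have "P t \<le> (ln (Z N t) + t * ln K) / N"
      using P_le t t0 N(1) by simp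
    ultimately show ?thesis
      by (smt (verit) divide_right_mono of_nat_0_le_iff)
  qed
  define T where "T = t0 + \<bar>ln (Z N t0) + t0 * ln K\<bar> / ln 2 + 1"
  have "P t < 0" if "t \<ge> T" for t
  proof -
    have q: "\<bar>ln (Z N t0) + t0 * ln K\<bar> / ln 2 \<ge> 0" by simp
    have "(t - t0) * ln 2 \<ge> (\<bar>ln (Z N t0) + t0 * ln K\<bar> / ln 2 + 1) * ln 2"
      using that by (intro mult_right_mono) (auto simp: T_def)
    then have "(t - t0) * ln 2 > ln (Z N t0) + t0 * ln K"
      by (simp add: algebra_simps) (smt (verit) ln_gt_zero)
    then have "(ln (Z N t0) + t0 * ln K - (t - t0) * ln 2) / N < 0"
      using N(1) by (intro divide_neg_pos) auto
    moreover have "t \<ge> t0" using that q unfolding T_def by linarith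
    ultimately show ?thesis using bound[of t] by linarith
  qed
  then show ?thesis by blast
qed

text \<open>By \<open>P_ge\<close> it suffices that \<open>L powr t * Z 1 t > 1\<close> for some
  \<open>t > \<theta>\<close>. At \<theta> the terms of the parabolic powers are bounded below by
  multiples of \<open>1 / n\<close>. A finite piece \<open>g\<close> of this harmonic series already
  exceeds 1 there, and being a finite sum it is continuous, so it still does so slightly to the
  right of \<theta>.\<close>

lemma P_pos: "\<exists>t>\<theta>. P t > 0"
proof -
  have "filterlim (\<lambda>M. (L / K) powr \<theta> * (harm M :: real)) at_top sequentially"
    using L_pos K_ge_1 harm_at_top by (intro filterlim_tendsto_pos_mult_at_top[OF tendsto_const]) auto
  then obtain M :: nat where M: "(L / K) powr \<theta> * (harm M :: real) > 1"
    using eventually_happens'[OF sequentially_bot] unfolding filterlim_at_top_dense by blast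
  define g where "g t = (\<Sum>n=1..M. (L * (real n powr (- 2 * s) / K)) powr t)" for t
  have "g \<theta> = (\<Sum>n=1..M. (L / K) powr \<theta> * inverse (real n))"
    unfolding g_def
  proof (intro sum.cong refl)
    fix n assume n: "n \<in> {1..M}"
    have "(L * (real n powr (- 2 * s) / K)) powr \<theta> = (L / K * real n powr (- 2 * s)) powr \<theta>"
      by simp
    also have "\<dots> = (L / K) powr \<theta> * (real n powr (- 2 * s)) powr \<theta>"
      by (rule powr_mult)
    also have "(real n powr (- 2 * s)) powr \<theta> = real n powr (- 1)"
      unfolding powr_powr using s_pos by (intro arg_cong[of _ _ "(powr) (real n)"]) (simp add: \<theta>_def)
    also have "\<dots> = inverse (real n)" using n powr_neg_one[of "real n"] by (simp add: inverse_eq_divide)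
    finally show "(L * (real n powr (- 2 * s) / K)) powr \<theta> = (L / K) powr \<theta> * inverse (real n)" .
  qed
  then have g1: "g \<theta> > 1" using M by (simp add: harm_def sum_distrib_left)
  have "(g \<longlongrightarrow> g \<theta>) (at_right \<theta>)"
    unfolding g_def using L_pos K_ge_1 by (intro tendsto_intros) auto
  then have "\<forall>\<^sub>F t in at_right \<theta>. g t > 1"
    using g1 by (rule order_tendstoD)
  then obtain t where t: "t > \<theta>" "g t > 1"
    by (metis (mono_tags, lifting) eventually_at_right_field gt_ex dense)
  have "L powr t * Z 1 t \<ge> g t"
  proof -
    have "g t = L powr t * (\<Sum>n=1..M. (real n powr (- 2 * s) / K) powr t)"
      unfolding g_def sum_distrib_left by (intro sum.cong refl powr_mult)
    moreover have "(\<Sum>n=1..M. (real n powr (- 2 * s) / K) powr t) \<le> (\<Sum>n=1..M. \<psi> [(p, int n)] powr t)"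
    proof (intro sum_mono powr_mono2)
      fix n assume "n \<in> {1..M}"
      then show "real n powr (- 2 * s) / K \<le> \<psi> [(p, int n)]"
        using weight_parabolic_ge[of "int n"] K_ge_1 by (simp add: divide_le_eq mult.commute)
    qed (use t theta_pos K_ge_1 in auto)
    moreover have "(\<Sum>n=1..M. \<psi> [(p, int n)] powr t) =
        sum (\<lambda>w. \<psi> w powr t) ((\<lambda>n. [(p, int n)]) ` {1..M})"
      by (subst sum.reindex) (auto simp: inj_on_def)
    moreover have "sum (\<lambda>w. \<psi> w powr t) ((\<lambda>n. [(p, int n)]) ` {1..M}) \<le> Z 1 t"
      unfolding Z_def using summable_words[of t 1] t(1) p_A
      by (intro finite_sum_le_infsum) (auto simp: words_def admissible_single)
    ultimately show ?thesis by (simp add: mult_left_mono)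
  qed
  then have "L powr t * Z 1 t > 1" using t by linarith
  then have "ln (L powr t * Z 1 t) > 0" by simp
  then have "ln (Z 1 t) + t * ln L > 0"
    using L_pos Z_pos[of t 1] t(1) by (simp add: ln_mult ln_powr)
  then show ?thesis using P_ge[OF t(1)] t(1) by (intro exI[of _ t]) auto
qed

lemma P_unique_zero: "\<exists>!t. t \<in> {\<theta><..} \<and> P t = 0"
  using convex_unique_zero[OF P_convex] P_pos P_neg by blast

end

section \<open>From words to periodic points and the Gurevich pressure\<close>

lemma infsum_ennreal:
  fixes f :: "'a \<Rightarrow> real"
  assumes "f summable_on X" "\<And>x. x \<in> X \<Longrightarrow> f x \<ge> 0"
  shows "infsum (\<lambda>x. ennreal (f x)) X = ennreal (infsum f X)"
proof -
  have "(SUP F\<in>{F. finite F \<and> F \<subseteq> X}. (\<Sum>x\<in>F. ennreal (f x))) =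
        (SUP F\<in>{F. finite F \<and> F \<subseteq> X}. ennreal (sum f F))"
    using assms(2) by (intro SUP_cong) (auto intro!: sum_ennreal)
  then show ?thesis
    using infsum_nonneg_is_SUPREMUM_ennreal[OF assms] by (simp add: nonneg_infsum_complete)
qed

lemma funpow_shift: "(shift ^^ n) x = (\<lambda>i. x (i + n))"
  by (induction n arbitrary: x) (auto simp: shift_def)

definition periodic_ext :: "'a list \<Rightarrow> nat \<Rightarrow> 'a" where
  "periodic_ext v i = v ! (i mod length v)"

lemma shift_periodic_ext: "(shift ^^ length v) (periodic_ext v) = periodic_ext v"
  by (auto simp: funpow_shift periodic_ext_def)

lemma map_periodic_ext: "map (periodic_ext v) [0..<length v] = v"
  by (intro nth_equalityI) (auto simp: periodic_ext_def)

lemma periodic_ext_map: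
  assumes "(shift ^^ n) x = x" "n \<ge> 1"
  shows "periodic_ext (map x [0..<n]) = x"
proof
  fix i
  have "x (j + k * n) = x j" for j k
  proof (induction k)
    case (Suc k)
    then show ?case
      using fun_cong[OF assms(1), of "j + k * n"] by (simp add: funpow_shift add_ac)
  qed simp
  from this[of "i mod n" "i div n"] show "periodic_ext (map x [0..<n]) i = x i"
    using assms(2) by (simp add: periodic_ext_def)
qed

lemma periodic_ext_in_markov_shift:
  assumes v: "v \<noteq> []" "admissible A v" "fst (last v) \<noteq> fst (hd v)"
  shows "periodic_ext v \<in> markov_shift A"
proof -
  have n: "length v > 0" using v by simp
  have "fst (v ! (i mod length v)) \<noteq> fst (v ! (Suc i mod length v))" for i
  proof (cases "Suc (i mod length v) = length v")
    case True
    then have "Suc i mod length v = 0" by (simp add: mod_Suc)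
    moreover have "i mod length v = length v - 1"
      using True by linarith
    then have "v ! (i mod length v) = last v"
      using v(1) by (simp add: last_conv_nth)
    ultimately show ?thesis using v by (simp add: hd_conv_nth)
  next
    case False
    then have "Suc i mod length v = Suc (i mod length v)" by (simp add: mod_Suc)
    moreover have "Suc (i mod length v) < length v"
      using False n by (metis Suc_lessI mod_less_divisor)
    ultimately show ?thesis
      using v(2) distinct_adj_nth[of "map fst v" "i mod length v"] by (simp add: admissible_def)
  qed
  moreover have "v ! (i mod length v) \<in> set v" for i
    using n by simp
  ultimately show ?thesis
    using v(2) by (auto simp: markov_shift_def periodic_ext_def admissible_def)
qed

lemma admissible_map_markov_shift:
  assumes "x \<in> markov_shift A"
  shows "admissible A (map x [0..<n])"
  using assms by (auto simp: admissible_def markov_shift_def distinct_adj_conv_nth)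

text \<open>The link to the shift: the Birkhoff sum over a period is comparable to the weight of
  that period, with the same constant \<open>K\<close> as for concatenation. No bound on
  \<open>u\<close> at other points is assumed.\<close>

locale word_potential = word_weights +
  fixes u :: "(nat \<Rightarrow> 'a \<times> int) \<Rightarrow> real"
  assumes potential_le: "n \<ge> 1 \<Longrightarrow> x \<in> markov_shift A \<Longrightarrow> (shift ^^ n) x = x \<Longrightarrow>
      exp (- birkhoff_sum n u x) \<le> K * \<psi> (map x [0..<n])"
    and potential_ge: "n \<ge> 1 \<Longrightarrow> x \<in> markov_shift A \<Longrightarrow> (shift ^^ n) x = x \<Longrightarrow>
      \<psi> (map x [0..<n]) \<le> K * exp (- birkhoff_sum n u x)"
begin

definition periodic :: "'a \<times> int \<Rightarrow> nat \<Rightarrow> (nat \<Rightarrow> 'a \<times> int) set" where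
  "periodic e n = {x \<in> markov_shift A. (shift ^^ n) x = x \<and> x 0 = e}"

definition R :: "real \<Rightarrow> 'a \<times> int \<Rightarrow> nat \<Rightarrow> real" where
  "R t e n = infsum (\<lambda>x. exp (- birkhoff_sum n u x) powr t) (periodic e n)"

lemma R_summable_le:
  assumes t: "t > \<theta>" and n: "n \<ge> 1"
  shows "(\<lambda>x. exp (- birkhoff_sum n u x) powr t) summable_on periodic e n"
    and "R t e n \<le> K powr t * Z n t"
proof -
  have sm: "(\<lambda>w. K powr t * \<psi> w powr t) summable_on words n"
    using summable_words[OF t n] by (rule summable_on_cmult_right)
  have inj: "inj_on (\<lambda>x. map x [0..<n]) (periodic e n)"
    using n periodic_ext_map by (intro inj_on_inverseI[of _ periodic_ext]) (auto simp: periodic_def)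
  have sub: "(\<lambda>x. map x [0..<n]) ` periodic e n \<subseteq> words n"
    by (auto simp: periodic_def words_def admissible_map_markov_shift)
  have le: "exp (- birkhoff_sum n u x) powr t \<le> K powr t * \<psi> (map x [0..<n]) powr t"
    if "x \<in> periodic e n" for x
  proof -
    have "exp (- birkhoff_sum n u x) powr t \<le> (K * \<psi> (map x [0..<n])) powr t"
      using potential_le[OF n, of x] that t theta_pos by (intro powr_mono2) (auto simp: periodic_def)
    then show ?thesis by (simp add: powr_mult)
  qed
  note * = infsum_le_inj[OF sm inj sub, of "\<lambda>x. exp (- birkhoff_sum n u x) powr t"]
  show "(\<lambda>x. exp (- birkhoff_sum n u x) powr t) summable_on periodic e n"
    by (rule *(1)) (use le in auto)
  have "R t e n \<le> infsum (\<lambda>w. K powr t * \<psi> w powr t) (words n)"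
    unfolding R_def by (rule *(2)) (use le in auto)
  then show "R t e n \<le> K powr t * Z n t"
    by (simp add: Z_def infsum_cmult_right')
qed

lemma partition_sum_eq:
  assumes t: "t > \<theta>" and n: "n \<ge> 1"
  shows "partition_sum (markov_shift A) (\<lambda>x. - t * u x) e n = ennreal (R t e n)"
proof -
  have exp: "exp (birkhoff_sum n (\<lambda>x. - t * u x) x) = exp (- birkhoff_sum n u x) powr t" for x
    by (simp add: birkhoff_sum_def powr_def sum_distrib_left sum_negf)
  have "partition_sum (markov_shift A) (\<lambda>x. - t * u x) e n =
      infsum (\<lambda>x. ennreal (exp (- birkhoff_sum n u x) powr t)) (periodic e n)"
    unfolding partition_sum_def exp
    by (rule infsum_cong_neutral) (auto simp: periodic_def indicator_def)
  then show ?thesis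
    unfolding R_def using infsum_ennreal[OF R_summable_le(1)[OF t n]] by simp
qed

text \<open>Every word \<open>w\<close> sits in the period of a cyclic word \<open>e c w d\<close>.\<close>

lemma R_ge:
  assumes t: "t > \<theta>" and n: "n \<ge> 1" and e: "fst e \<in> A" "snd e \<noteq> 0"
  shows "(L\<^sup>2 * \<psi> [e] / K) powr t * Z n t \<le> R t e (n + 3)"
    and "periodic e (n + 3) \<noteq> {}"
proof -
  \<comment> \<open>In \<open>e c w d\<close> the letter \<open>c\<close> with its two junctions
    costs \<open>L\<close>; the letter \<open>d\<close> with its single junction costs at most
    another \<open>L\<close>, since \<open>L * K\<close> is below the weight of \<open>d\<close>.
    The division by \<open>K\<close> pays for passing from the weight of the period to the Birkhoff
    sum.\<close>
  define B where "B = L\<^sup>2 * \<psi> [e] / K"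
  define v1 where "v1 w = [e] @ (pick (fst (last [e])) (fst (hd w)), 1::int) # w" for w
  define v where "v w = v1 w @ [(pick (fst (last w)) (fst e), 1::int)]" for w
  have psi_s: "\<psi> [e] > 0" using e by (intro weight_pos) (simp add: admissible_single)
  have K: "K > 0" using K_ge_1 by simp
  have B: "B > 0" using L_pos K psi_s by (simp add: B_def)
  have v: "admissible A (v w)" "length (v w) = n + 3" "fst (last (v w)) \<noteq> fst (hd (v w))"
      "hd (v w) = e" "v w \<noteq> []" "K * B * \<psi> w \<le> \<psi> (v w)"
    if w: "w \<in> words n" for w
  proof -
    define d where "d = pick (fst (last w)) (fst e)"
    have w': "w \<noteq> []" "admissible A w" "length w = n" using w n by (auto simp: words_def)
    have v1: "admissible A (v1 w)" "L * (\<psi> [e] * \<psi> w) \<le> \<psi> (v1 w)"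
      using weight_connect[of "[e]" w] w' e by (auto simp: v1_def admissible_single)
    have d: "d \<in> A" "d \<noteq> fst (last w)" "d \<noteq> fst e"
      unfolding d_def by (rule pick)+
    have v1w: "last (v1 w) = last w" "v1 w \<noteq> []" using w' by (auto simp: v1_def)
    show adm: "admissible A (v w)"
      using v1 d v1w by (auto simp: v_def admissible_append admissible_single d_def[symmetric])
    show "length (v w) = n + 3" "hd (v w) = e" "v w \<noteq> []" "fst (last (v w)) \<noteq> fst (hd (v w))"
      using w' d(3) by (auto simp: v_def v1_def d_def)
    have "L * K\<^sup>2 \<le> \<psi> [(d, 1)]"
      using finite_A d(1) K by (simp add: L_def)
    moreover have "L * K \<le> L * K\<^sup>2"
      using K_ge_1 L_pos by (simp add: power2_eq_square)
    ultimately have Ld: "L * K \<le> \<psi> [(d, 1)]" by simp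
    have "\<psi> (v1 w) * \<psi> [(d, 1)] \<le> K * \<psi> (v w)"
      using weight_append_ge[of "v1 w" "[(d, 1)]"] adm v1w by (auto simp: v_def d_def)
    moreover have "L * (\<psi> [e] * \<psi> w) * (L * K) \<le> \<psi> (v1 w) * \<psi> [(d, 1)]"
      using v1(2) Ld weight_pos[OF v1(1)] L_pos K by (intro mult_mono) auto
    ultimately have "K * (L * (\<psi> [e] * \<psi> w) * L) \<le> K * \<psi> (v w)" by (simp add: mult_ac)
    then have "L * (\<psi> [e] * \<psi> w) * L \<le> \<psi> (v w)" using K by simp
    then show "K * B * \<psi> w \<le> \<psi> (v w)"
      using K by (simp add: B_def power2_eq_square mult_ac)
  qed
  have per: "periodic_ext (v w) \<in> periodic e (n + 3)" if w: "w \<in> words n" for w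
    using periodic_ext_in_markov_shift[OF v(5,1,3)[OF w]] shift_periodic_ext[of "v w"] v(2,4,5)[OF w]
    by (simp add: periodic_def) (simp add: periodic_ext_def hd_conv_nth)
  then show "periodic e (n + 3) \<noteq> {}" using words_nonempty[of n] by auto
  have "infsum (\<lambda>w. B powr t * \<psi> w powr t) (words n) \<le> R t e (n + 3)"
    unfolding R_def
  proof (rule infsum_le_inj(2)[where j = "\<lambda>w. periodic_ext (v w)"])
    show "(\<lambda>x. exp (- birkhoff_sum (n + 3) u x) powr t) summable_on periodic e (n + 3)"
      by (intro R_summable_le t) simp
    show "inj_on (\<lambda>w. periodic_ext (v w)) (words n)"
    proof (rule inj_onI)
      fix w w' assume w: "w \<in> words n" "w' \<in> words n" and eq: "periodic_ext (v w) = periodic_ext (v w')"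
      then have "v w = v w'"
        using map_periodic_ext[of "v w"] map_periodic_ext[of "v w'"] v(2) by metis
      then show "w = w'" by (simp add: v_def v1_def)
    qed
    show "(\<lambda>w. periodic_ext (v w)) ` words n \<subseteq> periodic e (n + 3)"
      using per by blast
    fix w assume w: "w \<in> words n"
    let ?x = "periodic_ext (v w)"
    have "\<psi> (map ?x [0..<n + 3]) \<le> K * exp (- birkhoff_sum (n + 3) u ?x)"
      using per[OF w] by (intro potential_ge) (auto simp: periodic_def)
    then have "K * (B * \<psi> w) \<le> K * exp (- birkhoff_sum (n + 3) u ?x)"
      using v(6)[OF w] map_periodic_ext[of "v w"] v(2)[OF w] by simp
    then have "B * \<psi> w \<le> exp (- birkhoff_sum (n + 3) u ?x)" using K by simp
    then have "(B * \<psi> w) powr t \<le> exp (- birkhoff_sum (n + 3) u ?x) powr t"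
      using B weight_pos_words[OF w] t theta_pos by (intro powr_mono2) auto
    then show "B powr t * \<psi> w powr t \<le> exp (- birkhoff_sum (n + 3) u ?x) powr t"
      by (simp add: powr_mult)
  qed auto
  then show "(L\<^sup>2 * \<psi> [e] / K) powr t * Z n t \<le> R t e (n + 3)"
    by (simp add: Z_def infsum_cmult_right' B_def)
qed

lemma ln_R_lim:
  assumes t: "t > \<theta>" and e: "fst e \<in> A" "snd e \<noteq> 0"
  shows "(\<lambda>n. ln (R t e n) / n) \<longlonglongrightarrow> P t" and "n \<ge> 4 \<Longrightarrow> R t e n > 0"
proof -
  define B where "B = L\<^sup>2 * \<psi> [e] / K"
  have B: "B > 0"
    using L_pos K_ge_1 weight_pos[of "[e]"] e by (simp add: B_def admissible_single)
  have pos: "R t e n > 0" and lower: "t * ln B + ln (Z (n - 3) t) \<le> ln (R t e n)" if n: "n \<ge> 4" for n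
  proof -
    have Z: "Z (n - 3) t > 0" using Z_pos[OF t] n by simp
    then have BZ: "0 < B powr t * Z (n - 3) t" using B by simp
    have le: "B powr t * Z (n - 3) t \<le> R t e n"
      using R_ge(1)[OF t _ e, of "n - 3"] n by (simp add: B_def)
    then show R: "R t e n > 0" using BZ by linarith
    have "ln (B powr t * Z (n - 3) t) \<le> ln (R t e n)"
      using le BZ R by simp
    then show "t * ln B + ln (Z (n - 3) t) \<le> ln (R t e n)"
      using B Z by (simp add: ln_mult ln_powr)
  qed
  then show "n \<ge> 4 \<Longrightarrow> R t e n > 0" by blast
  have upper: "ln (R t e n) \<le> t * ln K + ln (Z n t)" if n: "n \<ge> 4" for n
  proof -
    have Z: "Z n t > 0" using Z_pos[OF t] n by simp
    have "ln (R t e n) \<le> ln (K powr t * Z n t)"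
      using R_summable_le(2)[OF t, of n e] pos[OF n] Z K_ge_1 n by (subst ln_le_cancel_iff) auto
    then show ?thesis using Z K_ge_1 by (simp add: ln_mult ln_powr)
  qed
  show "(\<lambda>n. ln (R t e n) / n) \<longlonglongrightarrow> P t"
  proof (rule tendsto_sandwich)
    have "(\<lambda>n. t * ln B * (1 / real n) + (1 - 3 * (1 / real n)) * (ln (Z (n - 3) t) / real (n - 3)))
        \<longlonglongrightarrow> t * ln B * 0 + (1 - 3 * 0) * P t"
      by (intro tendsto_intros lim_1_over_n filterlim_compose[OF P_lim[OF t]] filterlim_minus_const_nat_at_top)
    then show "(\<lambda>n. t * ln B * (1 / real n) + (1 - 3 * (1 / real n)) * (ln (Z (n - 3) t) / real (n - 3)))
        \<longlonglongrightarrow> P t" by simp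
    have "(\<lambda>n. t * ln K * (1 / real n) + ln (Z n t) / n) \<longlonglongrightarrow> t * ln K * 0 + P t"
      by (intro tendsto_intros lim_1_over_n P_lim[OF t])
    then show "(\<lambda>n. t * ln K * (1 / real n) + ln (Z n t) / n) \<longlonglongrightarrow> P t" by simp
    show "\<forall>\<^sub>F n in sequentially. t * ln B * (1 / real n) +
        (1 - 3 * (1 / real n)) * (ln (Z (n - 3) t) / real (n - 3)) \<le> ln (R t e n) / n"
      using eventually_ge_at_top[of 4]
    proof eventually_elim
      case (elim n)
      have "t * ln B * (1 / real n) + (1 - 3 * (1 / real n)) * (ln (Z (n - 3) t) / real (n - 3)) =
          (t * ln B + ln (Z (n - 3) t)) / n"
        using elim by (simp add: field_simps of_nat_diff)
      then show ?case using divide_right_mono[OF lower[OF elim], of "real n"] by simp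
    qed
    show "\<forall>\<^sub>F n in sequentially. ln (R t e n) / n \<le> t * ln K * (1 / real n) + ln (Z n t) / n"
      using eventually_ge_at_top[of 4]
    proof eventually_elim
      case (elim n)
      then show ?case using divide_right_mono[OF upper[OF elim], of "real n"]
        by (simp add: add_divide_distrib)
    qed
  qed
qed

lemma gurevich_pressure_eq:
  assumes t: "t > \<theta>"
  shows "gurevich_pressure (markov_shift A) (\<lambda>x. - t * u x) = ereal (P t)"
proof -
  let ?S = "(\<lambda>x. x 0) ` markov_shift A"
  let ?f = "\<lambda>e n. ereal (1 / real n) * ln_ennreal (partition_sum (markov_shift A) (\<lambda>x. - t * u x) e n)"
  have lim: "?f e \<longlonglongrightarrow> ereal (P t)" if "e \<in> ?S" for e
  proof -
    have e: "fst e \<in> A" "snd e \<noteq> 0" using that by (auto simp: markov_shift_def)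
    have "(\<lambda>n. ereal (ln (R t e n) / n)) \<longlonglongrightarrow> ereal (P t)"
      using ln_R_lim(1)[OF t e] by simp
    moreover have "\<forall>\<^sub>F n in sequentially. ?f e n = ereal (ln (R t e n) / n)"
      using eventually_ge_at_top[of 4]
    proof eventually_elim
      case (elim n)
      then show ?case
        using partition_sum_eq[OF t, of n e] ln_R_lim(2)[OF t e elim]
        by (simp add: ln_ennreal_def)
    qed
    ultimately show ?thesis by (simp add: tendsto_cong)
  qed
  \<comment> \<open>At least one symbol must occur: otherwise every value would satisfy the
    condition defining \<open>gurevich_pressure\<close>, and the description would not be
    unique.\<close>
  have "periodic (p, 1) (1 + 3) \<noteq> {}"
    using R_ge(2)[OF t, of 1 "(p, 1)"] p_A by simp
  then obtain e where e: "e \<in> ?S" unfolding periodic_def by blast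
  show ?thesis
    unfolding gurevich_pressure_def
  proof (rule the_equality)
    show "\<forall>e\<in>?S. ?f e \<longlonglongrightarrow> ereal (P t)" using lim by blast
    fix Q assume "\<forall>e\<in>?S. ?f e \<longlonglongrightarrow> Q"
    with lim e show "Q = ereal (P t)" using LIMSEQ_unique by blast
  qed
qed

theorem unique_pressure_zero:
  "\<exists>!t. t \<in> {1 / (2 * s)<..} \<and> gurevich_pressure (markov_shift A) (\<lambda>x. - t * u x) = 0"
proof -
  have "t \<in> {\<theta><..} \<and> gurevich_pressure (markov_shift A) (\<lambda>x. - t * u x) = 0 \<longleftrightarrow>
        t \<in> {\<theta><..} \<and> P t = 0" for t
    using gurevich_pressure_eq[of t] by auto
  then show ?thesis
    using P_unique_zero by (simp only: \<theta>_def)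
qed

end

section \<open>Moebius transformations of the disk\<close>

definition su :: "complex \<Rightarrow> complex \<Rightarrow> bool" where
  "su \<alpha> \<beta> \<longleftrightarrow> (cmod \<alpha>)\<^sup>2 - (cmod \<beta>)\<^sup>2 = 1"

definition mob :: "complex \<Rightarrow> complex \<Rightarrow> complex \<Rightarrow> complex" where
  "mob \<alpha> \<beta> z = (\<alpha> * z + \<beta>) / (cnj \<beta> * z + cnj \<alpha>)"

text \<open>The conformal derivative of \<open>mob \<alpha> \<beta>\<close> at \<open>z\<close> is \<open>1 / (mden \<alpha> \<beta> z)\<^sup>2\<close>.\<close>

definition mden :: "complex \<Rightarrow> complex \<Rightarrow> complex \<Rightarrow> real" where
  "mden \<alpha> \<beta> z = cmod (cnj \<beta> * z + cnj \<alpha>)"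

lemma of_real_cmod_sq: "(complex_of_real (cmod z))\<^sup>2 = z * cnj z"
  using complex_norm_square[of z] by simp

lemma su_norm:
  assumes "su \<alpha> \<beta>"
  shows "cmod \<alpha> \<ge> 1" "cmod \<beta> < cmod \<alpha>"
proof -
  have "(cmod \<alpha>)\<^sup>2 \<ge> 1\<^sup>2" using assms by (simp add: su_def) (smt (verit) zero_le_power2)
  then show "cmod \<alpha> \<ge> 1" by (rule power2_le_imp_le) simp
  have "(cmod \<beta>)\<^sup>2 < (cmod \<alpha>)\<^sup>2" using assms by (simp add: su_def)
  then show "cmod \<beta> < cmod \<alpha>" by (rule power2_less_imp_less) simp
qed

lemma mden_le: "cmod z \<le> 1 \<Longrightarrow> mden \<alpha> \<beta> z \<le> cmod \<alpha> + cmod \<beta>"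
proof -
  assume z: "cmod z \<le> 1"
  have "mden \<alpha> \<beta> z \<le> cmod \<beta> * cmod z + cmod \<alpha>"
    unfolding mden_def by (metis norm_triangle_ineq norm_mult complex_mod_cnj)
  moreover have "cmod \<beta> * cmod z \<le> cmod \<beta> * 1" using z by (intro mult_left_mono) auto
  ultimately show ?thesis by simp
qed

lemma mden_ge:
  assumes z: "cmod z \<le> 1"
  shows "cmod \<alpha> - cmod \<beta> \<le> mden \<alpha> \<beta> z"
proof -
  have "cmod (cnj \<alpha>) - cmod (cnj \<beta> * z) \<le> mden \<alpha> \<beta> z"
    unfolding mden_def by (metis add.commute norm_diff_ineq)
  moreover have "cmod (cnj \<beta> * z) \<le> cmod \<beta> * 1"
    using z by (simp add: norm_mult mult_left_le)
  ultimately show ?thesis by simp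
qed

lemma mden_pos:
  assumes "su \<alpha> \<beta>" "cmod z \<le> 1"
  shows "mden \<alpha> \<beta> z > 0" "cnj \<beta> * z + cnj \<alpha> \<noteq> 0"
  using mden_ge[OF assms(2), of \<alpha> \<beta>] su_norm[OF assms(1)] by (auto simp: mden_def)

text \<open>\<open>mden\<close> is the modulus of an affine function with slope
  \<open>cnj \<beta>\<close>, so it cannot be small at two distant points.\<close>

lemma mden_add_ge: "cmod \<beta> * cmod (z - w) \<le> mden \<alpha> \<beta> z + mden \<alpha> \<beta> w"
proof -
  have "cmod \<beta> * cmod (z - w) = cmod ((cnj \<beta> * z + cnj \<alpha>) - (cnj \<beta> * w + cnj \<alpha>))"
    by (simp add: norm_mult flip: right_diff_distrib)
  also have "\<dots> \<le> mden \<alpha> \<beta> z + mden \<alpha> \<beta> w"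
    unfolding mden_def by (rule norm_triangle_ineq4)
  finally show ?thesis .
qed

lemma su_mult_cnj:
  assumes "su \<alpha> \<beta>" shows "\<alpha> * cnj \<alpha> - \<beta> * cnj \<beta> = 1"
proof -
  have "\<alpha> * cnj \<alpha> - \<beta> * cnj \<beta> = complex_of_real ((cmod \<alpha>)\<^sup>2 - (cmod \<beta>)\<^sup>2)"
    by (simp add: of_real_cmod_sq)
  then show ?thesis using assms unfolding su_def by (metis of_real_1)
qed

text \<open>The exact two-point form of the derivative formula: distances scale by the geometric
  mean of the derivatives at both points. It yields the contraction estimates as well as the
  distortion estimate.\<close>

lemma mob_diff:
  assumes su: "su \<alpha> \<beta>" and z: "cmod z \<le> 1" and w: "cmod w \<le> 1"
  shows "cmod (mob \<alpha> \<beta> z - mob \<alpha> \<beta> w) = cmod (z - w) / (mden \<alpha> \<beta> z * mden \<alpha> \<beta> w)"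
proof -
  have "mob \<alpha> \<beta> z - mob \<alpha> \<beta> w =
      ((\<alpha> * z + \<beta>) * (cnj \<beta> * w + cnj \<alpha>) - (\<alpha> * w + \<beta>) * (cnj \<beta> * z + cnj \<alpha>)) /
      ((cnj \<beta> * z + cnj \<alpha>) * (cnj \<beta> * w + cnj \<alpha>))"
    unfolding mob_def using mden_pos(2)[OF su z] mden_pos(2)[OF su w]
    by (simp add: diff_frac_eq)
  also have "(\<alpha> * z + \<beta>) * (cnj \<beta> * w + cnj \<alpha>) - (\<alpha> * w + \<beta>) * (cnj \<beta> * z + cnj \<alpha>) =
      (\<alpha> * cnj \<alpha> - \<beta> * cnj \<beta>) * (z - w)"
    by (simp add: algebra_simps)
  finally show ?thesis
    using su_mult_cnj[OF su] by (simp add: mden_def norm_mult norm_divide)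
qed

lemma mden_sq_diff:
  assumes "su \<alpha> \<beta>"
  shows "(mden \<alpha> \<beta> z)\<^sup>2 - (cmod (\<alpha> * z + \<beta>))\<^sup>2 = 1 - (cmod z)\<^sup>2"
proof -
  have "complex_of_real ((mden \<alpha> \<beta> z)\<^sup>2 - (cmod (\<alpha> * z + \<beta>))\<^sup>2) =
      (\<alpha> * cnj \<alpha> - \<beta> * cnj \<beta>) * (1 - z * cnj z)"
    unfolding mden_def by (simp add: of_real_cmod_sq) (simp add: algebra_simps)
  also have "\<dots> = complex_of_real (1 - (cmod z)\<^sup>2)"
    using su_mult_cnj[OF assms] by (simp add: of_real_cmod_sq)
  finally show ?thesis by (simp only: of_real_eq_iff)
qed

lemma norm_mob_sq:
  assumes su: "su \<alpha> \<beta>" and z: "cmod z \<le> 1"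
  shows "1 - (cmod (mob \<alpha> \<beta> z))\<^sup>2 = (1 - (cmod z)\<^sup>2) / (mden \<alpha> \<beta> z)\<^sup>2"
proof -
  have d: "mden \<alpha> \<beta> z \<noteq> 0" using mden_pos(1)[OF su z] by simp
  have "cmod (mob \<alpha> \<beta> z) = cmod (\<alpha> * z + \<beta>) / mden \<alpha> \<beta> z"
    by (simp add: mob_def norm_divide mden_def)
  then have "1 - (cmod (mob \<alpha> \<beta> z))\<^sup>2 = ((mden \<alpha> \<beta> z)\<^sup>2 - (cmod (\<alpha> * z + \<beta>))\<^sup>2) / (mden \<alpha> \<beta> z)\<^sup>2"
    using d by (simp add: power_divide diff_divide_distrib)
  then show ?thesis using mden_sq_diff[OF su] by simp
qed

lemma norm_mob:
  assumes "su \<alpha> \<beta>"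
  shows "cmod z = 1 \<Longrightarrow> cmod (mob \<alpha> \<beta> z) = 1" "cmod z < 1 \<Longrightarrow> cmod (mob \<alpha> \<beta> z) < 1"
    "cmod z \<le> 1 \<Longrightarrow> cmod (mob \<alpha> \<beta> z) \<le> 1"
proof -
  show 1: "cmod (mob \<alpha> \<beta> z) = 1" if "cmod z = 1"
  proof -
    have "(cmod (mob \<alpha> \<beta> z))\<^sup>2 = 1" using norm_mob_sq[OF assms, of z] that by simp
    then show ?thesis by (simp add: power2_eq_1_iff) (smt (verit) norm_ge_zero)
  qed
  show 2: "cmod (mob \<alpha> \<beta> z) < 1" if "cmod z < 1"
  proof -
    have "(1 - (cmod z)\<^sup>2) / (mden \<alpha> \<beta> z)\<^sup>2 > 0"
      using that mden_pos(1)[OF assms, of z] by (simp add: power_less_one_iff abs_square_less_1)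
    then have "(cmod (mob \<alpha> \<beta> z))\<^sup>2 < 1" using norm_mob_sq[OF assms, of z] that by simp
    then show ?thesis by (simp add: abs_square_less_1)
  qed
  show "cmod (mob \<alpha> \<beta> z) \<le> 1" if "cmod z \<le> 1"
    using 1 2 that by linarith
qed

text \<open>The second equation is the chain rule for the derivative
  \<open>1 / (mden \<alpha> \<beta> z)^2\<close>, and it is what makes Birkhoff sums
  collapse.\<close>

lemma mob_mult:
  fixes \<alpha> \<beta> :: complex
  assumes "su \<alpha>' \<beta>'" "cmod z \<le> 1"
  defines "\<alpha>'' \<equiv> \<alpha> * \<alpha>' + \<beta> * cnj \<beta>'" and "\<beta>'' \<equiv> \<alpha> * \<beta>' + \<beta> * cnj \<alpha>'"
  shows "mob \<alpha>'' \<beta>'' z = mob \<alpha> \<beta> (mob \<alpha>' \<beta>' z)"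
    and "mden \<alpha>'' \<beta>'' z = mden \<alpha> \<beta> (mob \<alpha>' \<beta>' z) * mden \<alpha>' \<beta>' z"
proof -
  let ?d = "cnj \<beta>' * z + cnj \<alpha>'"
  have d: "?d \<noteq> 0" using mden_pos(2)[OF assms(1,2)] .
  have den: "cnj \<beta> * mob \<alpha>' \<beta>' z + cnj \<alpha> = (cnj \<beta>'' * z + cnj \<alpha>'') / ?d"
    using d by (simp add: mob_def \<alpha>''_def \<beta>''_def field_simps)
  have num: "\<alpha> * mob \<alpha>' \<beta>' z + \<beta> = (\<alpha>'' * z + \<beta>'') / ?d"
    using d by (simp add: mob_def \<alpha>''_def \<beta>''_def field_simps)
  show "mob \<alpha>'' \<beta>'' z = mob \<alpha> \<beta> (mob \<alpha>' \<beta>' z)"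
    unfolding mob_def[of \<alpha> \<beta>] den num using d by (simp add: mob_def)
  show "mden \<alpha>'' \<beta>'' z = mden \<alpha> \<beta> (mob \<alpha>' \<beta>' z) * mden \<alpha>' \<beta>' z"
    unfolding mden_def[of \<alpha> \<beta>] den using d by (simp add: mden_def norm_divide)
qed

lemma mob_uminus: "mob (- \<alpha>) (- \<beta>) z = mob \<alpha> \<beta> z" "mden (- \<alpha>) (- \<beta>) z = mden \<alpha> \<beta> z"
proof -
  have "mob (- \<alpha>) (- \<beta>) z = (- (\<alpha> * z + \<beta>)) / (- (cnj \<beta> * z + cnj \<alpha>))"
    by (simp add: mob_def)
  then show "mob (- \<alpha>) (- \<beta>) z = mob \<alpha> \<beta> z" unfolding minus_divide_divide by (simp add: mob_def)
  have "mden (- \<alpha>) (- \<beta>) z = cmod (- (cnj \<beta> * z + cnj \<alpha>))" by (simp add: mden_def)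
  then show "mden (- \<alpha>) (- \<beta>) z = mden \<alpha> \<beta> z" unfolding norm_minus_cancel by (simp add: mden_def)
qed

text \<open>On the circle \<open>cnj z\<close> is the inverse of \<open>z\<close>; multiplying the
  fixed point equation by it leaves an equation of imaginary parts. For \<beta> \<noteq> 0 the fixed
  points are therefore the intersection of the circle with a line.\<close>

lemma mob_fixpoint_iff:
  assumes su: "su \<alpha> \<beta>" and z: "cmod z = 1"
  shows "mob \<alpha> \<beta> z = z \<longleftrightarrow> Im (cnj \<beta> * z) = Im \<alpha>"
proof -
  have zz: "z * cnj z = 1" using of_real_cmod_sq[of z] z by simp
  have "mob \<alpha> \<beta> z = z \<longleftrightarrow> \<alpha> * z + \<beta> = z * (cnj \<beta> * z + cnj \<alpha>)"
    using mden_pos(2)[OF su, of z] z by (simp add: mob_def divide_eq_eq)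
  also have "\<dots> \<longleftrightarrow> cnj z * (\<alpha> * z + \<beta>) = cnj z * (z * (cnj \<beta> * z + cnj \<alpha>))"
    using z by auto
  also have "cnj z * (\<alpha> * z + \<beta>) = \<alpha> * (z * cnj z) + \<beta> * cnj z" by (simp add: algebra_simps)
  also have "cnj z * (z * (cnj \<beta> * z + cnj \<alpha>)) = (z * cnj z) * (cnj \<beta> * z + cnj \<alpha>)" by (simp add: algebra_simps)
  also have "\<alpha> * (z * cnj z) + \<beta> * cnj z = (z * cnj z) * (cnj \<beta> * z + cnj \<alpha>) \<longleftrightarrow>
      \<alpha> - cnj \<alpha> = cnj \<beta> * z - cnj (cnj \<beta> * z)"
    unfolding zz by (auto simp: algebra_simps)
  also have "\<dots> \<longleftrightarrow> Im (cnj \<beta> * z) = Im \<alpha>"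
    unfolding complex_diff_cnj by (auto simp: complex_eq_iff)
  finally show ?thesis .
qed

lemma fixpoints_nontrivial:
  assumes su: "su \<alpha> \<beta>" and card: "card {z \<in> sphere 0 1. mob \<alpha> \<beta> z = z} \<noteq> 0"
  shows "\<beta> \<noteq> 0" "\<bar>Re \<alpha>\<bar> \<ge> 1"
proof -
  have "{z \<in> sphere 0 1. mob \<alpha> \<beta> z = z} \<noteq> {}" using card by (metis card.empty)
  then obtain z where z: "cmod z = 1" "mob \<alpha> \<beta> z = z" by auto
  then have im: "Im (cnj \<beta> * z) = Im \<alpha>" using mob_fixpoint_iff[OF su] by simp
  \<comment> \<open>For \<open>\<beta> = 0\<close> the condition no longer involves
    \<open>z\<close>, so the whole circle is fixed; \<open>card\<close> is 0 on infinite sets,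
    contrary to the assumption.\<close>
  show "\<beta> \<noteq> 0"
  proof
    assume "\<beta> = 0"
    then have "{z \<in> sphere 0 1. mob \<alpha> \<beta> z = z} = sphere (0::complex) 1"
      using mob_fixpoint_iff[OF su] im by auto
    moreover have "infinite (sphere (0::complex) 1)"
    proof
      assume "finite (sphere (0::complex) 1)"
      moreover have "connected (sphere (0::complex) 1)" by (rule connected_sphere) simp
      ultimately obtain a where a: "sphere (0::complex) 1 \<subseteq> {a}"
        using connected_finite_iff_sing by (metis empty_subsetI order_refl)
      have "1 \<in> sphere (0::complex) 1" "- 1 \<in> sphere (0::complex) 1" by auto
      with a have "(1::complex) = - 1" by blast
      then show False by simp
    qed
    ultimately show False using card by simp
  qed
  have "\<bar>Im \<alpha>\<bar> \<le> cmod (cnj \<beta> * z)" using abs_Im_le_cmod[of "cnj \<beta> * z"] im by simp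
  then have "\<bar>Im \<alpha>\<bar> \<le> cmod \<beta>" using z by (simp add: norm_mult)
  then have "(Im \<alpha>)\<^sup>2 \<le> (cmod \<beta>)\<^sup>2" by (metis abs_ge_zero power2_abs power_mono)
  moreover have "(cmod \<alpha>)\<^sup>2 = (Re \<alpha>)\<^sup>2 + (Im \<alpha>)\<^sup>2" by (rule cmod_power2)
  ultimately have "(Re \<alpha>)\<^sup>2 \<ge> 1" using su unfolding su_def by linarith
  then show "\<bar>Re \<alpha>\<bar> \<ge> 1" using abs_le_square_iff[of 1 "Re \<alpha>"] by simp
qed

text \<open>Reflecting a fixed point so that the real part of \<open>cnj \<beta> * z\<close> changes
  sign gives another fixed point. If there is only one, this real part vanishes: the line is tangent
  to the circle, and half the trace, \<open>Re \<alpha>\<close>, is 1 or -1.\<close>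

lemma single_fixpoint:
  assumes su: "su \<alpha> \<beta>" and card: "card {z \<in> sphere 0 1. mob \<alpha> \<beta> z = z} = 1"
  shows "\<bar>Re \<alpha>\<bar> = 1"
proof -
  have b: "\<beta> \<noteq> 0" using fixpoints_nontrivial[OF su] card by simp
  obtain z where z: "{z \<in> sphere 0 1. mob \<alpha> \<beta> z = z} = {z}"
    using card card_1_singletonE by blast
  then have z1: "cmod z = 1" "Im (cnj \<beta> * z) = Im \<alpha>"
    using mob_fixpoint_iff[OF su, of z] by auto
  define z' where "z' = - cnj (cnj \<beta> * z) / cnj \<beta>"
  have bz: "cnj \<beta> * z' = - cnj (cnj \<beta> * z)" using b by (simp add: z'_def)
  have "cmod z' = 1" using z1(1) b by (simp add: z'_def norm_divide norm_mult)
  moreover have "Im (cnj \<beta> * z') = Im \<alpha>" unfolding bz using z1(2) by simp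
  ultimately have "z' \<in> {z}"
    using mob_fixpoint_iff[OF su, of z'] z by auto
  then have "cnj \<beta> * z = - cnj (cnj \<beta> * z)" using bz by simp
  then have "Re (cnj \<beta> * z) = 0" by (metis complex_cnj_cancel_iff complex_cnj_minus complex_cnj_cnj minus_complex.sel(1) uminus_complex.sel(1) cnj.sel(1) equal_neg_zero)
  then have "cmod (cnj \<beta> * z) = \<bar>Im \<alpha>\<bar>" using z1(2) by (simp add: cmod_def)
  then have "(cmod \<beta>)\<^sup>2 = (Im \<alpha>)\<^sup>2" using z1(1) by (simp add: norm_mult)
  then have "(Re \<alpha>)\<^sup>2 = 1" using su cmod_power2[of \<alpha>] by (simp add: su_def)
  then show ?thesis by (simp add: power2_eq_1_iff)
    (smt (verit))
qed

section \<open>Elements of PSL(2,R)\<close>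

definition mal :: "real^2^2 \<Rightarrow> complex" where
  "mal A = Complex ((A$1$1 + A$2$2) / 2) ((A$1$2 - A$2$1) / 2)"

definition mbe :: "real^2^2 \<Rightarrow> complex" where
  "mbe A = Complex ((A$1$1 - A$2$2) / 2) (- (A$1$2 + A$2$1) / 2)"

lemma disk_moebius_eq: "disk_moebius A z = mob (mal A) (mbe A) z"
  by (simp add: disk_moebius_def mob_def mal_def mbe_def Let_def)

lemma mal_mbe_eqI:
  assumes "mal A = mal B" "mbe A = mbe B"
  shows "A = B"
  using assms by (simp add: mal_def mbe_def vec_eq_iff forall_2)

lemma mal_uminus: "mal (- A) = - mal A" "mbe (- A) = - mbe A"
  by (simp_all add: mal_def mbe_def complex_eq_iff field_simps)

lemma mal_mult:
  "mal (A ** B) = mal A * mal B + mbe A * cnj (mbe B)"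
  "mbe (A ** B) = mal A * mbe B + mbe A * cnj (mal B)"
  by (simp_all add: mal_def mbe_def complex_eq_iff matrix_matrix_mult_def sum_2 field_simps)

lemma mal_mat_1: "mal (mat 1) = 1" "mbe (mat 1) = 0"
  by (simp_all add: mal_def mbe_def complex_eq_iff mat_def)

lemma su_det: "su (mal A) (mbe A) \<longleftrightarrow> det A = 1"
  unfolding su_def cmod_power2 mal_def mbe_def det_2
  by (auto simp: power2_eq_square field_simps)

text \<open>Discreteness is given for real matrices, while the estimates are made for \<alpha> and
  \<beta>. The constant 4 counts the entries, each of which is off by at most the sum in
  parentheses.\<close>

lemma mal_mbe_dist_1:
  "dist (mat 1) A \<le> 4 * (cmod (mal A - 1) + cmod (mbe A))"
proof -
  have e: "A$1$1 = Re (mal A) + Re (mbe A)" "A$2$2 = Re (mal A) - Re (mbe A)"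
     "A$1$2 = Im (mal A) - Im (mbe A)" "A$2$1 = - Im (mal A) - Im (mbe A)"
    by (simp_all add: mal_def mbe_def field_simps)
  let ?e = "cmod (mal A - 1) + cmod (mbe A)"
  have b: "\<bar>Re (mal A) - 1\<bar> \<le> cmod (mal A - 1)" "\<bar>Im (mal A)\<bar> \<le> cmod (mal A - 1)"
     "\<bar>Re (mbe A)\<bar> \<le> cmod (mbe A)" "\<bar>Im (mbe A)\<bar> \<le> cmod (mbe A)"
    using abs_Re_le_cmod[of "mal A - 1"] abs_Im_le_cmod[of "mal A - 1"] abs_Re_le_cmod abs_Im_le_cmod by auto
  have "norm (mat 1 - A) \<le> (\<Sum>i\<in>UNIV. norm ((mat 1 - A) $ i))"
    unfolding norm_vec_def by (rule L2_set_le_sum) simp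
  also have "\<dots> \<le> (\<Sum>i\<in>UNIV. \<Sum>j\<in>UNIV. \<bar>(mat 1 - A) $ i $ j\<bar>)"
    by (intro sum_mono norm_le_l1_cart)
  also have "\<dots> = \<bar>1 - A$1$1\<bar> + \<bar>A$1$2\<bar> + (\<bar>A$2$1\<bar> + \<bar>1 - A$2$2\<bar>)"
    by (simp add: sum_2 mat_def)
  also have "\<dots> \<le> ?e + ?e + (?e + ?e)"
    unfolding e using b by (intro add_mono) linarith+
  also have "\<dots> = 4 * ?e" by simp
  finally show ?thesis by (simp add: dist_norm)
qed

lemma group_SL2R: "group SL2R"
proof (rule groupI)
  fix A assume "A \<in> carrier SL2R"
  then have A: "det A = 1" by (simp add: SL2R_def)
  then have "invertible A" by (simp add: invertible_det_nz)
  then obtain B where B: "A ** B = mat 1" "B ** A = mat 1" by (auto simp: invertible_def)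
  then have "det B * det A = 1" by (metis det_mul det_I)
  then show "\<exists>B\<in>carrier SL2R. B \<otimes>\<^bsub>SL2R\<^esub> A = \<one>\<^bsub>SL2R\<^esub>"
    using A B by (intro bexI[of _ B]) (auto simp: SL2R_def)
qed (auto simp: SL2R_def det_mul matrix_mul_assoc det_I)

lemma uminus_matrix_mult: "(- A) ** B = - (A ** B)" "A ** (- B) = - (A ** B)"
  for A B :: "real^2^2"
  by (simp_all add: matrix_matrix_mult_def vec_eq_iff sum_negf)

lemma det_uminus_2: "det (- A) = det A" for A :: "real^2^2"
  by (simp add: det_2)

lemma normal_pm1: "{mat 1, - mat 1} \<lhd> SL2R"
proof -
  interpret group SL2R by (rule group_SL2R)
  have i: "inv\<^bsub>SL2R\<^esub> (- mat 1) = - mat 1"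
    by (rule inv_equality) (auto simp: SL2R_def uminus_matrix_mult det_uminus_2 det_I)
  have "subgroup {mat 1, - mat 1} SL2R"
  proof (rule subgroupI)
    fix a assume "a \<in> {mat 1, - mat 1 :: real^2^2}"
    then show "inv\<^bsub>SL2R\<^esub> a \<in> {mat 1, - mat 1}"
      using i inv_one by (auto simp: SL2R_def)
  qed (auto simp: SL2R_def uminus_matrix_mult det_uminus_2 det_I)
  then show ?thesis
    by (rule normalI)
       (auto simp: r_coset_def l_coset_def SL2R_def uminus_matrix_mult)
qed

lemma group_PSL2R: "group PSL2R"
  unfolding PSL2R_def using normal_pm1 by (rule normal.factorgroup_is_group)

lemma carrier_PSL2R: "g \<in> carrier PSL2R \<longleftrightarrow> (\<exists>A. det A = 1 \<and> g = {A, - A})"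
proof -
  have "{mat 1, - mat 1} #>\<^bsub>SL2R\<^esub> A = {A, - A}" for A
    by (auto simp: r_coset_def SL2R_def uminus_matrix_mult)
  then show ?thesis
    by (auto simp: PSL2R_def FactGroup_def RCOSETS_def SL2R_def)
qed

lemma mult_PSL2R: "{A, - A} \<otimes>\<^bsub>PSL2R\<^esub> {B, - B} = {A ** B, - (A ** B)}"
  by (auto simp: PSL2R_def FactGroup_def set_mult_def SL2R_def uminus_matrix_mult)

lemma one_PSL2R: "\<one>\<^bsub>PSL2R\<^esub> = {mat 1, - mat 1}"
  by (simp add: PSL2R_def FactGroup_def)

text \<open>A choice of sign; all quantities derived from it below are even in \<open>(al g, be g)\<close>.\<close>

definition al :: "(real^2^2) set \<Rightarrow> complex" where "al g = mal (SOME A. A \<in> g)"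
definition be :: "(real^2^2) set \<Rightarrow> complex" where "be g = mbe (SOME A. A \<in> g)"

text \<open>The chosen signs are not compatible with products, so the homomorphism laws for
  \<open>al\<close> and \<open>be\<close> hold only up to a common sign of the pair.\<close>

definition pm_eq :: "complex \<times> complex \<Rightarrow> complex \<times> complex \<Rightarrow> bool" where
  "pm_eq p q \<longleftrightarrow> p = q \<or> p = - q"

lemma al_be:
  assumes "g \<in> carrier PSL2R"
  obtains A where "g = {A, - A}" "det A = 1" "al g = mal A" "be g = mbe A"
proof -
  obtain A where A: "det A = 1" "g = {A, - A}" using assms carrier_PSL2R by blast
  have "(SOME A. A \<in> g) \<in> g" by (rule someI[of _ A]) (simp add: A)
  then have "(SOME A. A \<in> g) = A \<or> (SOME A. A \<in> g) = - A" using A by auto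
  then show thesis
    using that[of A] that[of "- A"] A by (auto simp: al_def be_def det_uminus_2 insert_commute)
qed

lemma al_be_pm:
  assumes "A \<in> g" "g \<in> carrier PSL2R"
  shows "pm_eq (al g, be g) (mal A, mbe A)"
  using assms by (elim al_be) (auto simp: pm_eq_def mal_uminus)

lemma su_al_be: "g \<in> carrier PSL2R \<Longrightarrow> su (al g) (be g)"
  by (elim al_be) (simp add: su_det)

lemma psl_act_eq: 
  assumes "g \<in> carrier PSL2R" shows "psl_act g z = mob (al g) (be g) z"
proof -
  obtain A where A: "g = {A, - A}" "al g = mal A" "be g = mbe A" using al_be[OF assms] by metis
  then show ?thesis by (simp add: psl_act_def disk_moebius_uminus flip: disk_moebius_eq)
qed

lemma al_be_mult:
  assumes "g \<in> carrier PSL2R" "h \<in> carrier PSL2R"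
  shows "pm_eq (al (g \<otimes>\<^bsub>PSL2R\<^esub> h), be (g \<otimes>\<^bsub>PSL2R\<^esub> h))
    (al g * al h + be g * cnj (be h), al g * be h + be g * cnj (al h))"
proof -
  interpret group PSL2R by (rule group_PSL2R)
  obtain A where A: "g = {A, - A}" "al g = mal A" "be g = mbe A" using al_be[OF assms(1)] by metis
  obtain B where B: "h = {B, - B}" "al h = mal B" "be h = mbe B" using al_be[OF assms(2)] by metis
  have "A ** B \<in> g \<otimes>\<^bsub>PSL2R\<^esub> h" by (simp add: A B mult_PSL2R)
  from al_be_pm[OF this m_closed[OF assms]] show ?thesis
    unfolding A(2,3) B(2,3) by (simp add: mal_mult)
qed

lemma al_be_one: "pm_eq (al \<one>\<^bsub>PSL2R\<^esub>, be \<one>\<^bsub>PSL2R\<^esub>) (1, 0)"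
proof -
  interpret group PSL2R by (rule group_PSL2R)
  show ?thesis
    using al_be_pm[of "mat 1" "\<one>\<^bsub>PSL2R\<^esub>"] one_closed by (simp add: one_PSL2R mal_mat_1)
qed

lemma al_be_inv:
  assumes "g \<in> carrier PSL2R"
  shows "pm_eq (al (inv\<^bsub>PSL2R\<^esub> g), be (inv\<^bsub>PSL2R\<^esub> g)) (cnj (al g), - be g)"
proof -
  interpret group PSL2R by (rule group_PSL2R)
  obtain A where A: "g = {A, - A}" "det A = 1" "al g = mal A" "be g = mbe A" using al_be[OF assms] by metis
  \<comment> \<open>The adjugate of \<open>A\<close>, which is its inverse because the determinant
    is 1.\<close>
  define B :: "real^2^2" where "B = (\<chi> i j. if i = j then (if i = 1 then A$2$2 else A$1$1) else - A$i$j)"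
  have B: "mal B = cnj (mal A)" "mbe B = - mbe A"
    by (simp_all add: B_def mal_def mbe_def complex_eq_iff field_simps)
  have su: "su (mal A) (mbe A)" using A(2) by (simp add: su_det)
  then have dB: "det B = 1" by (simp add: B su_def flip: su_det)
  have BA: "B ** A = mat 1"
    using su_mult_cnj[OF su] by (intro mal_mbe_eqI) (simp_all add: mal_mult B mal_mat_1 mult.commute)
  have cB: "{B, - B} \<in> carrier PSL2R" using dB carrier_PSL2R by blast
  have "{B, - B} \<otimes>\<^bsub>PSL2R\<^esub> g = \<one>\<^bsub>PSL2R\<^esub>"
    by (simp add: A mult_PSL2R BA one_PSL2R)
  then have "inv\<^bsub>PSL2R\<^esub> g = {B, - B}" using inv_equality[OF _ assms cB] by simp
  then show ?thesis
    using al_be_pm[of B "inv\<^bsub>PSL2R\<^esub> g"] cB unfolding A(3,4) by (simp add: B)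
qed

lemma pm_eqD:
  assumes "pm_eq (\<alpha>, \<beta>) (\<alpha>', \<beta>')"
  shows "cmod \<alpha> = cmod \<alpha>'" "cmod \<beta> = cmod \<beta>'" "mob \<alpha> \<beta> z = mob \<alpha>' \<beta>' z" "mden \<alpha> \<beta> z = mden \<alpha>' \<beta>' z"
  using assms by (auto simp: pm_eq_def mob_uminus)

section \<open>The Busemann function of the disk\<close>

text \<open>Here \<open>q\<close> will be \<open>1 - (cmod z)^2\<close>, which tends to 0 at the
  boundary. The divergent term \<open>ln q\<close> is split off so that it cancels in the difference
  of two distances.\<close>

lemma arcosh_divide:
  fixes t q :: real
  assumes "q > 0" "t \<ge> q"
  shows "arcosh (t / q) = ln (t + sqrt (t\<^sup>2 - q\<^sup>2)) - ln q"
proof -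
  have "sqrt ((t / q)\<^sup>2 - 1) = sqrt ((t\<^sup>2 - q\<^sup>2) / q\<^sup>2)"
    using assms by (simp add: power_divide diff_divide_distrib)
  also have "\<dots> = sqrt (t\<^sup>2 - q\<^sup>2) / q" using assms by (simp add: real_sqrt_divide)
  finally have "t / q + sqrt ((t / q)\<^sup>2 - 1) = (t + sqrt (t\<^sup>2 - q\<^sup>2)) / q"
    by (simp add: add_divide_distrib)
  moreover have "sqrt (t\<^sup>2 - q\<^sup>2) \<ge> 0" using assms by simp
  then have "t + sqrt (t\<^sup>2 - q\<^sup>2) > 0" using assms by linarith
  ultimately show ?thesis
    using assms by (simp add: arcosh_real_def ln_div)
qed

text \<open>The logarithm of the Poisson kernel. After cancellation of \<open>ln q\<close> both
  remaining terms are continuous up to the boundary point, with limits \<open>ln 4\<close> and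
  \<open>ln (2 * V)\<close>.\<close>

lemma busemann_disk:
  assumes \<xi>: "cmod \<xi> = 1" and w: "cmod w < 1"
  shows "busemann \<xi> 0 w = ln ((1 - (cmod w)\<^sup>2) / (cmod (w - \<xi>))\<^sup>2)"
proof -
  let ?F = "at \<xi> within ball 0 1"
  define q where "q z = 1 - (cmod z)\<^sup>2" for z :: complex
  define e where "e z = q z + 2 * (cmod z)\<^sup>2" for z :: complex
  define f where "f z = q z + 2 * (cmod (w - z))\<^sup>2 / (1 - (cmod w)\<^sup>2)" for z
  define V where "V = 2 * (cmod (w - \<xi>))\<^sup>2 / (1 - (cmod w)\<^sup>2)"
  have w1: "1 - (cmod w)\<^sup>2 > 0" using w by (simp add: abs_square_less_1)
  have wx: "w \<noteq> \<xi>" using \<xi> w by auto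
  then have V: "V > 0" using w1 by (simp add: V_def)
  have idt: "((\<lambda>z. z) \<longlongrightarrow> \<xi>) ?F" by (rule tendsto_ident_at)
  have q: "(q \<longlongrightarrow> 0) ?F"
    unfolding q_def by (rule tendsto_eq_intros idt refl)+ (simp add: \<xi>)
  have e: "(e \<longlongrightarrow> 2) ?F"
    unfolding e_def by (rule tendsto_eq_intros idt refl q)+ (simp add: \<xi>)
  have f: "(f \<longlongrightarrow> V) ?F"
    unfolding f_def using w1 by (auto intro!: tendsto_eq_intros idt q simp: V_def)
  have "((\<lambda>z. ln (e z + sqrt ((e z)\<^sup>2 - (q z)\<^sup>2)) - ln (f z + sqrt ((f z)\<^sup>2 - (q z)\<^sup>2))) \<longlongrightarrow>
      ln (2 + sqrt (2\<^sup>2 - 0\<^sup>2)) - ln (V + sqrt (V\<^sup>2 - 0\<^sup>2))) ?F"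
    using V by (intro tendsto_intros e f q) auto
  moreover have "\<forall>\<^sub>F z in ?F. hdist 0 z - hdist w z =
      ln (e z + sqrt ((e z)\<^sup>2 - (q z)\<^sup>2)) - ln (f z + sqrt ((f z)\<^sup>2 - (q z)\<^sup>2))"
    unfolding eventually_at_filter
  proof (intro always_eventually allI impI)
    fix z :: complex assume "z \<in> ball 0 1"
    then have qz: "q z > 0" by (simp add: q_def abs_square_less_1)
    have "hdist 0 z = arcosh (1 + 2 * (cmod z)\<^sup>2 / q z)" by (simp add: hdist_def q_def)
    then have "hdist 0 z = arcosh (e z / q z)"
      using qz by (simp add: e_def add_divide_distrib)
    moreover have "hdist w z = arcosh (1 + 2 * (cmod (w - z))\<^sup>2 / ((1 - (cmod w)\<^sup>2) * q z))"
      by (simp add: hdist_def q_def)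
    then have "hdist w z = arcosh (f z / q z)"
      using qz by (simp add: f_def add_divide_distrib)
    moreover have "e z \<ge> q z" "f z \<ge> q z" using w1 by (auto simp: e_def f_def)
    ultimately show "hdist 0 z - hdist w z =
      ln (e z + sqrt ((e z)\<^sup>2 - (q z)\<^sup>2)) - ln (f z + sqrt ((f z)\<^sup>2 - (q z)\<^sup>2))"
      using arcosh_divide[OF qz] by simp
  qed
  ultimately have "((\<lambda>z. hdist 0 z - hdist w z) \<longlongrightarrow>
      ln (2 + sqrt (2\<^sup>2 - 0\<^sup>2)) - ln (V + sqrt (V\<^sup>2 - 0\<^sup>2))) ?F"
    by (simp only: tendsto_cong)
  also have "ln (2 + sqrt (2\<^sup>2 - 0\<^sup>2)) - ln (V + sqrt (V\<^sup>2 - 0\<^sup>2)) = ln 4 - ln (2 * V)"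
    using V by simp
  finally have "((\<lambda>z. hdist 0 z - hdist w z) \<longlongrightarrow> ln 4 - ln (2 * V)) ?F" .
  moreover have "\<not> trivial_limit ?F"
    using \<xi> by (simp add: trivial_limit_within islimpt_ball)
  ultimately have "busemann \<xi> 0 w = ln 4 - ln (2 * V)"
    unfolding busemann_def by (rule tendsto_Lim[rotated])
  also have "\<dots> = ln (4 / (2 * V))" using V ln_div[of 4 "2 * V"] by simp
  also have "4 / (2 * V) = (1 - (cmod w)\<^sup>2) / (cmod (w - \<xi>))\<^sup>2"
    using w1 wx by (simp add: V_def field_simps)
  finally show ?thesis .
qed

text \<open>The right-hand side is minus the logarithm of the derivative at \<open>z\<close>, the
  preimage of the boundary point that is used on the left.\<close>

lemma busemann_mob:
  assumes su: "su \<alpha> \<beta>" and z: "cmod z = 1"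
  shows "busemann (mob \<alpha> \<beta> z) 0 (mob \<alpha> \<beta> 0) = 2 * ln (mden \<alpha> \<beta> z)"
proof -
  have a: "cmod \<alpha> > 0" using su_norm[OF su] by linarith
  have d: "mden \<alpha> \<beta> z > 0" using mden_pos[OF su] z by simp
  have d0: "mden \<alpha> \<beta> 0 = cmod \<alpha>" by (simp add: mden_def)
  have "busemann (mob \<alpha> \<beta> z) 0 (mob \<alpha> \<beta> 0) =
      ln ((1 - (cmod (mob \<alpha> \<beta> 0))\<^sup>2) / (cmod (mob \<alpha> \<beta> 0 - mob \<alpha> \<beta> z))\<^sup>2)"
    using norm_mob[OF su] z by (intro busemann_disk) auto
  also have "(1 - (cmod (mob \<alpha> \<beta> 0))\<^sup>2) / (cmod (mob \<alpha> \<beta> 0 - mob \<alpha> \<beta> z))\<^sup>2 = (mden \<alpha> \<beta> z)\<^sup>2"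
  proof -
    have 1: "1 - (cmod (mob \<alpha> \<beta> 0))\<^sup>2 = 1 / (cmod \<alpha>)\<^sup>2"
      using norm_mob_sq[OF su, of 0] by (simp add: d0)
    have 2: "cmod (mob \<alpha> \<beta> 0 - mob \<alpha> \<beta> z) = 1 / (cmod \<alpha> * mden \<alpha> \<beta> z)"
      using mob_diff[OF su, of 0 z] z by (simp add: d0)
    show ?thesis unfolding 1 2 using a d by (simp add: power_divide power_mult_distrib)
  qed
  finally show ?thesis using d by (simp add: ln_realpow)
qed

section \<open>Extended Schottky groups\<close>

primrec word_elt :: "('g, 'm) monoid_scheme \<Rightarrow> ('g \<times> int) list \<Rightarrow> 'g" where
  "word_elt G [] = \<one>\<^bsub>G\<^esub>"
| "word_elt G (s # w) = symbol_elt G s \<otimes>\<^bsub>G\<^esub> word_elt G w"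

section \<open>Derivative cocycle and norm growth for a representation acting on the disk\<close>

locale disk_action = group G for G (structure) +
  fixes \<rho> :: "'a \<Rightarrow> (real^2^2) set"
  assumes hom: "\<rho> \<in> hom G PSL2R"
begin

definition act :: "'a \<Rightarrow> complex \<Rightarrow> complex" where "act g z = psl_act (\<rho> g) z"
definition F :: "'a \<Rightarrow> complex \<Rightarrow> real" where "F g z = mden (al (\<rho> g)) (be (\<rho> g)) z"
text \<open>For \<open>g\<close> in the group and \<open>r\<close> the hyperbolic distance from 0 to
  \<open>act g 0\<close>, \<open>N g\<close> is \<open>cosh (r / 2)\<close> and \<open>M g\<close>
  below is \<open>sinh (r / 2)\<close>.\<close>

definition N :: "'a \<Rightarrow> real" where "N g = cmod (al (\<rho> g))"
definition M :: "'a \<Rightarrow> real" where "M g = cmod (be (\<rho> g))"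

lemma group_hom_rho: "group_hom G PSL2R \<rho>"
  using hom group_PSL2R by (simp add: group_hom_def group_hom_axioms_def)

lemma rho_closed: "g \<in> carrier G \<Longrightarrow> \<rho> g \<in> carrier PSL2R"
  using hom by (auto simp: hom_def)

lemma su_rho: "g \<in> carrier G \<Longrightarrow> su (al (\<rho> g)) (be (\<rho> g))"
  by (simp add: rho_closed su_al_be)

lemma act_eq: "g \<in> carrier G \<Longrightarrow> act g z = mob (al (\<rho> g)) (be (\<rho> g)) z"
  by (simp add: act_def rho_closed psl_act_eq)

lemma rho_mult: "g \<in> carrier G \<Longrightarrow> h \<in> carrier G \<Longrightarrow>
    pm_eq (al (\<rho> (g \<otimes> h)), be (\<rho> (g \<otimes> h)))
      (al (\<rho> g) * al (\<rho> h) + be (\<rho> g) * cnj (be (\<rho> h)), al (\<rho> g) * be (\<rho> h) + be (\<rho> g) * cnj (al (\<rho> h)))"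
  using hom by (simp add: hom_def al_be_mult rho_closed)

lemma rho_inv: "g \<in> carrier G \<Longrightarrow>
    pm_eq (al (\<rho> (inv g)), be (\<rho> (inv g))) (cnj (al (\<rho> g)), - be (\<rho> g))"
  using group_hom.hom_inv[OF group_hom_rho] by (simp add: al_be_inv rho_closed)

lemma rho_one: "pm_eq (al (\<rho> \<one>), be (\<rho> \<one>)) (1, 0)"
  using group_hom.hom_one[OF group_hom_rho] by (simp add: al_be_one)

lemma N_ge_1: "g \<in> carrier G \<Longrightarrow> N g \<ge> 1"
  using su_norm(1)[OF su_rho[of g]] by (simp add: N_def)

lemma N_M: "g \<in> carrier G \<Longrightarrow> (N g)\<^sup>2 = 1 + (M g)\<^sup>2"
  using su_rho[of g] by (simp add: N_def M_def su_def)

lemma M_less_N: "g \<in> carrier G \<Longrightarrow> M g < N g"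
  using su_norm(2)[OF su_rho[of g]] by (simp add: N_def M_def)

lemma M_nonneg: "M g \<ge> 0"
  by (simp add: M_def)

lemma F_le: "g \<in> carrier G \<Longrightarrow> cmod z \<le> 1 \<Longrightarrow> F g z \<le> 2 * N g"
  using mden_le[of z "al (\<rho> g)" "be (\<rho> g)"] M_less_N[of g] by (simp add: F_def N_def M_def)

lemma F_ge: "cmod z \<le> 1 \<Longrightarrow> F g z \<ge> N g - M g"
  by (simp add: F_def N_def M_def mden_ge)

lemma F_pos: "g \<in> carrier G \<Longrightarrow> cmod z \<le> 1 \<Longrightarrow> F g z > 0"
  by (simp add: F_def su_rho mden_pos)

lemma F_add_ge: "M g * cmod (z - w) \<le> F g z + F g w"
  by (simp add: F_def M_def mden_add_ge)

lemma F_0: "F g 0 = N g"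
  by (simp add: F_def N_def mden_def)

lemma norm_act:
  assumes "g \<in> carrier G"
  shows "cmod z = 1 \<Longrightarrow> cmod (act g z) = 1" "cmod z < 1 \<Longrightarrow> cmod (act g z) < 1"
    "cmod z \<le> 1 \<Longrightarrow> cmod (act g z) \<le> 1"
  using norm_mob[OF su_rho[OF assms], of z] by (auto simp: act_eq[OF assms])

lemma act_mult:
  assumes "g \<in> carrier G" "h \<in> carrier G" "cmod z \<le> 1"
  shows "act (g \<otimes> h) z = act g (act h z)" "F (g \<otimes> h) z = F g (act h z) * F h z"
  using mob_mult[OF su_rho[OF assms(2)] assms(3), of "al (\<rho> g)" "be (\<rho> g)"]
    pm_eqD(3,4)[OF rho_mult[OF assms(1,2)], of z] assms
  by (simp_all add: act_eq F_def)

lemma act_one: "act \<one> z = z" "F \<one> z = 1"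
  using pm_eqD(3,4)[OF rho_one, of z] by (simp_all add: act_eq F_def mob_def mden_def)

lemma act_diff:
  assumes "g \<in> carrier G" "cmod z \<le> 1" "cmod w \<le> 1"
  shows "cmod (act g z - act g w) = cmod (z - w) / (F g z * F g w)"
  using mob_diff[OF su_rho] assms by (simp add: act_eq F_def)

lemma act_inv:
  assumes "g \<in> carrier G" "cmod z \<le> 1"
  shows "act g (act (inv g) z) = z" "F g (act (inv g) z) * F (inv g) z = 1"
  using act_mult[of g "inv g" z] assms by (simp_all add: act_one)

lemma N_inv: "g \<in> carrier G \<Longrightarrow> N (inv g) = N g" "g \<in> carrier G \<Longrightarrow> M (inv g) = M g"
  using pm_eqD(1,2)[OF rho_inv[of g]] by (simp_all add: N_def M_def)

lemma N_mult_le: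
  assumes "g \<in> carrier G" "h \<in> carrier G"
  shows "N (g \<otimes> h) \<le> 2 * (N g * N h)"
proof -
  have "N (g \<otimes> h) = F (g \<otimes> h) 0" by (simp add: F_0)
  also have "\<dots> = F g (act h 0) * N h" using act_mult[OF assms, of 0] by (simp add: F_0)
  also have "\<dots> \<le> (2 * N g) * N h"
    using F_le[OF assms(1), of "act h 0"] norm_act[OF assms(2), of 0] N_ge_1[OF assms(2)]
    by (intro mult_right_mono) auto
  finally show ?thesis by simp
qed

text \<open>
  If \<open>\<xi>\<close> is far from the images under \<open>inv g\<close> of two distant points, then it is far from the pole
  of \<open>g\<close>, so that the derivative of \<open>g\<close> at \<open>\<xi>\<close> is comparable to \<open>1 / (N g)\<^sup>2\<close>.
\<close>

lemma distortion:
  assumes g: "g \<in> carrier G" and norms: "cmod \<xi> = 1" "cmod \<eta>1 = 1" "cmod \<eta>2 = 1"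
    and \<delta>: "\<delta> > 0" "cmod (\<eta>1 - \<eta>2) \<ge> \<delta>"
      "cmod (act (inv g) \<eta>1 - \<xi>) \<ge> \<delta>" "cmod (act (inv g) \<eta>2 - \<xi>) \<ge> \<delta>"
  shows "min (1/2) (\<delta>\<^sup>2 / 8) * N g \<le> F g \<xi>"
proof -
  have F: "F g \<xi> > 0" using F_pos[OF g] norms by simp
  \<comment> \<open>The points \<eta> and \<open>act g \<xi>\<close> of the circle are at distance
    at most 2. By \<open>act_diff\<close> this distance is that of their preimages times
    \<open>F (inv g) \<eta> / F g \<xi>\<close>.\<close>
  have key: "\<delta> * F (inv g) \<eta> \<le> 2 * F g \<xi>" if \<eta>: "cmod \<eta> = 1" "cmod (act (inv g) \<eta> - \<xi>) \<ge> \<delta>" for \<eta>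
  proof -
    let ?\<zeta> = "act (inv g) \<eta>"
    have n: "cmod ?\<zeta> = 1" using norm_act(1)[of "inv g"] g \<eta> by simp
    have Fi: "F (inv g) \<eta> > 0" using F_pos[of "inv g"] g \<eta> by simp
    have "F g ?\<zeta> * F (inv g) \<eta> = 1" "act g ?\<zeta> = \<eta>" using act_inv[OF g, of \<eta>] \<eta> by auto
    then have "F g ?\<zeta> = 1 / F (inv g) \<eta>" using Fi by (simp add: field_simps)
    then have "cmod (\<eta> - act g \<xi>) = cmod (?\<zeta> - \<xi>) * F (inv g) \<eta> / F g \<xi>"
      using act_diff[OF g, of ?\<zeta> \<xi>] n norms \<open>act g ?\<zeta> = \<eta>\<close> by simp
    moreover have "cmod (\<eta> - act g \<xi>) \<le> 2"
      using norm_triangle_ineq4[of \<eta> "act g \<xi>"] norm_act(1)[OF g norms(1)] \<eta> by simp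
    ultimately have "cmod (?\<zeta> - \<xi>) * F (inv g) \<eta> \<le> 2 * F g \<xi>"
      using F by (simp add: divide_le_eq)
    moreover have "\<delta> * F (inv g) \<eta> \<le> cmod (?\<zeta> - \<xi>) * F (inv g) \<eta>"
      using \<eta> Fi by (intro mult_right_mono) auto
    ultimately show ?thesis by linarith
  qed
  \<comment> \<open>Two separated points \<eta> are needed because \<open>F (inv g)\<close> may be
    small at one of them, but not at both unless \<open>M g\<close> is small.\<close>
  have "M g * \<delta> \<le> M g * cmod (\<eta>1 - \<eta>2)"
    using \<delta> M_nonneg by (intro mult_left_mono) auto
  also have "\<dots> \<le> F (inv g) \<eta>1 + F (inv g) \<eta>2"
    using F_add_ge[of "inv g"] N_inv(2)[OF g] by simp
  finally have "\<delta> * (M g * \<delta>) \<le> \<delta> * (F (inv g) \<eta>1 + F (inv g) \<eta>2)"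
    using \<delta> by (intro mult_left_mono) auto
  also have "\<dots> \<le> 4 * F g \<xi>"
    using key[OF norms(2) \<delta>(3)] key[OF norms(3) \<delta>(4)] by (simp add: algebra_simps)
  finally have MF: "\<delta>\<^sup>2 * M g \<le> 4 * F g \<xi>" by (simp add: power2_eq_square mult_ac)
  have N: "N g \<ge> 1" by (rule N_ge_1[OF g])
  \<comment> \<open>If \<open>M g\<close> is at least half of \<open>N g\<close>, the bound just
    found gives the constant \<open>\<delta>\<^sup>2 / 8\<close>. Otherwise \<open>g\<close> has its
    pole far from the circle and the trivial bound \<open>N g - M g\<close> gives
    \<open>1/2\<close>.\<close>
  show ?thesis
  proof (cases "M g \<ge> N g / 2")
    case True
    have "min (1/2) (\<delta>\<^sup>2 / 8) * N g \<le> \<delta>\<^sup>2 / 8 * N g" using N by (intro mult_right_mono) auto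
    also have "\<dots> = \<delta>\<^sup>2 * (N g / 2) / 4" by simp
    also have "\<dots> \<le> \<delta>\<^sup>2 * M g / 4" using True by (intro divide_right_mono mult_left_mono) auto
    also have "\<dots> \<le> F g \<xi>" using MF by simp
    finally show ?thesis .
  next
    case False
    have "min (1/2) (\<delta>\<^sup>2 / 8) * N g \<le> 1/2 * N g" using N by (intro mult_right_mono) auto
    also have "\<dots> \<le> N g - M g" using False by simp
    also have "\<dots> \<le> F g \<xi>" using F_ge norms by simp
    finally show ?thesis .
  qed
qed

text \<open>By Cayley-Hamilton the \<open>n\<close>-th power of a matrix of determinant 1 is \<open>u\<close> times the matrix minus \<open>v\<close>.\<close>

lemma M_pow:
  assumes a: "a \<in> carrier G" and re: "\<bar>Re (al (\<rho> a))\<bar> \<ge> 1" and n: "n \<ge> 1"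
  shows "M (a [^] (n::nat)) \<ge> n * M a"
    and "\<bar>Re (al (\<rho> a))\<bar> = 1 \<Longrightarrow> M (a [^] n) \<le> n * M a"
proof -
  let ?\<alpha> = "al (\<rho> a)" and ?\<beta> = "be (\<rho> a)"
  let ?e = "Re ?\<alpha>"
  have su: "?\<alpha> * cnj ?\<alpha> - ?\<beta> * cnj ?\<beta> = 1" using su_mult_cnj[OF su_rho[OF a]] .
  have tr: "?\<alpha> + cnj ?\<alpha> = 2 * complex_of_real ?e" by (simp add: complex_add_cnj)
  \<comment> \<open>Up to sign, \<open>u\<close> and \<open>v\<close> are consecutive values of
    Chebyshev polynomials of the second kind at \<open>?e\<close>. The gap between
    \<open>\<bar>v\<bar>\<close> and \<open>\<bar>u\<bar>\<close> propagates the linear growth; in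
    the parabolic case \<open>u * ?e - v\<close> is half the trace of the power and stays 1 or -1,
    which gives the opposite bound on \<open>u\<close>.\<close>
  have "\<exists>u v. al (\<rho> (a [^] n)) = complex_of_real u * ?\<alpha> - complex_of_real v \<and>
      be (\<rho> (a [^] n)) = complex_of_real u * ?\<beta> \<and> real n \<le> \<bar>u\<bar> \<and> \<bar>v\<bar> + 1 \<le> \<bar>u\<bar> \<and>
      (\<bar>?e\<bar> = 1 \<longrightarrow> \<bar>u\<bar> \<le> real n \<and> \<bar>u * ?e - v\<bar> = (1::real))"
    using n
  proof (induction n rule: dec_induct)
    case base
    show ?case using a by (rule_tac exI[of _ 1], rule_tac exI[of _ 0]) simp
  next
    case (step n)
    then obtain u v where uv: "al (\<rho> (a [^] n)) = complex_of_real u * ?\<alpha> - complex_of_real v"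
      "be (\<rho> (a [^] n)) = complex_of_real u * ?\<beta>" "real n \<le> \<bar>u\<bar>" "\<bar>v\<bar> + 1 \<le> \<bar>u\<bar>"
      "\<bar>?e\<bar> = 1 \<longrightarrow> \<bar>u\<bar> \<le> real n \<and> \<bar>u * ?e - v\<bar> = (1::real)" by blast
    define u' v' where "u' = 2 * ?e * u - v" and "v' = u"
    have 1: "al (\<rho> (a [^] n)) * ?\<alpha> + be (\<rho> (a [^] n)) * cnj ?\<beta> = u' * ?\<alpha> - v'"
    proof -
      have "al (\<rho> (a [^] n)) * ?\<alpha> + be (\<rho> (a [^] n)) * cnj ?\<beta> =
          u * (?\<alpha> * (?\<alpha> + cnj ?\<alpha>) - (?\<alpha> * cnj ?\<alpha> - ?\<beta> * cnj ?\<beta>)) - v * ?\<alpha>"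
        by (simp add: uv algebra_simps)
      also have "\<dots> = u' * ?\<alpha> - v'"
        unfolding su tr by (simp add: u'_def v'_def algebra_simps)
      finally show ?thesis .
    qed
    have 2: "al (\<rho> (a [^] n)) * ?\<beta> + be (\<rho> (a [^] n)) * cnj ?\<alpha> = u' * ?\<beta>"
    proof -
      have "al (\<rho> (a [^] n)) * ?\<beta> + be (\<rho> (a [^] n)) * cnj ?\<alpha> = u * ((?\<alpha> + cnj ?\<alpha>) * ?\<beta>) - v * ?\<beta>"
        by (simp add: uv algebra_simps)
      also have "\<dots> = u' * ?\<beta>" unfolding tr by (simp add: u'_def algebra_simps)
      finally show ?thesis .
    qed
    have "\<bar>2 * ?e * u\<bar> \<ge> 2 * \<bar>u\<bar>"
      using mult_right_mono[OF re, of "2 * \<bar>u\<bar>"] by (simp add: abs_mult)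
    then have u': "real (Suc n) \<le> \<bar>u'\<bar>" "\<bar>v'\<bar> + 1 \<le> \<bar>u'\<bar>"
      using uv(3,4) unfolding u'_def v'_def by linarith+
    have par: "\<bar>u'\<bar> \<le> real (Suc n) \<and> \<bar>u' * ?e - v'\<bar> = (1::real)" if e: "\<bar>?e\<bar> = 1"
    proof -
      have uv5: "\<bar>u\<bar> \<le> n" "\<bar>u * ?e - v\<bar> = 1" using uv(5) e by auto
      have "?e = 1 \<or> ?e = - 1" using e by linarith
      then show ?thesis using uv5 by (auto simp: u'_def v'_def)
    qed
    \<comment> \<open>The product law determines the power only up to a common sign; replacing
      \<open>u'\<close> and \<open>v'\<close> by their negatives preserves all invariants, which are
      stated with absolute values for this reason.\<close>
    have "pm_eq (al (\<rho> (a [^] Suc n)), be (\<rho> (a [^] Suc n))) (u' * ?\<alpha> - v', u' * ?\<beta>)"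
      using rho_mult[of "a [^] n" a] a unfolding 1 2 by simp
    then consider "al (\<rho> (a [^] Suc n)) = u' * ?\<alpha> - v' \<and> be (\<rho> (a [^] Suc n)) = u' * ?\<beta>"
      | "al (\<rho> (a [^] Suc n)) = (- u') * ?\<alpha> - (- v') \<and> be (\<rho> (a [^] Suc n)) = (- u') * ?\<beta>"
      by (auto simp: pm_eq_def)
    then show ?case
    proof cases
      case 1
      then show ?thesis using u' par by blast
    next
      case 2
      have "al (\<rho> (a [^] Suc n)) = complex_of_real (- u') * ?\<alpha> - complex_of_real (- v') \<and>
          be (\<rho> (a [^] Suc n)) = complex_of_real (- u') * ?\<beta>" using 2 by simp
      moreover have "real (Suc n) \<le> \<bar>- u'\<bar> \<and> \<bar>- v'\<bar> + 1 \<le> \<bar>- u'\<bar>" using u' by simp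
      moreover have "\<bar>?e\<bar> = 1 \<longrightarrow> \<bar>- u'\<bar> \<le> real (Suc n) \<and> \<bar>- u' * ?e - - v'\<bar> = (1::real)"
        using par by (simp add: abs_minus_commute)
      ultimately show ?thesis by blast
    qed
  qed
  then obtain u where u: "be (\<rho> (a [^] n)) = complex_of_real u * ?\<beta>" "real n \<le> \<bar>u\<bar>"
    "\<bar>?e\<bar> = 1 \<longrightarrow> \<bar>u\<bar> \<le> real n" by blast
  have M: "M (a [^] n) = \<bar>u\<bar> * M a" by (simp add: M_def u(1) norm_mult)
  show "M (a [^] n) \<ge> n * M a" unfolding M using u(2) M_nonneg by (intro mult_right_mono) auto
  show "M (a [^] n) \<le> n * M a" if "\<bar>?e\<bar> = 1"
    unfolding M using u(3) that M_nonneg by (intro mult_right_mono) auto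
qed

lemma N_int_pow:
  assumes a: "a \<in> carrier G" and re: "\<bar>Re (al (\<rho> a))\<bar> \<ge> 1" and n: "n \<noteq> 0"
  shows "N (a [^] (n::int)) \<ge> real_of_int \<bar>n\<bar> * M a"
    and "\<bar>Re (al (\<rho> a))\<bar> = 1 \<Longrightarrow> N (a [^] n) \<le> real_of_int \<bar>n\<bar> * (1 + M a)"
proof -
  define k where "k = nat \<bar>n\<bar>"
  have k: "k \<ge> 1" "real k = real_of_int \<bar>n\<bar>" using n by (auto simp: k_def)
  have "n = int k \<or> n = - int k" by (auto simp: k_def)
  then have "a [^] n = a [^] k \<or> a [^] n = inv (a [^] k)"
    using int_pow_int int_pow_neg_int[OF a] by metis
  then have N: "N (a [^] n) = N (a [^] k)" using N_inv a by auto
  have ak: "a [^] k \<in> carrier G" using a by simp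
  show "N (a [^] n) \<ge> real_of_int \<bar>n\<bar> * M a"
    using M_pow(1)[OF a re k(1)] M_less_N[OF ak] k(2) unfolding N by simp
  assume e: "\<bar>Re (al (\<rho> a))\<bar> = 1"
  have M: "M (a [^] k) \<le> k * M a" by (rule M_pow(2)[OF a re k(1) e])
  have "N x \<le> 1 + M x" if x: "x \<in> carrier G" for x
  proof (rule power2_le_imp_le)
    show "(N x)\<^sup>2 \<le> (1 + M x)\<^sup>2"
      using N_M[OF x] M_nonneg[of x] unfolding power2_sum by simp
    show "0 \<le> 1 + M x" using M_nonneg[of x] by simp
  qed
  from this[OF ak] have "N (a [^] k) \<le> 1 + M (a [^] k)" .
  also have "\<dots> \<le> k * (1 + M a)" using M k(1) by (simp add: algebra_simps)
  finally show "N (a [^] n) \<le> real_of_int \<bar>n\<bar> * (1 + M a)" unfolding N using k(2) by simp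
qed

text \<open>Isolation of the identity suffices: if \<open>g\<close> and \<open>h\<close> are close
  and bounded, then \<open>inv g \<otimes> h\<close> is close to the identity, hence trivial. An
  infinite set with bounded \<open>N\<close> would have a limit point and thus contain two distinct
  close elements.\<close>

lemma finite_N_le:
  assumes inj: "inj_on \<rho> (carrier G)" and disc: "discrete (\<Union>(\<rho> ` carrier G))"
  shows "finite {g \<in> carrier G. N g \<le> R}"
proof -
  have one: "mat 1 \<in> \<rho> \<one>"
    using group_hom.hom_one[OF group_hom_rho] by (simp add: one_PSL2R)
  then have "mat 1 isolated_in (\<Union>(\<rho> ` carrier G))"
    using disc by (intro discreteD) auto
  then obtain e where e: "e > 0"
    "\<And>A. A \<in> \<Union>(\<rho> ` carrier G) \<Longrightarrow> dist (mat 1) A < e \<Longrightarrow> A = mat 1"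
    unfolding isolated_in_dist_Ex_iff by blast
  have near_one: "g = \<one>"
    if g: "g \<in> carrier G" and pm: "pm_eq (al (\<rho> g), be (\<rho> g)) (\<alpha>, \<beta>)"
      and lt: "4 * (cmod (\<alpha> - 1) + cmod \<beta>) < e" for g \<alpha> \<beta>
  proof -
    obtain A where A: "\<rho> g = {A, - A}" "al (\<rho> g) = mal A" "be (\<rho> g) = mbe A"
      using al_be[OF rho_closed[OF g]] by metis
    have "\<exists>B\<in>\<rho> g. mal B = \<alpha> \<and> mbe B = \<beta>"
      using pm unfolding A(2,3) unfolding A(1) pm_eq_def by (auto simp: mal_uminus)
    then obtain B where B: "B \<in> \<rho> g" "mal B = \<alpha>" "mbe B = \<beta>" by blast
    have "dist (mat 1) B < e" using mal_mbe_dist_1[of B] lt by (simp add: B)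
    then have "B = mat 1" using e(2)[of B] B(1) g by blast
    then have "A = mat 1 \<or> A = - mat 1"
      using B(1) unfolding A(1) by (metis insertE minus_minus singletonD)
    then have "\<rho> g = {mat 1, - mat 1}"
      unfolding A(1) by (elim disjE) (simp_all add: insert_commute)
    then have "\<rho> g = \<rho> \<one>" using group_hom.hom_one[OF group_hom_rho] by (simp add: one_PSL2R)
    then show ?thesis using inj g by (meson inj_onD one_closed)
  qed
  define R' where "R' = max R 1"
  have R': "R' \<ge> 1" "R \<le> R'" by (auto simp: R'_def)
  \<comment> \<open>The entries of \<open>inv g \<otimes> h\<close> will deviate by less than
    \<open>2 * R' * \<eta>\<close>, which is \<open>e / 8\<close>; two such deviations times the
    factor 4 of \<open>mal_mbe_dist_1\<close> stay below \<open>e\<close>.\<close>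
  define \<eta> where "\<eta> = e / (16 * R')"
  have \<eta>: "\<eta> > 0" using e R' by (simp add: \<eta>_def)
  have close: "g = h"
    if g: "g \<in> carrier G" "N g \<le> R" and h: "h \<in> carrier G"
      and d: "cmod (al (\<rho> h) - al (\<rho> g)) < \<eta>" "cmod (be (\<rho> h) - be (\<rho> g)) < \<eta>" for g h
  proof -
    let ?\<alpha> = "al (\<rho> g)" and ?\<beta> = "be (\<rho> g)" and ?\<alpha>' = "al (\<rho> h)" and ?\<beta>' = "be (\<rho> h)"
    let ?a = "cnj ?\<alpha> * ?\<alpha>' - ?\<beta> * cnj ?\<beta>'" and ?b = "cnj ?\<alpha> * ?\<beta>' - ?\<beta> * cnj ?\<alpha>'"
    have su: "?\<alpha> * cnj ?\<alpha> - ?\<beta> * cnj ?\<beta> = 1" using su_mult_cnj[OF su_rho[OF g(1)]] .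
    have pm: "pm_eq (al (\<rho> (inv g \<otimes> h)), be (\<rho> (inv g \<otimes> h))) (?a, ?b)"
      using rho_mult[of "inv g" h] rho_inv[OF g(1)] g(1) h by (auto simp: pm_eq_def)
    have nb: "cmod ?\<alpha> \<le> R'" "cmod ?\<beta> \<le> R'"
      using g R' M_less_N[OF g(1)] by (auto simp: N_def M_def)
    have "?a - 1 = cnj ?\<alpha> * (?\<alpha>' - ?\<alpha>) - ?\<beta> * cnj (?\<beta>' - ?\<beta>)"
      using su by (simp add: algebra_simps)
    then have "cmod (?a - 1) \<le> cmod ?\<alpha> * cmod (?\<alpha>' - ?\<alpha>) + cmod ?\<beta> * cmod (?\<beta>' - ?\<beta>)"
      by (metis norm_triangle_ineq4 norm_mult complex_mod_cnj)
    also have "\<dots> \<le> R' * cmod (?\<alpha>' - ?\<alpha>) + R' * cmod (?\<beta>' - ?\<beta>)"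
      using nb by (intro add_mono mult_right_mono) auto
    also have "\<dots> < R' * \<eta> + R' * \<eta>"
      using d R' by (intro add_strict_mono mult_strict_left_mono) auto
    finally have 1: "cmod (?a - 1) < 2 * R' * \<eta>" by simp
    have "?b = cnj ?\<alpha> * (?\<beta>' - ?\<beta>) - ?\<beta> * cnj (?\<alpha>' - ?\<alpha>)"
      by (simp add: algebra_simps)
    then have "cmod ?b \<le> cmod ?\<alpha> * cmod (?\<beta>' - ?\<beta>) + cmod ?\<beta> * cmod (?\<alpha>' - ?\<alpha>)"
      by (metis norm_triangle_ineq4 norm_mult complex_mod_cnj)
    also have "\<dots> \<le> R' * cmod (?\<beta>' - ?\<beta>) + R' * cmod (?\<alpha>' - ?\<alpha>)"
      using nb by (intro add_mono mult_right_mono) auto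
    also have "\<dots> < R' * \<eta> + R' * \<eta>"
      using d R' by (intro add_strict_mono mult_strict_left_mono) auto
    finally have 2: "cmod ?b < 2 * R' * \<eta>" by simp
    have "R' * \<eta> = e / 16" using R' by (simp add: \<eta>_def)
    then have "4 * (cmod (?a - 1) + cmod ?b) < e" using 1 2 e(1) by simp
    then have "inv g \<otimes> h = \<one>" using near_one[OF _ pm] g(1) h by simp
    then show "g = h" using g(1) h by (metis inv_closed inv_equality inv_inv)
  qed
  let ?S = "{g \<in> carrier G. N g \<le> R}" and ?f = "\<lambda>g. (al (\<rho> g), be (\<rho> g))"
  have injf: "inj_on ?f ?S"
    using close \<eta> by (intro inj_onI) auto
  have bdd: "bounded (?f ` ?S)"
  proof (rule bounded_subset)
    show "bounded (cball (0::complex) R \<times> cball (0::complex) R)" by (intro bounded_Times bounded_cball)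
    show "?f ` ?S \<subseteq> cball 0 R \<times> cball 0 R"
      using M_less_N by (fastforce simp: N_def M_def)
  qed
  show ?thesis
  proof (rule ccontr)
    assume "infinite ?S"
    then have "infinite (?f ` ?S)" using injf finite_imageD by blast
    then obtain p where p: "p islimpt ?f ` ?S"
      using bounded_infinite_imp_islimpt[OF order_refl bdd] by blast
    then have inf: "infinite (?f ` ?S \<inter> ball p (\<eta> / 2))"
      using \<eta> unfolding islimpt_eq_infinite_ball by auto
    define T where "T = ?f ` ?S \<inter> ball p (\<eta> / 2)"
    have "infinite T" unfolding T_def by (rule inf)
    then have "T \<noteq> {}" by (rule infinite_imp_nonempty)
    then obtain q where qT: "q \<in> T" by blast
    have "infinite (T - {q})" using \<open>infinite T\<close> by (rule infinite_remove)
    then have "T - {q} \<noteq> {}" by (rule infinite_imp_nonempty)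
    then obtain r where rT: "r \<in> T - {q}" by blast
    have q: "q \<in> ?f ` ?S" "dist p q < \<eta> / 2" and r: "r \<in> ?f ` ?S" "dist p r < \<eta> / 2" "r \<noteq> q"
      using qT rT by (auto simp only: T_def Int_iff mem_ball Diff_iff singleton_iff)
    have "dist q r < \<eta>" using q(2) r(2) by (rule dist_triangle_half_r)
    obtain g h where gh: "g \<in> ?S" "h \<in> ?S" "q = ?f g" "r = ?f h" using q(1) r(1) by blast
    have "dist (al (\<rho> g)) (al (\<rho> h)) < \<eta>" "dist (be (\<rho> g)) (be (\<rho> h)) < \<eta>"
      using \<open>dist q r < \<eta>\<close> dist_fst_le[of q r] dist_snd_le[of q r] gh by auto
    then have "g = h" using gh by (intro close) (auto simp: dist_norm norm_minus_commute)
    then show False using gh(3,4) r(3) by simp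
  qed
qed

lemma busemann_act:
  assumes "g \<in> carrier G" "cmod z = 1"
  shows "busemann (act g z) 0 (act g 0) = 2 * ln (F g z)"
  using busemann_mob[OF su_rho[OF assms(1)] assms(2)] assms(1) by (simp add: act_eq F_def)

end

text \<open>For a hyperbolic generator \<open>a\<close> the set \<open>D a\<close> will be the union
  of its attracting and repelling neighbourhoods. Then every nonzero power of any generator maps the
  complement of \<open>D a\<close> in the circle into \<open>D a\<close>, and the two kinds of
  generators need no further distinction in the ping-pong arguments.\<close>

locale schottky_action = disk_action +
  fixes A :: "'a set" and D :: "'a \<Rightarrow> complex set"
  assumes inj: "inj_on \<rho> (carrier G)" and disc: "discrete (\<Union>(\<rho> ` carrier G))"
    and A_closed: "A \<subseteq> carrier G" and finite_A: "finite A" and card_A: "card A \<ge> 3"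
    and D_compact: "a \<in> A \<Longrightarrow> compact (D a)" and D_sphere: "a \<in> A \<Longrightarrow> D a \<subseteq> sphere 0 1"
    and D_nonempty: "a \<in> A \<Longrightarrow> D a \<noteq> {}"
    and D_disjoint: "a \<in> A \<Longrightarrow> b \<in> A \<Longrightarrow> a \<noteq> b \<Longrightarrow> D a \<inter> D b = {}"
    and ping_pong: "a \<in> A \<Longrightarrow> n \<noteq> 0 \<Longrightarrow> z \<in> sphere 0 1 \<Longrightarrow> z \<notin> D a \<Longrightarrow>
      psl_act (\<rho> (a [^] (n::int))) z \<in> D a"
begin

section \<open>Ping-pong for words, uniform distortion and escape to infinity\<close>

abbreviation elt :: "('a \<times> int) list \<Rightarrow> 'a" where "elt \<equiv> word_elt G"

lemma D_norm: "a \<in> A \<Longrightarrow> z \<in> D a \<Longrightarrow> cmod z = 1"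
  using D_sphere[of a] by (simp add: subset_iff)

lemma act_symbol:
  assumes "fst s \<in> A" "snd s \<noteq> 0" "b \<in> A" "b \<noteq> fst s" "z \<in> D b"
  shows "act (symbol_elt G s) z \<in> D (fst s)" "act (inv (symbol_elt G s)) z \<in> D (fst s)"
proof -
  have z: "z \<in> sphere 0 1" "z \<notin> D (fst s)" using assms D_disjoint D_norm by fastforce+
  show "act (symbol_elt G s) z \<in> D (fst s)"
    unfolding act_def symbol_elt_def using assms z by (intro ping_pong)
  have "inv (symbol_elt G s) = fst s [^] (- snd s)"
    unfolding symbol_elt_def using assms(1) A_closed by (intro int_pow_neg[symmetric]) auto
  then show "act (inv (symbol_elt G s)) z \<in> D (fst s)"
    unfolding act_def using assms z by (simp add: ping_pong)
qed

lemma symbol_closed: "fst s \<in> A \<Longrightarrow> symbol_elt G s \<in> carrier G"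
  using A_closed by (auto simp: symbol_elt_def)

lemma elt_closed: "admissible A w \<Longrightarrow> elt w \<in> carrier G"
  by (induction w) (auto simp: admissible_Cons symbol_closed)

lemma elt_append: "admissible A v \<Longrightarrow> admissible A w \<Longrightarrow> elt (v @ w) = elt v \<otimes> elt w"
  by (induction v) (auto simp: admissible_Cons symbol_closed elt_closed m_assoc)

lemma act_elt:
  assumes "admissible A w" "w \<noteq> []" "b \<in> A" "b \<noteq> fst (last w)" "z \<in> D b"
  shows "act (elt w) z \<in> D (fst (hd w))"
  using assms
proof (induction w)
  case (Cons s w)
  have s: "fst s \<in> A" "snd s \<noteq> 0" "admissible A w" using Cons.prems by (auto simp: admissible_Cons)
  have z: "cmod z \<le> 1" using D_norm[OF Cons.prems(3,5)] by simp
  have eq: "act (elt (s # w)) z = act (symbol_elt G s) (act (elt w) z)"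
    using act_mult(1)[OF symbol_closed[OF s(1)] elt_closed[OF s(3)] z] by simp
  show ?case
  proof (cases "w = []")
    case True
    then show ?thesis unfolding eq using act_symbol(1)[OF s(1,2)] Cons.prems by (simp add: act_one)
  next
    case False
    then have "act (elt w) z \<in> D (fst (hd w))" using Cons s by simp
    moreover have "fst (hd w) \<in> A" using False s(3) by (simp add: admissible_def)
    moreover have "fst (hd w) \<noteq> fst s" using False Cons.prems(1) by (auto simp: admissible_Cons)
    ultimately show ?thesis unfolding eq using act_symbol(1)[OF s(1,2)] by simp
  qed
qed simp

lemma act_inv_elt:
  assumes "admissible A w" "w \<noteq> []" "b \<in> A" "b \<noteq> fst (hd w)" "z \<in> D b"
  shows "act (inv (elt w)) z \<in> D (fst (last w))"
  using assms
\<comment> \<open>The inverse of a word undoes its first letter first, so the point and its set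
  \<open>D b\<close> change along the induction.\<close>
proof (induction w arbitrary: b z)
  case (Cons s w)
  have s: "fst s \<in> A" "snd s \<noteq> 0" "admissible A w" using Cons.prems by (auto simp: admissible_Cons)
  have z: "cmod z \<le> 1" using D_norm[OF Cons.prems(3,5)] by simp
  have "inv (elt (s # w)) = inv (elt w) \<otimes> inv (symbol_elt G s)"
    using symbol_closed[OF s(1)] elt_closed[OF s(3)] by (simp add: inv_mult_group)
  then have eq: "act (inv (elt (s # w))) z = act (inv (elt w)) (act (inv (symbol_elt G s)) z)"
    using act_mult(1)[of "inv (elt w)" "inv (symbol_elt G s)" z] symbol_closed[OF s(1)] elt_closed[OF s(3)] z
    by simp
  have 1: "act (inv (symbol_elt G s)) z \<in> D (fst s)"
    using act_symbol(2)[OF s(1,2)] Cons.prems by simp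
  show ?case
  proof (cases "w = []")
    case True
    then show ?thesis unfolding eq using 1 by (simp add: act_one)
  next
    case False
    then have "fst s \<noteq> fst (hd w)" using Cons.prems(1) by (auto simp: admissible_Cons)
    then show ?thesis unfolding eq using Cons.IH[OF s(3) False s(1) _ 1] False by simp
  qed
qed simp

lemma D_separated: "\<exists>\<delta>>0. \<forall>a\<in>A. \<forall>b\<in>A. \<forall>z\<in>D a. \<forall>w\<in>D b. a \<noteq> b \<longrightarrow> \<delta> \<le> cmod (z - w)"
proof -
  have "\<exists>d>0. \<forall>z\<in>D a. \<forall>w\<in>D b. a \<noteq> b \<longrightarrow> d \<le> cmod (z - w)" if "a \<in> A" "b \<in> A" for a b
  proof (cases "a = b")
    case True
    then show ?thesis by (intro exI[of _ 1]) auto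
  next
    case False
    then have "\<exists>d>0. \<forall>z\<in>D a. \<forall>w\<in>D b. d \<le> dist z w"
      using that by (intro separate_compact_closed D_compact compact_imp_closed D_disjoint)
    then show ?thesis by (auto simp: dist_norm)
  qed
  then obtain d where d: "\<And>a b. a \<in> A \<Longrightarrow> b \<in> A \<Longrightarrow>
      d a b > 0 \<and> (\<forall>z\<in>D a. \<forall>w\<in>D b. a \<noteq> b \<longrightarrow> d a b \<le> cmod (z - w))"
    by metis
  define \<delta> where "\<delta> = Min ((\<lambda>(a, b). d a b) ` (A \<times> A))"
  have ne: "A \<noteq> {}" using card_A by auto
  have fin: "finite ((\<lambda>(a, b). d a b) ` (A \<times> A))" using finite_A by simp
  have "\<delta> > 0"
    unfolding \<delta>_def using fin ne d by (subst Min_gr_iff) auto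
  moreover have "\<delta> \<le> d a b" if "a \<in> A" "b \<in> A" for a b
    unfolding \<delta>_def using fin that by (intro Min_le) auto
  ultimately show ?thesis using d by (intro exI[of _ \<delta>]) (meson order_trans)
qed

text \<open>Two test points are taken in sets \<open>D\<close> of two generators other than that of
  the first letter. The inverse of the word sends both into the set of its last letter, which has a
  fixed positive distance from \<open>D b\<close>; so \<open>distortion\<close> applies with a
  constant independent of the word.\<close>

lemma uniform_distortion:
  "\<exists>c. 0 < c \<and> c \<le> 1 \<and> (\<forall>w b \<xi>. admissible A w \<and> w \<noteq> [] \<and> b \<in> A \<and> b \<noteq> fst (last w) \<and> \<xi> \<in> D b
     \<longrightarrow> c * N (elt w) \<le> F (elt w) \<xi>)"
proof -
  obtain \<delta> where \<delta>: "\<delta> > 0" "\<And>a b z w. a \<in> A \<Longrightarrow> b \<in> A \<Longrightarrow> z \<in> D a \<Longrightarrow> w \<in> D b \<Longrightarrow> a \<noteq> b \<Longrightarrow> \<delta> \<le> cmod (z - w)"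
    using D_separated by metis
  have "min (1/2) (\<delta>\<^sup>2 / 8) * N (elt w) \<le> F (elt w) \<xi>"
    if w: "admissible A w" "w \<noteq> []" and b: "b \<in> A" "b \<noteq> fst (last w)" "\<xi> \<in> D b" for w b \<xi>
  proof -
    obtain b1 where b1: "b1 \<in> A" "b1 \<noteq> fst (hd w)" using ex_third[OF card_A] by metis
    obtain b2 where b2: "b2 \<in> A" "b2 \<noteq> fst (hd w)" "b2 \<noteq> b1" using ex_third[OF card_A] by metis
    obtain \<eta>1 \<eta>2 where \<eta>: "\<eta>1 \<in> D b1" "\<eta>2 \<in> D b2" using D_nonempty b1 b2 by blast
    have l: "fst (last w) \<in> A" using w by (auto simp: admissible_def)
    show ?thesis
    proof (rule distortion[OF elt_closed[OF w(1)] _ _ _ \<delta>(1)])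
      show "cmod \<xi> = 1" "cmod \<eta>1 = 1" "cmod \<eta>2 = 1" using D_norm b b1 b2 \<eta> by auto
      show "\<delta> \<le> cmod (\<eta>1 - \<eta>2)" using \<delta>(2)[OF b1(1) b2(1) \<eta>] b2(3) by auto
      show "\<delta> \<le> cmod (act (inv (elt w)) \<eta>1 - \<xi>)"
        using \<delta>(2)[OF l b(1) act_inv_elt[OF w b1 \<eta>(1)] b(3)] b(2) by auto
      show "\<delta> \<le> cmod (act (inv (elt w)) \<eta>2 - \<xi>)"
        using \<delta>(2)[OF l b(1) act_inv_elt[OF w b2(1,2) \<eta>(2)] b(3)] b(2) by auto
    qed
  qed
  moreover have "0 < min (1/2) (\<delta>\<^sup>2 / 8)" "min (1/2) (\<delta>\<^sup>2 / 8) \<le> 1" using \<delta>(1) by auto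
  ultimately show ?thesis by (intro exI[of _ "min (1/2) (\<delta>\<^sup>2 / 8)"]) blast
qed

definition c :: real where
  "c = (SOME c. 0 < c \<and> c \<le> 1 \<and> (\<forall>w b \<xi>. admissible A w \<and> w \<noteq> [] \<and> b \<in> A \<and> b \<noteq> fst (last w) \<and> \<xi> \<in> D b
     \<longrightarrow> c * N (elt w) \<le> F (elt w) \<xi>))"

lemma c_pos: "0 < c" and c_le_1: "c \<le> 1"
  and F_elt_ge: "admissible A w \<Longrightarrow> w \<noteq> [] \<Longrightarrow> b \<in> A \<Longrightarrow> b \<noteq> fst (last w) \<Longrightarrow> \<xi> \<in> D b \<Longrightarrow>
      c * N (elt w) \<le> F (elt w) \<xi>"
  using someI_ex[OF uniform_distortion, folded c_def] by auto

lemma N_elt_ge_1: "admissible A w \<Longrightarrow> N (elt w) \<ge> 1"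
  by (simp add: N_ge_1 elt_closed)

text \<open>The chain rule is evaluated at a point \<xi> to which \<open>F_elt_ge\<close> applies
  for \<open>w\<close>. Its image under \<open>w\<close> lies in the set of the first letter of
  \<open>w\<close>, hence off that of the last letter of \<open>v\<close>, so
  \<open>F_elt_ge\<close> applies to \<open>v\<close> as well. The 2 comes from
  \<open>F_le\<close>.\<close>

lemma N_append_ge:
  assumes "v \<noteq> []" "w \<noteq> []" "admissible A (v @ w)"
  shows "c\<^sup>2 / 2 * (N (elt v) * N (elt w)) \<le> N (elt (v @ w))"
proof -
  have adm: "admissible A v" "admissible A w" "fst (last v) \<noteq> fst (hd w)"
    using assms by (auto simp: admissible_append)
  obtain b where b: "b \<in> A" "b \<noteq> fst (last w)" using ex_third[OF card_A] by metis
  obtain \<xi> where \<xi>: "\<xi> \<in> D b" using D_nonempty b by blast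
  have n: "cmod \<xi> \<le> 1" using D_norm[OF b(1) \<xi>] by simp
  have w: "act (elt w) \<xi> \<in> D (fst (hd w))" "fst (hd w) \<in> A"
    using act_elt[OF adm(2) assms(2) b \<xi>] adm(2) assms(2) by (auto simp: admissible_def)
  have "(c * N (elt v)) * (c * N (elt w)) \<le> F (elt v) (act (elt w) \<xi>) * F (elt w) \<xi>"
    using F_elt_ge[OF adm(1) assms(1) w(2) _ w(1)] F_elt_ge[OF adm(2) assms(2) b \<xi>] adm
      N_elt_ge_1[OF adm(1)] N_elt_ge_1[OF adm(2)] c_pos
    by (intro mult_mono order_trans[OF _ F_elt_ge[OF adm(1) assms(1) w(2) _ w(1)]]) auto
  also have "\<dots> = F (elt (v @ w)) \<xi>"
    using act_mult(2)[OF elt_closed[OF adm(1)] elt_closed[OF adm(2)] n] adm by (simp add: elt_append)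
  also have "\<dots> \<le> 2 * N (elt (v @ w))" using F_le[OF elt_closed[OF assms(3)] n] .
  finally show ?thesis by (simp add: power2_eq_square mult_ac)
qed

lemma N_append_le:
  assumes "admissible A (v @ w)"
  shows "N (elt (v @ w)) \<le> 2 * (N (elt v) * N (elt w))"
  using assms N_mult_le elt_append elt_closed by (simp add: admissible_append)

lemma elt_neq_one:
  assumes "admissible A w" "w \<noteq> []"
  shows "elt w \<noteq> \<one>"
proof
  assume "elt w = \<one>"
  obtain b where b: "b \<in> A" "b \<noteq> fst (last w)" "b \<noteq> fst (hd w)" using ex_third[OF card_A] by metis
  obtain \<xi> where \<xi>: "\<xi> \<in> D b" using D_nonempty b by blast
  have "\<xi> \<in> D (fst (hd w))"
    using act_elt[OF assms b(1,2) \<xi>] \<open>elt w = \<one>\<close> by (simp add: act_one)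
  moreover have "fst (hd w) \<in> A" using assms by (auto simp: admissible_def)
  ultimately show False using D_disjoint b \<xi> by blast
qed

text \<open>
  All prefixes of a word with bounded \<open>N\<close> have bounded \<open>N\<close>. By discreteness, two prefixes of a long
  one agree in the group, and the subword between them is trivial, which contradicts ping-pong.
\<close>

lemma N_elt_unbounded: "\<exists>n\<ge>1. \<forall>w. admissible A w \<and> length w \<ge> n \<longrightarrow> N (elt w) > R"
proof -
  \<comment> \<open>By \<open>N_append_ge\<close>, a prefix of a word with \<open>N\<close> at most
    \<open>R\<close> stays below this bound, since the rest of the word has \<open>N\<close> at
    least 1.\<close>
  define S where "S = {g \<in> carrier G. N g \<le> 2 / c\<^sup>2 * R}"
  have fin: "finite S" unfolding S_def by (rule finite_N_le[OF inj disc])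
  have "N (elt w) > R" if w: "admissible A w" "length w \<ge> card S + 1" for w
  proof (rule ccontr)
    assume "\<not> N (elt w) > R"
    then have R: "N (elt w) \<le> R" by simp
    have adm: "admissible A (take k w)" "admissible A (drop k w)" for k
      using w(1) admissible_append[of A "take k w" "drop k w"] by auto
    have c2: "c\<^sup>2 > 0" "c\<^sup>2 \<le> 1" using c_pos c_le_1 by (auto simp: power_le_one)
    have "N (elt (take k w)) \<le> 2 / c\<^sup>2 * R" if k: "k \<in> {1..length w}" for k
    proof (cases "k = length w")
      case True
      have "N (elt w) \<ge> 1" using N_elt_ge_1[OF w(1)] .
      then have "R * 1 \<le> R * (2 / c\<^sup>2)" using R c2 by (intro mult_left_mono) (auto simp: field_simps)
      moreover have "N (elt (take k w)) \<le> R" using True R by simp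
      ultimately show ?thesis by (simp add: mult.commute)
    next
      case False
      then have ne: "take k w \<noteq> []" "drop k w \<noteq> []" using k by auto
      have "c\<^sup>2 / 2 * (N (elt (take k w)) * N (elt (drop k w))) \<le> R"
        using N_append_ge[OF ne] w(1) R by simp
      moreover have "c\<^sup>2 / 2 * (N (elt (take k w)) * 1) \<le> c\<^sup>2 / 2 * (N (elt (take k w)) * N (elt (drop k w)))"
        using N_elt_ge_1[OF adm(1)[of k]] N_elt_ge_1[OF adm(2)[of k]] c2 by (intro mult_left_mono) auto
      ultimately have "c\<^sup>2 / 2 * N (elt (take k w)) \<le> R" by simp
      then show ?thesis using c2 by (simp add: field_simps)
    qed
    then have sub: "(\<lambda>k. elt (take k w)) ` {1..length w} \<subseteq> S"
      using adm elt_closed by (auto simp: S_def)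
    have "\<not> inj_on (\<lambda>k. elt (take k w)) {1..length w}"
      using card_inj_on_le[OF _ sub fin] w(2) by auto
    then obtain k l where kl: "k \<in> {1..length w}" "l \<in> {1..length w}" "k \<noteq> l"
        "elt (take k w) = elt (take l w)"
      unfolding inj_on_def by blast
    define i j where "i = min k l" and "j = max k l"
    have ij: "i < j" "j \<le> length w" "elt (take i w) = elt (take j w)"
      using kl by (auto simp: i_def j_def min_def max_def)
    define v where "v = drop i (take j w)"
    have tj: "take j w = take i w @ v"
      using ij by (simp add: v_def) (metis append_take_drop_id min.absorb1 less_imp_le take_take)
    have v: "v \<noteq> []" "admissible A v"
      using ij adm(1)[of j] unfolding tj by (auto simp: v_def admissible_append)
    have "elt (take i w) \<otimes> elt v = elt (take i w)"
      using ij(3) tj elt_append[OF adm(1)[of i] v(2)] by simp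
    then have "elt v = \<one>" using elt_closed[OF v(2)] elt_closed[OF adm(1)[of i]] by simp
    then show False using elt_neq_one v by simp
  qed
  then show ?thesis by (intro exI[of _ "card S + 1"]) auto
qed

section \<open>The coding map and the Birkhoff sums of the potential\<close>

lemma prefix_elt_eq:
  assumes "x \<in> markov_shift A"
  shows "prefix_elt G x k = elt (map x [0..<k])"
proof (induction k)
  case (Suc k)
  have "fst (x k) \<in> A" "snd (x k) \<noteq> 0" using assms by (auto simp: markov_shift_def)
  then have "elt (map x [0..<k] @ [x k]) = elt (map x [0..<k]) \<otimes> symbol_elt G (x k)"
    using elt_append[OF admissible_map_markov_shift[OF assms]] symbol_closed by (simp add: admissible_single)
  then show ?case using Suc by simp
qed simp

lemma prefix_closed: "x \<in> markov_shift A \<Longrightarrow> prefix_elt G x k \<in> carrier G"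
  by (simp add: prefix_elt_eq elt_closed admissible_map_markov_shift)

lemma shift_markov: "x \<in> markov_shift A \<Longrightarrow> shift x \<in> markov_shift A"
  by (simp add: markov_shift_def shift_def)

lemma symbol_x_closed: "x \<in> markov_shift A \<Longrightarrow> symbol_elt G (x i) \<in> carrier G"
  by (auto simp: markov_shift_def intro!: symbol_closed)

lemma prefix_elt_shift:
  assumes "x \<in> markov_shift A"
  shows "prefix_elt G x (Suc k) = symbol_elt G (x 0) \<otimes> prefix_elt G (shift x) k"
proof (induction k)
  case 0
  then show ?case using symbol_x_closed[OF assms] by simp
next
  case (Suc k)
  have "prefix_elt G x (Suc (Suc k)) = prefix_elt G x (Suc k) \<otimes> symbol_elt G (x (Suc k))" by simp
  also have "\<dots> = symbol_elt G (x 0) \<otimes> prefix_elt G (shift x) (Suc k)"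
    unfolding Suc using symbol_x_closed[OF assms] prefix_closed[OF shift_markov[OF assms], of k]
    by (simp add: m_assoc shift_def del: prefix_elt.simps(2)) (simp add: shift_def)
  finally show ?case .
qed

text \<open>The images of \<open>D (fst (x k))\<close> under the prefixes are nested, and their
  diameters tend to 0 by distortion and the growth of \<open>N\<close>. Points \<open>y k\<close>
  chosen in them therefore converge; the orbit of 0, which lies inside the disk and not in these
  sets, is then shown to approach \<open>y k\<close>.\<close>

lemma coded_point:
  assumes x: "x \<in> markov_shift A"
  shows "(\<lambda>k. act (prefix_elt G x k) 0) \<longlonglongrightarrow> coded_point G \<rho> x" "coded_point G \<rho> x \<in> D (fst (x 0))"
proof -
  let ?g = "prefix_elt G x"
  have xA: "fst (x i) \<in> A" for i using x by (auto simp: markov_shift_def)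
  define \<eta> where "\<eta> k = (SOME z. z \<in> D (fst (x k)))" for k
  have \<eta>: "\<eta> k \<in> D (fst (x k))" for k
    unfolding \<eta>_def using D_nonempty[OF xA] by (simp add: some_in_eq)
  define y where "y k = act (?g k) (\<eta> k)" for k
  have nested: "\<exists>\<zeta>\<in>D (fst (x k)). y m = act (?g k) \<zeta>" if "k \<le> m" for k m
  proof (cases "k = m")
    case True
    then show ?thesis using \<eta> by (auto simp: y_def)
  next
    case False
    then have km: "k < m" using that by simp
    define v where "v = map x [k..<m]"
    have split: "map x [0..<m] = map x [0..<k] @ v"
      using km by (simp add: v_def flip: map_append) (metis le_add_diff_inverse less_imp_le upt_add_eq_append zero_le)
    have adm: "admissible A (map x [0..<k])" "admissible A v"
      using admissible_map_markov_shift[OF x, of m] unfolding split by (auto simp: admissible_append)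
    have v: "v \<noteq> []" "hd v = x k" "last v = x (m - 1)"
      using km by (auto simp: v_def hd_map last_map)
    have "fst (x m) \<noteq> fst (last v)"
      using x km unfolding v(3) markov_shift_def by (metis (mono_tags, lifting) Suc_diff_1 mem_Collect_eq less_nat_zero_code not_gr0)
    then have "act (elt v) (\<eta> m) \<in> D (fst (x k))"
      using act_elt[OF adm(2) v(1) xA _ \<eta>] v(2) by simp
    moreover have "y m = act (?g k) (act (elt v) (\<eta> m))"
      unfolding y_def prefix_elt_eq[OF x] split elt_append[OF adm]
      using D_norm[OF xA \<eta>[of m]] by (intro act_mult(1) elt_closed adm) auto
    ultimately show ?thesis by blast
  qed
  have lower: "c * N (?g k) \<le> F (?g k) \<zeta>" if "\<zeta> \<in> D (fst (x k))" "k \<ge> 1" for k \<zeta>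
  proof -
    have "fst (x k) \<noteq> fst (x (k - 1))"
      using x that(2) unfolding markov_shift_def by (metis (mono_tags, lifting) Suc_diff_1 mem_Collect_eq less_eq_Suc_le One_nat_def)
    then show ?thesis
      using F_elt_ge[OF admissible_map_markov_shift[OF x, of k] _ xA _ that(1)] that(2)
      by (simp add: prefix_elt_eq[OF x] last_map)
  qed
  have small: "\<exists>K\<ge>1. \<forall>k\<ge>K. 2 / (c\<^sup>2 * N (?g k)) < e" if "e > 0" for e
  proof -
    obtain n where n: "n \<ge> 1" "\<And>w. admissible A w \<Longrightarrow> length w \<ge> n \<Longrightarrow> N (elt w) > 2 / (c\<^sup>2 * e)"
      using N_elt_unbounded by blast
    have "2 / (c\<^sup>2 * N (?g k)) < e" if "k \<ge> n" for k
    proof -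
      have "2 / (c\<^sup>2 * e) < N (?g k)"
        using n(2)[OF admissible_map_markov_shift[OF x, of k]] that by (simp add: prefix_elt_eq[OF x])
      moreover have "N (?g k) \<ge> 1" by (rule N_ge_1[OF prefix_closed[OF x]])
      ultimately show ?thesis using c_pos \<open>e > 0\<close> by (simp add: field_simps)
    qed
    then show ?thesis using n(1) by blast
  qed
  have diam: "cmod (act (?g k) \<zeta> - act (?g k) \<zeta>') \<le> 2 / (c\<^sup>2 * N (?g k))"
    if "\<zeta> \<in> D (fst (x k))" "\<zeta>' \<in> D (fst (x k))" "k \<ge> 1" for k \<zeta> \<zeta>'
  proof -
    let ?N = "N (?g k)"
    have N: "?N \<ge> 1" by (rule N_ge_1[OF prefix_closed[OF x]])
    have n: "cmod \<zeta> = 1" "cmod \<zeta>' = 1" using D_norm[OF xA] that by auto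
    have "(c * ?N) * (c * ?N) \<le> F (?g k) \<zeta> * F (?g k) \<zeta>'"
      using lower[OF that(1,3)] lower[OF that(2,3)] c_pos N F_pos[OF prefix_closed[OF x], of \<zeta> k] n
      by (intro mult_mono) auto
    moreover have "c\<^sup>2 * ?N * 1 \<le> c\<^sup>2 * ?N * ?N" using N c_pos by (intro mult_left_mono) auto
    ultimately have FF: "c\<^sup>2 * ?N \<le> F (?g k) \<zeta> * F (?g k) \<zeta>'" by (simp add: power2_eq_square mult_ac)
    have pos: "c\<^sup>2 * ?N > 0" using c_pos N by simp
    have "cmod (act (?g k) \<zeta> - act (?g k) \<zeta>') = cmod (\<zeta> - \<zeta>') / (F (?g k) \<zeta> * F (?g k) \<zeta>')"
      using act_diff[OF prefix_closed[OF x]] n by simp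
    also have "\<dots> \<le> 2 / (c\<^sup>2 * ?N)"
      using norm_triangle_ineq4[of \<zeta> \<zeta>'] n FF pos by (intro frac_le) auto
    finally show ?thesis .
  qed
  \<comment> \<open>At 0 the cocycle \<open>F\<close> equals \<open>N\<close>, so only \<eta> needs
    the distortion bound; the weaker constant with the square of \<open>c\<close> is kept so that
    \<open>small\<close> serves both estimates.\<close>
  have zy: "cmod (act (?g k) 0 - y k) \<le> 2 / (c\<^sup>2 * N (?g k))" if "k \<ge> 1" for k
  proof -
    let ?N = "N (?g k)"
    have N: "?N \<ge> 1" by (rule N_ge_1[OF prefix_closed[OF x]])
    have n: "cmod (\<eta> k) = 1" using D_norm[OF xA \<eta>] .
    have "c * ?N * 1 \<le> F (?g k) (\<eta> k) * ?N"
      using lower[OF \<eta> that] c_pos N by (intro mult_mono) (auto intro: order_trans[rotated])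
    moreover have "c\<^sup>2 * ?N \<le> c * ?N"
      using c_pos c_le_1 N by (simp add: power2_eq_square)
    ultimately have FF: "c\<^sup>2 * ?N \<le> ?N * F (?g k) (\<eta> k)" by (simp add: mult.commute)
    have pos: "c\<^sup>2 * ?N > 0" using c_pos N by simp
    have "cmod (act (?g k) 0 - y k) = 1 / (?N * F (?g k) (\<eta> k))"
      using act_diff[OF prefix_closed[OF x], of 0 "\<eta> k" k] n by (simp add: y_def F_0)
    also have "\<dots> \<le> 2 / (c\<^sup>2 * ?N)" using FF pos by (intro frac_le) auto
    finally show ?thesis .
  qed
  have "Cauchy y"
  proof (rule metric_CauchyI)
    fix e :: real assume "e > 0"
    then obtain K where K: "K \<ge> 1" "\<And>k. k \<ge> K \<Longrightarrow> 2 / (c\<^sup>2 * N (?g k)) < e" using small by blast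
    have "dist (y m) (y n) < e" if mn: "m \<ge> K" "n \<ge> K" for m n
    proof -
      obtain \<zeta> \<zeta>' where "\<zeta> \<in> D (fst (x K))" "y m = act (?g K) \<zeta>" "\<zeta>' \<in> D (fst (x K))" "y n = act (?g K) \<zeta>'"
        using nested[OF mn(1)] nested[OF mn(2)] by blast
      then show ?thesis using diam[of \<zeta> K \<zeta>'] K by (simp add: dist_norm) (meson K(2) le_less_trans order_refl)
    qed
    then show "\<exists>M. \<forall>m\<ge>M. \<forall>n\<ge>M. dist (y m) (y n) < e" by blast
  qed
  then obtain \<xi> where \<xi>: "y \<longlonglongrightarrow> \<xi>" by (auto simp: Cauchy_convergent_iff convergent_def)
  have "(\<lambda>k. act (?g k) 0 - y k) \<longlonglongrightarrow> 0"
  proof (rule LIMSEQ_I)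
    fix e :: real assume "e > 0"
    then obtain K where K: "K \<ge> 1" "\<And>k. k \<ge> K \<Longrightarrow> 2 / (c\<^sup>2 * N (?g k)) < e" using small by blast
    have "norm (act (?g k) 0 - y k - 0) < e" if "k \<ge> K" for k
      using zy[of k] K(2)[OF that] K(1) that by simp
    then show "\<exists>K. \<forall>k\<ge>K. norm (act (?g k) 0 - y k - 0) < e" by blast
  qed
  from tendsto_add[OF this \<xi>] have lim: "(\<lambda>k. act (?g k) 0) \<longlonglongrightarrow> \<xi>" by simp
  then have eq: "coded_point G \<rho> x = \<xi>"
    unfolding coded_point_def act_def by (rule limI)
  with lim show "(\<lambda>k. act (?g k) 0) \<longlonglongrightarrow> coded_point G \<rho> x" by simp
  have "y k \<in> D (fst (x 0))" for k
    using nested[of 0 k] by (auto simp: act_one)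
  then show "coded_point G \<rho> x \<in> D (fst (x 0))"
    unfolding eq using closed_sequentially[OF compact_imp_closed[OF D_compact[OF xA]] _ \<xi>] by blast
qed

lemma coded_point_norm: "x \<in> markov_shift A \<Longrightarrow> cmod (coded_point G \<rho> x) = 1"
  using coded_point(2) D_norm by (auto simp: markov_shift_def)

lemma coded_point_shift:
  assumes x: "x \<in> markov_shift A"
  shows "act (symbol_elt G (x 0)) (coded_point G \<rho> (shift x)) = coded_point G \<rho> x"
proof -
  let ?s = "symbol_elt G (x 0)" and ?z = "\<lambda>k. act (prefix_elt G (shift x) k) 0"
    and ?\<xi> = "coded_point G \<rho> (shift x)"
  note sx = shift_markov[OF x]
  have s: "?s \<in> carrier G" by (rule symbol_x_closed[OF x])
  have "cnj (be (\<rho> ?s)) * ?\<xi> + cnj (al (\<rho> ?s)) \<noteq> 0"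
    using mden_pos(2)[OF su_rho[OF s]] coded_point_norm[OF sx] by simp
  then have "(\<lambda>k. act ?s (?z k)) \<longlonglongrightarrow> act ?s ?\<xi>"
    unfolding act_eq[OF s] mob_def by (intro tendsto_intros coded_point(1)[OF sx])
  moreover have "act ?s (?z k) = act (prefix_elt G x (Suc k)) 0" for k
    unfolding prefix_elt_shift[OF x] using act_mult(1)[OF s prefix_closed[OF sx], of 0 k] by simp
  ultimately have "(\<lambda>k. act (prefix_elt G x (Suc k)) 0) \<longlonglongrightarrow> act ?s ?\<xi>" by simp
  moreover have "(\<lambda>k. act (prefix_elt G x (Suc k)) 0) \<longlonglongrightarrow> coded_point G \<rho> x"
    using coded_point(1)[OF x] by (rule LIMSEQ_Suc)
  ultimately show ?thesis by (rule LIMSEQ_unique)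
qed

lemma geometric_potential_eq:
  assumes x: "x \<in> markov_shift A"
  shows "geometric_potential G \<rho> x = 2 * ln (F (symbol_elt G (x 0)) (coded_point G \<rho> (shift x)))"
  using busemann_act[OF symbol_x_closed[OF x] coded_point_norm[OF shift_markov[OF x]], of 0]
  by (simp add: geometric_potential_def coded_point_shift[OF x]) (simp add: act_def)

lemma funpow_shift_markov: "x \<in> markov_shift A \<Longrightarrow> (shift ^^ n) x \<in> markov_shift A"
  by (induction n) (auto intro: shift_markov)

lemma birkhoff_geometric_potential:
  assumes x: "x \<in> markov_shift A"
  shows "birkhoff_sum n (geometric_potential G \<rho>) x =
    2 * ln (F (elt (map x [0..<n])) (coded_point G \<rho> ((shift ^^ n) x)))"
proof (induction n)
  case 0
  then show ?case by (simp add: birkhoff_sum_def act_one)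
next
  case (Suc n)
  let ?y = "(shift ^^ n) x" and ?g = "prefix_elt G x n"
  have y: "?y \<in> markov_shift A" by (rule funpow_shift_markov[OF x])
  have y0: "?y 0 = x n" by (simp add: funpow_shift)
  let ?s = "symbol_elt G (x n)" and ?\<xi> = "coded_point G \<rho> (shift ?y)"
  have s: "?s \<in> carrier G" and g: "?g \<in> carrier G" using symbol_x_closed prefix_closed x by auto
  have n: "cmod ?\<xi> \<le> 1" "cmod (coded_point G \<rho> ?y) \<le> 1"
    using coded_point_norm[OF shift_markov[OF y]] coded_point_norm[OF y] by auto
  have "birkhoff_sum (Suc n) (geometric_potential G \<rho>) x =
      2 * ln (F ?g (coded_point G \<rho> ?y)) + 2 * ln (F ?s ?\<xi>)"
    using Suc geometric_potential_eq[OF y] by (simp add: birkhoff_sum_def prefix_elt_eq[OF x] y0)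
  also have "\<dots> = 2 * ln (F ?g (act ?s ?\<xi>) * F ?s ?\<xi>)"
    using coded_point_shift[OF y] F_pos[OF g n(2)] F_pos[OF s n(1)] by (simp add: y0 ln_mult)
  also have "F ?g (act ?s ?\<xi>) * F ?s ?\<xi> = F (prefix_elt G x (Suc n)) ?\<xi>"
    using act_mult(2)[OF g s n(1)] by simp
  finally show ?case unfolding prefix_elt_eq[OF x] by simp
qed

lemma birkhoff_bounds:
  assumes n: "n \<ge> 1" and x: "x \<in> markov_shift A" and per: "(shift ^^ n) x = x"
  shows "2 * ln (c * N (elt (map x [0..<n]))) \<le> birkhoff_sum n (geometric_potential G \<rho>) x"
    and "birkhoff_sum n (geometric_potential G \<rho>) x \<le> 2 * ln (2 * N (elt (map x [0..<n])))"
proof -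
  let ?w = "map x [0..<n]" and ?\<xi> = "coded_point G \<rho> x"
  have w: "admissible A ?w" "?w \<noteq> []" using admissible_map_markov_shift[OF x] n by auto
  \<comment> \<open>By periodicity the first letter of the period also follows its last one. The
    coded point lies in the set of the first letter, hence off that of the last, where the
    distortion bound for the period is available.\<close>
  have "x n = x 0" using fun_cong[OF per, of 0] by (simp add: funpow_shift)
  moreover obtain m where m: "n = Suc m" using n by (cases n) auto
  moreover have "fst (x m) \<noteq> fst (x (Suc m))" using x by (simp add: markov_shift_def)
  ultimately have "fst (x 0) \<noteq> fst (last ?w)" by simp
  then have lower: "c * N (elt ?w) \<le> F (elt ?w) ?\<xi>"
    using F_elt_ge[OF w _ _ coded_point(2)[OF x]] x by (auto simp: markov_shift_def)
  have upper: "F (elt ?w) ?\<xi> \<le> 2 * N (elt ?w)"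
    using F_le[OF elt_closed[OF w(1)]] coded_point_norm[OF x] by simp
  have N: "N (elt ?w) \<ge> 1" by (rule N_elt_ge_1[OF w(1)])
  have Fp: "F (elt ?w) ?\<xi> > 0"
    using F_pos[OF elt_closed[OF w(1)]] coded_point_norm[OF x] by simp
  have eq: "birkhoff_sum n (geometric_potential G \<rho>) x = 2 * ln (F (elt ?w) ?\<xi>)"
    using birkhoff_geometric_potential[OF x, of n] per by simp
  show "2 * ln (c * N (elt ?w)) \<le> birkhoff_sum n (geometric_potential G \<rho>) x"
    unfolding eq using lower N c_pos Fp by simp
  show "birkhoff_sum n (geometric_potential G \<rho>) x \<le> 2 * ln (2 * N (elt ?w))"
    unfolding eq using upper N Fp by simp
qed

end

section \<open>The pressure of the geometric potentials\<close>

text \<open>The contribution of one representation, with \<open>e\<close> equal to \<open>a\<close>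
  or \<open>b\<close>. As \<open>e\<close> may be 0, smallness is required only for
  \<open>e > 0\<close>; the bound by 1 then lets the product inherit it from the other
  factor.\<close>

locale weight_factor =
  fixes A :: "'g set" and \<phi> :: "('g \<times> int) list \<Rightarrow> real" and K e :: real and p :: 'g
    and v :: "(nat \<Rightarrow> 'g \<times> int) \<Rightarrow> real"
  assumes K_ge_1: "K \<ge> 1" and e_nonneg: "e \<ge> 0"
    and pos: "admissible A w \<Longrightarrow> \<phi> w > 0" and le_1: "admissible A w \<Longrightarrow> \<phi> w \<le> 1"
    and append_le: "w \<noteq> [] \<Longrightarrow> w' \<noteq> [] \<Longrightarrow> admissible A (w @ w') \<Longrightarrow> \<phi> (w @ w') \<le> K * (\<phi> w * \<phi> w')"
    and append_ge: "w \<noteq> [] \<Longrightarrow> w' \<noteq> [] \<Longrightarrow> admissible A (w @ w') \<Longrightarrow> \<phi> w * \<phi> w' \<le> K * \<phi> (w @ w')"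
    and single_le: "a \<in> A \<Longrightarrow> k \<noteq> 0 \<Longrightarrow> \<phi> [(a, k)] \<le> K * \<bar>real_of_int k\<bar> powr (- 2 * e)"
    and parabolic_ge: "k \<noteq> 0 \<Longrightarrow> \<bar>real_of_int k\<bar> powr (- 2 * e) \<le> K * \<phi> [(p, k)]"
    and small: "e > 0 \<Longrightarrow> \<epsilon> > 0 \<Longrightarrow> \<exists>N\<ge>1. \<forall>w. admissible A w \<and> length w \<ge> N \<longrightarrow> \<phi> w \<le> \<epsilon>"
    and birkhoff_le: "n \<ge> 1 \<Longrightarrow> x \<in> markov_shift A \<Longrightarrow> (shift ^^ n) x = x \<Longrightarrow>
      exp (- birkhoff_sum n v x) \<le> K * \<phi> (map x [0..<n])"
    and birkhoff_ge: "n \<ge> 1 \<Longrightarrow> x \<in> markov_shift A \<Longrightarrow> (shift ^^ n) x = x \<Longrightarrow>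
      \<phi> (map x [0..<n]) \<le> K * exp (- birkhoff_sum n v x)"

lemma mult_mono_scaled:
  fixes a b a' b' :: real
  assumes "a \<le> K * b" "a' \<le> K' * b'" "0 \<le> a" "0 \<le> a'"
  shows "a * a' \<le> (K * K') * (b * b')"
proof -
  have "a * a' \<le> (K * b) * (K' * b')" using assms by (intro mult_mono) auto
  then show ?thesis by (simp add: mult_ac)
qed

lemma word_potential_product:
  assumes 1: "weight_factor A \<phi>1 K1 e1 p v1" and 2: "weight_factor A \<phi>2 K2 e2 p v2"
    and A: "finite A" "card A \<ge> 3" "p \<in> A" and e: "e1 + e2 > 0"
  shows "word_potential A (\<lambda>w. \<phi>1 w * \<phi>2 w) (K1 * K2) (e1 + e2) p (\<lambda>x. v1 x + v2 x)"
proof -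
  interpret f1: weight_factor A \<phi>1 K1 e1 p v1 by (rule 1)
  interpret f2: weight_factor A \<phi>2 K2 e2 p v2 by (rule 2)
  have n_powr: "x powr (- 2 * (e1 + e2)) = x powr (- 2 * e1) * x powr (- 2 * e2)" for x :: real
    by (simp add: algebra_simps flip: powr_add)
  have birkhoff: "exp (- birkhoff_sum n (\<lambda>x. v1 x + v2 x) x) =
      exp (- birkhoff_sum n v1 x) * exp (- birkhoff_sum n v2 x)" for n x
    by (simp add: birkhoff_sum_def sum.distrib flip: exp_add)
  have pos0: "0 \<le> \<phi>1 w" "0 \<le> \<phi>2 w" if "admissible A w" for w
    using f1.pos f2.pos that by (auto intro: less_imp_le)
  show ?thesis
  proof unfold_locales
    show "K1 * K2 \<ge> 1" using mult_mono[OF f1.K_ge_1 f2.K_ge_1] f1.K_ge_1 by simp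
    fix w w' assume w: "w \<noteq> []" "w' \<noteq> []" "admissible A (w @ w')"
    then have adm: "admissible A w" "admissible A w'" by (auto simp: admissible_append)
    show "\<phi>1 (w @ w') * \<phi>2 (w @ w') \<le> K1 * K2 * (\<phi>1 w * \<phi>2 w * (\<phi>1 w' * \<phi>2 w'))"
      using mult_mono_scaled[OF f1.append_le[OF w] f2.append_le[OF w]] pos0[OF w(3)]
      by (simp add: mult_ac)
    show "\<phi>1 w * \<phi>2 w * (\<phi>1 w' * \<phi>2 w') \<le> K1 * K2 * (\<phi>1 (w @ w') * \<phi>2 (w @ w'))"
      using mult_mono_scaled[OF f1.append_ge[OF w] f2.append_ge[OF w]] pos0[OF adm(1)] pos0[OF adm(2)]
      by (simp add: mult_ac)
  next
    fix a and n :: int assume a: "a \<in> A" "n \<noteq> 0"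
    then show "\<phi>1 [(a, n)] * \<phi>2 [(a, n)] \<le> K1 * K2 * \<bar>real_of_int n\<bar> powr (- 2 * (e1 + e2))"
      unfolding n_powr using pos0[of "[(a, n)]"] f1.single_le[OF a] f2.single_le[OF a] a
      by (intro mult_mono_scaled) (auto simp: admissible_single)
  next
    fix n :: int assume n: "n \<noteq> 0"
    then show "\<bar>real_of_int n\<bar> powr (- 2 * (e1 + e2)) \<le> K1 * K2 * (\<phi>1 [(p, n)] * \<phi>2 [(p, n)])"
      unfolding n_powr by (intro mult_mono_scaled f1.parabolic_ge f2.parabolic_ge) auto
  next
    fix \<epsilon> :: real assume \<epsilon>: "\<epsilon> > 0"
    \<comment> \<open>One factor is small on long words, and the other is at most 1.\<close>
    have "e1 > 0 \<or> e2 > 0" using e f1.e_nonneg f2.e_nonneg by linarith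
    then obtain N where N: "N \<ge> 1"
      "(\<forall>w. admissible A w \<and> length w \<ge> N \<longrightarrow> \<phi>1 w \<le> \<epsilon>) \<or> (\<forall>w. admissible A w \<and> length w \<ge> N \<longrightarrow> \<phi>2 w \<le> \<epsilon>)"
      using f1.small[OF _ \<epsilon>] f2.small[OF _ \<epsilon>] by metis
    have "\<phi>1 w * \<phi>2 w \<le> \<epsilon>" if w: "admissible A w" "length w = N" for w
    proof -
      have "\<phi>1 w * \<phi>2 w \<le> \<phi>1 w" "\<phi>1 w * \<phi>2 w \<le> \<phi>2 w"
        using f1.le_1[OF w(1)] f2.le_1[OF w(1)] pos0[OF w(1)]
        by (simp_all add: mult_left_le mult_left_le_one_le)
      moreover have "\<phi>1 w \<le> \<epsilon> \<or> \<phi>2 w \<le> \<epsilon>" using N(2) w by auto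
      ultimately show ?thesis by linarith
    qed
    then show "\<exists>N\<ge>1. \<forall>w. admissible A w \<and> length w = N \<longrightarrow> \<phi>1 w * \<phi>2 w \<le> \<epsilon>"
      using N(1) by blast
  next
    fix n :: nat and x assume x: "n \<ge> 1" "x \<in> markov_shift A" "(shift ^^ n) x = x"
    show "exp (- birkhoff_sum n (\<lambda>x. v1 x + v2 x) x) \<le> K1 * K2 * (\<phi>1 (map x [0..<n]) * \<phi>2 (map x [0..<n]))"
      unfolding birkhoff using x by (intro mult_mono_scaled f1.birkhoff_le f2.birkhoff_le) auto
    show "\<phi>1 (map x [0..<n]) * \<phi>2 (map x [0..<n]) \<le> K1 * K2 * exp (- birkhoff_sum n (\<lambda>x. v1 x + v2 x) x)"
      unfolding birkhoff using x pos0[OF admissible_map_markov_shift[OF x(2)]]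
      by (intro mult_mono_scaled f1.birkhoff_ge f2.birkhoff_ge) auto
  qed (use A e f1.pos f2.pos in auto)
qed

text \<open>Every estimate for \<open>N\<close> with the constant \<open>B\<close> becomes the
  reversed estimate for its power \<open>- 2 * e\<close> with the constant
  \<open>B powr (2 * e)\<close>.\<close>

lemma powr_neg_scaled:
  fixes x y B e :: real
  assumes "0 < x" "0 < y" "B \<ge> 1" "e \<ge> 0" "x \<le> B * y"
  shows "y powr (- 2 * e) \<le> B powr (2 * e) * x powr (- 2 * e)"
proof -
  have "(B * y) powr (- 2 * e) \<le> x powr (- 2 * e)"
    using assms by (intro powr_mono2') auto
  then have "B powr (2 * e) * ((B * y) powr (- 2 * e)) \<le> B powr (2 * e) * x powr (- 2 * e)"
    by (intro mult_left_mono) auto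
  moreover have "B powr (2 * e) * ((B * y) powr (- 2 * e)) = y powr (- 2 * e)"
    using assms by (simp add: powr_mult powr_minus field_simps)
  ultimately show ?thesis by simp
qed

lemma (in schottky_action) weight_factor_geometric:
  assumes nontriv: "\<And>a. a \<in> A \<Longrightarrow> \<bar>Re (al (\<rho> a))\<bar> \<ge> 1 \<and> M a > 0"
    and p: "p \<in> A" "\<bar>Re (al (\<rho> p))\<bar> = 1" and e: "e \<ge> 0"
  shows "\<exists>K. weight_factor A (\<lambda>w. N (elt w) powr (- 2 * e)) K e p (\<lambda>x. e * geometric_potential G \<rho> x)"
proof -
  define m where "m = Min (M ` A)"
  have ne: "A \<noteq> {}" using p by auto
  have m: "m > 0" "\<And>a. a \<in> A \<Longrightarrow> m \<le> M a"
    unfolding m_def using finite_A ne nontriv by auto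
  \<comment> \<open>One constant for all comparisons: \<open>2 / c\<^sup>2\<close> for splitting a
    word and for the lower Birkhoff bound, 2 for joining words and for the upper Birkhoff bound,
    \<open>1 / m\<close> for the growth of powers, and \<open>1 + M p\<close> for the parabolic
    powers.\<close>
  define B where "B = 2 / c\<^sup>2 + 1 / m + 2 + M p"
  have c2: "0 < c\<^sup>2" "c\<^sup>2 \<le> c" "c\<^sup>2 \<le> 1"
    using c_pos c_le_1 by (auto simp: power2_eq_square mult_le_one)
  have B: "B \<ge> 2 / c\<^sup>2" "B \<ge> 1 / m" "B \<ge> 2" "B \<ge> 1 + M p" "B \<ge> 1"
    using c2 m M_nonneg[of p] by (auto simp: B_def)
  have B_ge: "x \<le> B * y" if "x \<le> b * y" "b \<le> B" "y \<ge> 0" for x y b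
    using that mult_right_mono[of b B y] by linarith
  have a_closed: "a \<in> carrier G" if "a \<in> A" for a using that A_closed by auto
  have single: "elt [(a, n)] = a [^] n" if "a \<in> A" for a n
    using a_closed[OF that] by (simp add: symbol_elt_def)
  let ?\<phi> = "\<lambda>w. N (elt w) powr (- 2 * e)" and ?K = "B powr (2 * e)"
  have exp_birkhoff: "exp (- birkhoff_sum n (\<lambda>x. e * geometric_potential G \<rho> x) x) =
      exp (birkhoff_sum n (geometric_potential G \<rho>) x / 2) powr (- 2 * e)" for n x
    by (simp add: birkhoff_sum_def powr_def mult.assoc flip: sum_distrib_left)
  have N1: "N (elt w) \<ge> 1" "N (elt w) > 0" if "admissible A w" for w
    using N_elt_ge_1[OF that] by auto
  have "weight_factor A ?\<phi> ?K e p (\<lambda>x. e * geometric_potential G \<rho> x)"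
  proof
    show "?K \<ge> 1" using B e by (simp add: ge_one_powr_ge_zero)
    show "e \<ge> 0" by (rule e)
    fix w assume w: "admissible A w"
    show "0 < ?\<phi> w" using N1[OF w] by simp
    have "?\<phi> w \<le> 1 powr (- 2 * e)" using N1[OF w] e by (intro powr_mono2') auto
    then show "?\<phi> w \<le> 1" by simp
  next
    fix w w' assume w: "w \<noteq> []" "w' \<noteq> []" "admissible A (w @ w')"
    then have adm: "admissible A w" "admissible A w'" by (auto simp: admissible_append)
    have "N (elt w) * N (elt w') \<le> 2 / c\<^sup>2 * N (elt (w @ w'))"
      using N_append_ge[OF w] c2 by (simp add: field_simps)
    then have "N (elt w) * N (elt w') \<le> B * N (elt (w @ w'))"
      using B(1) N1(1)[OF w(3)] by (intro B_ge[of _ "2 / c\<^sup>2"]) auto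
    then show "?\<phi> (w @ w') \<le> ?K * (?\<phi> w * ?\<phi> w')"
      using powr_neg_scaled[of "N (elt w) * N (elt w')" "N (elt (w @ w'))" B e] B e
        N1[OF adm(1)] N1[OF adm(2)] N1[OF w(3)] by (simp add: powr_mult)
    have "N (elt (w @ w')) \<le> B * (N (elt w) * N (elt w'))"
      using B_ge[OF N_append_le[OF w(3)] B(3)] N1[OF adm(1)] N1[OF adm(2)] by simp
    then show "?\<phi> w * ?\<phi> w' \<le> ?K * ?\<phi> (w @ w')"
      using powr_neg_scaled[of "N (elt (w @ w'))" "N (elt w) * N (elt w')" B e] B e
        N1[OF adm(1)] N1[OF adm(2)] N1[OF w(3)] by (simp add: powr_mult)
  next
    fix a and n :: int assume a: "a \<in> A" "n \<noteq> 0"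
    have N: "N (a [^] n) \<ge> 1" using a_closed[OF a(1)] by (simp add: N_ge_1)
    have "real_of_int \<bar>n\<bar> * m \<le> real_of_int \<bar>n\<bar> * M a"
      using m(2)[OF a(1)] by (intro mult_left_mono) auto
    also have "\<dots> \<le> N (a [^] n)"
      using N_int_pow(1)[OF a_closed[OF a(1)] _ a(2)] nontriv[OF a(1)] by simp
    finally have "\<bar>real_of_int n\<bar> \<le> 1 / m * N (a [^] n)" using m(1) by (simp add: field_simps)
    then have "\<bar>real_of_int n\<bar> \<le> B * N (a [^] n)"
      using B(2) N by (intro B_ge[of _ "1 / m"]) auto
    then show "?\<phi> [(a, n)] \<le> ?K * \<bar>real_of_int n\<bar> powr (- 2 * e)"
      unfolding single[OF a(1)] using a N B e by (intro powr_neg_scaled) auto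
  next
    fix n :: int assume n: "n \<noteq> 0"
    have N: "N (p [^] n) \<ge> 1" using a_closed[OF p(1)] by (simp add: N_ge_1)
    have "N (p [^] n) \<le> (1 + M p) * \<bar>real_of_int n\<bar>"
      using N_int_pow(2)[OF a_closed[OF p(1)] _ n] p(2) by (simp add: mult.commute)
    then have "N (p [^] n) \<le> B * \<bar>real_of_int n\<bar>"
      using B(4) by (intro B_ge[of _ "1 + M p"]) auto
    then show "\<bar>real_of_int n\<bar> powr (- 2 * e) \<le> ?K * ?\<phi> [(p, n)]"
      unfolding single[OF p(1)] using n N B e by (intro powr_neg_scaled) auto
  next
    fix \<epsilon> :: real assume e0: "e > 0" and \<epsilon>: "\<epsilon> > 0"
    obtain n where n: "n \<ge> 1" "\<And>w. admissible A w \<Longrightarrow> length w \<ge> n \<Longrightarrow> N (elt w) > \<epsilon> powr (- 1 / (2 * e))"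
      using N_elt_unbounded by blast
    have "?\<phi> w \<le> \<epsilon>" if w: "admissible A w" "length w \<ge> n" for w
    proof -
      have "?\<phi> w \<le> (\<epsilon> powr (- 1 / (2 * e))) powr (- 2 * e)"
        using n(2)[OF w] \<epsilon> e0 by (intro powr_mono2') auto
      also have "\<dots> = \<epsilon>" using \<epsilon> e0 by (simp add: powr_powr)
      finally show ?thesis .
    qed
    then show "\<exists>N\<ge>1. \<forall>w. admissible A w \<and> length w \<ge> N \<longrightarrow> ?\<phi> w \<le> \<epsilon>" using n(1) by blast
  next
    fix n :: nat and x assume x: "n \<ge> 1" "x \<in> markov_shift A" "(shift ^^ n) x = x"
    let ?w = "map x [0..<n]" and ?S = "birkhoff_sum n (geometric_potential G \<rho>) x"
    have N: "N (elt ?w) > 0" using N1[OF admissible_map_markov_shift[OF x(2)]] by blast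
    have "exp (ln (c * N (elt ?w))) \<le> exp (?S / 2)" "exp (?S / 2) \<le> exp (ln (2 * N (elt ?w)))"
      using birkhoff_bounds[OF x] by simp_all
    then have bd: "c * N (elt ?w) \<le> exp (?S / 2)" "exp (?S / 2) \<le> 2 * N (elt ?w)"
      using N c_pos by simp_all
    have "1 / c \<le> 1 / c\<^sup>2" using c2 by (intro divide_left_mono) (auto simp: c_pos)
    also have "\<dots> \<le> 2 / c\<^sup>2" using c2 by (intro divide_right_mono) auto
    finally have "1 / c \<le> B" using B(1) by linarith
    moreover have "N (elt ?w) \<le> 1 / c * exp (?S / 2)" using bd(1) c_pos by (simp add: field_simps)
    ultimately have "N (elt ?w) \<le> B * exp (?S / 2)" by (intro B_ge[of _ "1 / c"]) auto
    then show "exp (- birkhoff_sum n (\<lambda>x. e * geometric_potential G \<rho> x) x) \<le> ?K * ?\<phi> ?w"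
      unfolding exp_birkhoff using N B e by (intro powr_neg_scaled) auto
    have "exp (?S / 2) \<le> B * N (elt ?w)" using B_ge[OF bd(2) B(3)] N by simp
    then show "?\<phi> ?w \<le> ?K * exp (- birkhoff_sum n (\<lambda>x. e * geometric_potential G \<rho> x) x)"
      unfolding exp_birkhoff using N B e by (intro powr_neg_scaled) auto
  qed
  then show ?thesis by blast
qed

section \<open>Ping-pong sets from the extended Schottky condition\<close>

lemma compact_nbhd_mem: "compact_nbhd C \<xi> \<Longrightarrow> \<xi> \<in> C"
  by (auto simp: compact_nbhd_def)

primrec label_elt :: "(nat \<Rightarrow> 'g) \<Rightarrow> (nat \<Rightarrow> 'g) \<Rightarrow> label \<Rightarrow> 'g" where
  "label_elt h p (Att i) = h i"
| "label_elt h p (Rep i) = h i"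
| "label_elt h p (Par i) = p i"

context disk_action
begin

lemma act_pow_in:
  assumes g: "g \<in> carrier G" and X: "X \<subseteq> sphere 0 1" "X \<inter> Y = {}"
    and map: "\<And>z. z \<in> sphere 0 1 \<Longrightarrow> z \<notin> Y \<Longrightarrow> act g z \<in> X"
    and z: "z \<in> sphere 0 1" "z \<notin> Y" and k: "k \<ge> 1"
  shows "act (g [^] (k::nat)) z \<in> X"
  using k
proof (induction k rule: dec_induct)
  case base
  then show ?case using map z g by simp
next
  case (step k)
  have "act (g [^] Suc k) z = act g (act (g [^] k) z)"
    unfolding nat_pow_Suc2[OF g] using g z by (intro act_mult(1)) auto
  moreover have "act (g [^] k) z \<in> sphere 0 1" "act (g [^] k) z \<notin> Y" using step.IH X by auto
  ultimately show ?case using map by simp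
qed

text \<open>For hyperbolic generators only the generator itself is known to map the complement of
  the repelling set \<open>Y\<close> into the attracting set \<open>X\<close>. Disjointness lets
  this be iterated, and reading it backwards shows that the inverse maps the complement of
  \<open>X\<close> into \<open>Y\<close>.\<close>

lemma act_int_pow_in:
  assumes g: "g \<in> carrier G" and XY: "X \<subseteq> sphere 0 1" "Y \<subseteq> sphere 0 1" "X \<inter> Y = {}"
    and map: "\<And>z. z \<in> sphere 0 1 \<Longrightarrow> z \<notin> Y \<Longrightarrow> act g z \<in> X"
    and z: "z \<in> sphere 0 1" "z \<notin> X \<union> Y" and n: "n \<noteq> 0"
  shows "act (g [^] (n::int)) z \<in> X \<union> Y"
proof -
  have inv: "act (inv g) z \<in> Y" if z: "z \<in> sphere 0 1" "z \<notin> X" for z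
  proof (rule ccontr)
    assume "act (inv g) z \<notin> Y"
    moreover have "act (inv g) z \<in> sphere 0 1" using norm_act(1)[of "inv g" z] g z by simp
    ultimately have "act g (act (inv g) z) \<in> X" by (intro map)
    then show False using act_inv(1)[OF g, of z] z by simp
  qed
  define k where "k = nat \<bar>n\<bar>"
  have k: "k \<ge> 1" using n by (simp add: k_def)
  have "n = int k \<or> n = - int k" by (auto simp: k_def)
  then show ?thesis
  proof
    assume "n = int k"
    then have "g [^] n = g [^] k" by (simp only: int_pow_int)
    then show ?thesis using act_pow_in[OF g XY(1,3) map z(1) _ k] z(2) by simp
  next
    assume "n = - int k"
    then have "g [^] n = inv g [^] k" using int_pow_neg_int[OF g] nat_pow_inv[OF g] by metis
    moreover have "Y \<inter> X = {}" using XY(3) by blast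
    ultimately show ?thesis
      using act_pow_in[OF inv_closed[OF g] XY(2) _ inv z(1) _ k] z(2) by simp
  qed
qed

lemma hyperbolic_or_parabolic_al:
  assumes "g \<in> carrier G"
  shows "hyperbolic (\<rho> g) \<or> parabolic (\<rho> g) \<Longrightarrow> \<bar>Re (al (\<rho> g))\<bar> \<ge> 1 \<and> M g > 0"
    and "parabolic (\<rho> g) \<Longrightarrow> \<bar>Re (al (\<rho> g))\<bar> = 1"
proof -
  have eq: "{z \<in> sphere 0 1. psl_act (\<rho> g) z = z} = {z \<in> sphere 0 1. mob (al (\<rho> g)) (be (\<rho> g)) z = z}"
    using act_eq[OF assms] by (simp add: act_def)
  show "\<bar>Re (al (\<rho> g))\<bar> \<ge> 1 \<and> M g > 0" if "hyperbolic (\<rho> g) \<or> parabolic (\<rho> g)"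
  proof -
    have "card {z \<in> sphere 0 1. psl_act (\<rho> g) z = z} \<noteq> 0"
      using that unfolding hyperbolic_def parabolic_def by (elim disjE conjE; linarith)
    then show ?thesis
      using fixpoints_nontrivial[OF su_rho[OF assms]] unfolding eq M_def by simp
  qed
  show "\<bar>Re (al (\<rho> g))\<bar> = 1" if "parabolic (\<rho> g)"
    using single_fixpoint[OF su_rho[OF assms]] that unfolding parabolic_def eq by blast
qed

lemma extended_schottky_action:
  assumes inj: "inj_on \<rho> (carrier G)" and disc: "discrete (\<Union>(\<rho> ` carrier G))"
    and A: "A = h ` {..<N1} \<union> p ` {..<N2}" "A \<subseteq> carrier G"
    and sch: "extended_schottky_generators N1 N2 (\<rho> \<circ> h) (\<rho> \<circ> p) \<Gamma>"
  shows "\<exists>D. schottky_action G \<rho> A D" "\<And>a. a \<in> A \<Longrightarrow> \<bar>Re (al (\<rho> a))\<bar> \<ge> 1 \<and> M a > 0"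
    "p 0 \<in> A" "\<bar>Re (al (\<rho> (p 0)))\<bar> = 1"
proof -
  define Lab where "Lab = Att ` {..<N1} \<union> Rep ` {..<N1} \<union> Par ` {..<N2}"
  obtain C where N: "N2 \<ge> 1" "N1 + N2 \<ge> 3"
    and hyp: "\<And>i. i < N1 \<Longrightarrow> hyperbolic (\<rho> (h i))" and par: "\<And>i. i < N2 \<Longrightarrow> parabolic (\<rho> (p i))"
    and h: "\<And>i. i < N1 \<Longrightarrow> compact_nbhd (C (Att i)) (attracting_fixpoint (\<rho> (h i))) \<and>
      compact_nbhd (C (Rep i)) (repelling_fixpoint (\<rho> (h i))) \<and>
      psl_act (\<rho> (h i)) ` (sphere 0 1 - C (Rep i)) \<subseteq> C (Att i)"
    and p: "\<And>i. i < N2 \<Longrightarrow> compact_nbhd (C (Par i)) (parabolic_fixpoint (\<rho> (p i))) \<and>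
      (\<forall>n::int. n \<noteq> 0 \<longrightarrow> psl_act (\<rho> (p i) [^]\<^bsub>PSL2R\<^esub> n) ` (sphere 0 1 - C (Par i)) \<subseteq> C (Par i))"
    and disj: "disjoint_family_on C Lab"
    using sch unfolding extended_schottky_generators_def Lab_def o_def by metis
  have hA: "h i \<in> A" if "i < N1" for i using that A by auto
  have pA: "p i \<in> A" if "i < N2" for i using that A by auto
  show pA0: "p 0 \<in> A" using pA N by simp
  show "\<bar>Re (al (\<rho> (p 0)))\<bar> = 1"
    using hyperbolic_or_parabolic_al(2)[of "p 0"] pA0 A(2) par[of 0] N by auto
  show "\<bar>Re (al (\<rho> a))\<bar> \<ge> 1 \<and> M a > 0" if "a \<in> A" for a
    using hyperbolic_or_parabolic_al(1)[of a] that A hyp par by auto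
  have C_disj: "C l \<inter> C l' = {}" if "l \<in> Lab" "l' \<in> Lab" "l \<noteq> l'" for l l'
    using disjoint_family_onD[OF disj that] .
  \<comment> \<open>Generators are given by indices, whereas \<open>A\<close> is a set. Disjointness
    of the labelled neighbourhoods excludes repetitions, so \<open>A\<close> really has
    \<open>N1 + N2\<close> elements.\<close>
  have inj_h: "inj_on h {..<N1}"
  proof (rule inj_onI, rule ccontr)
    fix i j assume ij: "i \<in> {..<N1}" "j \<in> {..<N1}" "h i = h j" "i \<noteq> j"
    then have "attracting_fixpoint (\<rho> (h i)) \<in> C (Att i) \<inter> C (Att j)"
      using h[of i] h[of j] compact_nbhd_mem by fastforce
    then show False using C_disj[of "Att i" "Att j"] ij by (auto simp: Lab_def)
  qed
  have inj_p: "inj_on p {..<N2}"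
  proof (rule inj_onI, rule ccontr)
    fix i j assume ij: "i \<in> {..<N2}" "j \<in> {..<N2}" "p i = p j" "i \<noteq> j"
    then have "parabolic_fixpoint (\<rho> (p i)) \<in> C (Par i) \<inter> C (Par j)"
      using p[of i] p[of j] compact_nbhd_mem by fastforce
    then show False using C_disj[of "Par i" "Par j"] ij by (auto simp: Lab_def)
  qed
  \<comment> \<open>A hyperbolic element has two fixed points on the circle, a parabolic one only
    one.\<close>
  have "h ` {..<N1} \<inter> p ` {..<N2} = {}"
  proof -
    have "h i \<noteq> p j" if "i < N1" "j < N2" for i j
      using hyp[OF that(1)] par[OF that(2)] by (auto simp: hyperbolic_def parabolic_def)
    then show ?thesis by blast
  qed
  then have "card A = N1 + N2"
    unfolding A(1) using inj_h inj_p by (simp add: card_Un_disjoint card_image)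
  then have card: "card A \<ge> 3" using N by simp
  define D where "D a = (\<Union>l\<in>{l \<in> Lab. label_elt h p l = a}. C l)" for a
  have C: "compact (C l)" "C l \<subseteq> sphere 0 1" if "l \<in> Lab" for l
    using that h p unfolding Lab_def compact_nbhd_def by blast+
  have finL: "finite Lab" by (simp add: Lab_def)
  have "schottky_action G \<rho> A D"
  proof
    show "inj_on \<rho> (carrier G)" "discrete (\<Union>(\<rho> ` carrier G))" "A \<subseteq> carrier G" "card A \<ge> 3"
      by (fact inj disc A(2) card)+
    show "finite A" by (simp add: A(1))
    fix a assume a: "a \<in> A"
    show "compact (D a)" unfolding D_def using finL C by (intro compact_UN) auto
    show "D a \<subseteq> sphere 0 1" unfolding D_def using C by blast
    from a consider i where "i < N1" "a = h i" | i where "i < N2" "a = p i" using A by auto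
    then show "D a \<noteq> {}"
    proof cases
      case 1
      then have "attracting_fixpoint (\<rho> a) \<in> C (Att i)" "Att i \<in> Lab"
        using h[of i] compact_nbhd_mem by (auto simp: Lab_def)
      then show ?thesis using 1 unfolding D_def by force
    next
      case 2
      then have "parabolic_fixpoint (\<rho> a) \<in> C (Par i)" "Par i \<in> Lab"
        using p[of i] compact_nbhd_mem by (auto simp: Lab_def)
      then show ?thesis using 2 unfolding D_def by force
    qed
    fix b assume "b \<in> A" "a \<noteq> b"
    then show "D a \<inter> D b = {}" unfolding D_def using C_disj by blast
  next
    fix a z and n :: int
    assume a: "a \<in> A" and n: "n \<noteq> 0" and z: "z \<in> sphere 0 1" "z \<notin> D a"
    have aG: "a \<in> carrier G" using a A by blast
    from a consider i where "i < N1" "a = h i" | i where "i < N2" "a = p i" using A by auto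
    then show "psl_act (\<rho> (a [^] n)) z \<in> D a"
    proof cases
      case 1
      have L: "Att i \<in> Lab" "Rep i \<in> Lab" using 1 by (auto simp: Lab_def)
      have sub: "C (Att i) \<union> C (Rep i) \<subseteq> D a" unfolding D_def using L 1 by force
      have "act (a [^] n) z \<in> C (Att i) \<union> C (Rep i)"
      proof (rule act_int_pow_in[OF aG C(2)[OF L(1)] C(2)[OF L(2)] C_disj[OF L] _ z(1) _ n])
        show "z \<notin> C (Att i) \<union> C (Rep i)" using z sub by blast
        fix y :: complex assume "y \<in> sphere 0 1" "y \<notin> C (Rep i)"
        then show "act a y \<in> C (Att i)" using h[OF 1(1)] 1(2) unfolding act_def by blast
      qed simp
      then show ?thesis using sub unfolding act_def by blast
    next
      case 2
      have "Par i \<in> Lab" using 2 by (auto simp: Lab_def)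
      then have sub: "C (Par i) \<subseteq> D a" unfolding D_def using 2 by force
      have "\<rho> (a [^] n) = \<rho> (p i) [^]\<^bsub>PSL2R\<^esub> n"
        using group_hom.hom_int_pow[OF group_hom_rho aG] 2 by simp
      moreover have "z \<in> sphere 0 1 - C (Par i)" using z sub by blast
      then have "psl_act (\<rho> (p i) [^]\<^bsub>PSL2R\<^esub> n) z \<in> C (Par i)" using p[OF 2(1)] n by blast
      ultimately show ?thesis using sub by auto
    qed
  qed
  then show "\<exists>D. schottky_action G \<rho> A D" by blast
qed

end

theorem lemma5:
  fixes S :: "'s::topological_space set" and x0 :: 's
    and G :: "('g, 'm) monoid_scheme"
    and \<rho>1 \<rho>2 :: "'g \<Rightarrow> (real^2^2) set"
    and N1 N2 :: nat and h p :: "nat \<Rightarrow> 'g"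
    and A :: "'g set"
    and \<tau> \<kappa> :: "(nat \<Rightarrow> 'g \<times> int) \<Rightarrow> real"
    and a b :: real
  assumes "surface S" and "euler_characteristic S < 0" and "x0 \<in> S"
    and "group G" and "G \<cong> fundamental_group S x0"
    and "fuchsian G \<rho>1" and "fuchsian G \<rho>2"
    and "boundary_preserving G \<rho>1 \<rho>2"
    and "A = h ` {..<N1} \<union> p ` {..<N2}" and "A \<subseteq> carrier G" and "generate G A = carrier G"
    and "extended_schottky_generators N1 N2 (\<rho>1 \<circ> h) (\<rho>1 \<circ> p) (\<rho>1 ` carrier G)"
    and "extended_schottky_generators N1 N2 (\<rho>2 \<circ> h) (\<rho>2 \<circ> p) (\<rho>2 ` carrier G)"
    and "\<tau> = geometric_potential G \<rho>1" and "\<kappa> = geometric_potential G \<rho>2"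
    and "(a, b) \<in> weight_quadrant"
  shows "\<exists>!t. t \<in> {1 / (2 * (a + b))<..} \<and>
           gurevich_pressure (markov_shift A) (\<lambda>x. - t * (a * \<tau> x + b * \<kappa> x)) = 0"
proof -
  have ab: "a \<ge> 0" "b \<ge> 0" "a + b > 0"
    using assms(16) by (auto simp: weight_quadrant_def)
  \<comment> \<open>Both representations are treated over the same alphabet \<open>A\<close> and
    with the same parabolic generator \<open>p 0\<close>; only then do the lower bounds for its
    powers multiply to the exponent \<open>a + b\<close>.\<close>
  have factor: "\<exists>\<phi> K. weight_factor A \<phi> K e (p 0) (\<lambda>x. e * geometric_potential G \<rho> x)"
    and A: "finite A" "card A \<ge> 3" "p 0 \<in> A"
    if \<rho>: "fuchsian G \<rho>" "extended_schottky_generators N1 N2 (\<rho> \<circ> h) (\<rho> \<circ> p) (\<rho> ` carrier G)"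
      and e: "e \<ge> 0" for \<rho> e
  proof -
    have disk: "disk_action G \<rho>"
      using \<rho>(1) assms(4) by (simp add: disk_action_def disk_action_axioms_def fuchsian_def)
    interpret disk_action G \<rho> by (rule disk)
    have fuchs: "inj_on \<rho> (carrier G)" "discrete (\<Union>(\<rho> ` carrier G))"
      using \<rho>(1) by (auto simp: fuchsian_def)
    note ext = extended_schottky_action[OF fuchs assms(9,10) \<rho>(2)]
    obtain D where "schottky_action G \<rho> A D" using ext(1) by blast
    then interpret S: schottky_action G \<rho> A D .
    show "\<exists>\<phi> K. weight_factor A \<phi> K e (p 0) (\<lambda>x. e * geometric_potential G \<rho> x)"
      using S.weight_factor_geometric[OF ext(2-4) e] by blast
    show "finite A" "card A \<ge> 3" "p 0 \<in> A" by (fact S.finite_A S.card_A ext(3))+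
  qed
  obtain \<phi>1 K1 where 1: "weight_factor A \<phi>1 K1 a (p 0) (\<lambda>x. a * \<tau> x)"
    using factor[OF assms(6,12) ab(1)] unfolding assms(14) by blast
  obtain \<phi>2 K2 where 2: "weight_factor A \<phi>2 K2 b (p 0) (\<lambda>x. b * \<kappa> x)"
    using factor[OF assms(7,13) ab(2)] unfolding assms(15) by blast
  have "word_potential A (\<lambda>w. \<phi>1 w * \<phi>2 w) (K1 * K2) (a + b) (p 0) (\<lambda>x. a * \<tau> x + b * \<kappa> x)"
    using word_potential_product[OF 1 2 A[OF assms(6,12) ab(1)] ab(3)] .
  then show ?thesis by (rule word_potential.unique_pressure_zero)
qed

end
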